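(* Let $[a,b]\subset\mathbb{R}$ be a finite segment, let $m,n,r\in\mathbb{N}$ and $1\le p\le\infty$. Let $A(\cdot)\in (W_p^{n-1})^{m\times m}$ and let $B\colon (W_p^n)^m\to\mathbb{C}^r$ be an arbitrary continuous linear operator. Put $Ly:=y'+A(\cdot)y$ for $y\in (W_p^n)^m$. Then the linear operator $$(L,B)\colon (W_p^n)^m\to (W_p^{n-1})^m\times\mathbb{C}^r,\qquad y\mapsto (Ly,By),$$ is a bounded Fredholm operator with index $m-r$.
   Context: $\mathbb{N}=\{1,2,\dots\}$ and $a<b$. $W_p^n:=W_p^n([a,b];\mathbb{C})$ is the complex Sobolev space on $[a,b]$ (functions whose derivatives up to order $n$ lie in $L_p$), with $W_p^0:=L_p$. $(W_p^n)^m:=W_p^n([a,b];\mathbb{C}^m)$ and $(W_p^n)^{m\times m}:=W_p^n([a,b];\mathbb{C}^{m\times m})$ are the spaces of vector-valued and matrix-valued functions whose entries lie in $W_p^n$; the norm $\|\cdot\|_{n,p}$ is the sum of the $W_p^n$-norms of the entries. Vectors are written as columns. A continuous linear operator $T\colon X\to Y$ between Banach spaces is called Fredholm if $\ker T$ and $Y/T(X)$ are finite-dimensional; its index is $\operatorname{ind}T:=\dim\ker T-\dim (Y/T(X))$. *)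

theory Defs
  imports "HOL-Probability.Essential_Supremum"
begin

section \<open>Complex vector spaces, Fredholm operators\<close>

class complex_vector = ab_group_add +
  fixes scaleC :: "complex \<Rightarrow> 'a \<Rightarrow> 'a"  (infixr \<open>*\<^sub>C\<close> 75)
  assumes scaleC_add_right: "c *\<^sub>C (x + y) = c *\<^sub>C x + c *\<^sub>C y"
    and scaleC_add_left: "(c + d) *\<^sub>C x = c *\<^sub>C x + d *\<^sub>C x"
    and scaleC_scaleC: "c *\<^sub>C d *\<^sub>C x = (c * d) *\<^sub>C x"
    and scaleC_one: "1 *\<^sub>C x = x"

global_interpretation complex_vector: vector_space "scaleC :: complex \<Rightarrow> 'a \<Rightarrow> 'a::complex_vector"
  by unfold_locales (fact scaleC_add_right scaleC_add_left scaleC_scaleC scaleC_one)+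

instantiation complex :: complex_vector
begin
definition scaleC_complex :: "complex \<Rightarrow> complex \<Rightarrow> complex" where
  "c *\<^sub>C z = c * z"
instance by standard (simp_all add: scaleC_complex_def algebra_simps)
end

instantiation prod :: (complex_vector, complex_vector) complex_vector
begin
definition scaleC_prod :: "complex \<Rightarrow> 'a \<times> 'b \<Rightarrow> 'a \<times> 'b" where
  "c *\<^sub>C v = (c *\<^sub>C fst v, c *\<^sub>C snd v)"
instance by standard
    (simp_all add: scaleC_prod_def scaleC_add_right scaleC_add_left scaleC_scaleC scaleC_one)
end

instantiation vec :: (complex_vector, finite) complex_vector
begin
definition scaleC_vec :: "complex \<Rightarrow> 'a ^ 'b \<Rightarrow> 'a ^ 'b" where
  "c *\<^sub>C v = (\<chi> i. c *\<^sub>C (v $ i))"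
instance by standard
    (simp_all add: scaleC_vec_def vec_eq_iff
       scaleC_add_right scaleC_add_left scaleC_scaleC scaleC_one)
end

text \<open>The Banach spaces below are subspaces \<open>X\<close> of some type of class \<^class>\<open>complex_vector\<close>,
  together with a norm \<open>nX\<close> that only matters on \<open>X\<close>; maps are only considered on \<open>X\<close>.\<close>

definition linear_operator ::
    "'a::complex_vector set \<Rightarrow> 'b::complex_vector set \<Rightarrow> ('a \<Rightarrow> 'b) \<Rightarrow> bool" where
  "linear_operator X Y T \<longleftrightarrow>
     T ` X \<subseteq> Y \<and>
     (\<forall>x\<in>X. \<forall>y\<in>X. T (x + y) = T x + T y) \<and>
     (\<forall>c. \<forall>x\<in>X. T (c *\<^sub>C x) = c *\<^sub>C T x)"

definition continuous_linear_operator ::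
    "'a::complex_vector set \<Rightarrow> ('a \<Rightarrow> real) \<Rightarrow> 'b::complex_vector set \<Rightarrow> ('b \<Rightarrow> real)
      \<Rightarrow> ('a \<Rightarrow> 'b) \<Rightarrow> bool" where
  "continuous_linear_operator X nX Y nY T \<longleftrightarrow>
     linear_operator X Y T \<and>
     (\<forall>x\<in>X. \<forall>\<epsilon>>0. \<exists>\<delta>>0. \<forall>y\<in>X. nX (y - x) < \<delta> \<longrightarrow> nY (T y - T x) < \<epsilon>)"

definition bounded_linear_operator ::
    "'a::complex_vector set \<Rightarrow> ('a \<Rightarrow> real) \<Rightarrow> 'b::complex_vector set \<Rightarrow> ('b \<Rightarrow> real)
      \<Rightarrow> ('a \<Rightarrow> 'b) \<Rightarrow> bool" where
  "bounded_linear_operator X nX Y nY T \<longleftrightarrow>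
     linear_operator X Y T \<and> (\<exists>C. \<forall>x\<in>X. nY (T x) \<le> C * nX x)"

definition finite_dimensional :: "'a::complex_vector set \<Rightarrow> bool" where
  "finite_dimensional V \<longleftrightarrow> (\<exists>S. finite S \<and> complex_vector.span S = V)"

text \<open>\<open>S\<close> is a finite set of representatives of a basis of the quotient space \<open>Y / V\<close>:
  their classes span \<open>Y / V\<close> and are linearly independent
  (in particular, pairwise distinct).\<close>

definition quotient_basis ::
    "'a::complex_vector set \<Rightarrow> 'a set \<Rightarrow> 'a set \<Rightarrow> bool" where
  "quotient_basis Y V S \<longleftrightarrow>
     finite S \<and> S \<subseteq> Y \<and>
     (\<forall>y\<in>Y. \<exists>c. y - (\<Sum>s\<in>S. c s *\<^sub>C s) \<in> V) \<and>
     (\<forall>c. (\<Sum>s\<in>S. c s *\<^sub>C s) \<in> V \<longrightarrow> (\<forall>s\<in>S. c s = 0))"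

definition finite_dimensional_quotient ::
    "'a::complex_vector set \<Rightarrow> 'a set \<Rightarrow> bool" where
  "finite_dimensional_quotient Y V \<longleftrightarrow> (\<exists>S. quotient_basis Y V S)"

definition dim_quotient :: "'a::complex_vector set \<Rightarrow> 'a set \<Rightarrow> nat" where
  "dim_quotient Y V = card (SOME S. quotient_basis Y V S)"

definition kernel ::
    "'a::complex_vector set \<Rightarrow> ('a \<Rightarrow> 'b::complex_vector) \<Rightarrow> 'a set" where
  "kernel X T = {x \<in> X. T x = 0}"

definition fredholm_operator ::
    "'a::complex_vector set \<Rightarrow> ('a \<Rightarrow> real) \<Rightarrow> 'b::complex_vector set \<Rightarrow> ('b \<Rightarrow> real)
      \<Rightarrow> ('a \<Rightarrow> 'b) \<Rightarrow> bool" where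
  "fredholm_operator X nX Y nY T \<longleftrightarrow>
     continuous_linear_operator X nX Y nY T \<and>
     finite_dimensional (kernel X T) \<and>
     finite_dimensional_quotient Y (T ` X)"

definition fredholm_index ::
    "'a::complex_vector set \<Rightarrow> 'b::complex_vector set \<Rightarrow> ('a \<Rightarrow> 'b) \<Rightarrow> int" where
  "fredholm_index X Y T =
     int (complex_vector.dim (kernel X T)) - int (dim_quotient Y (T ` X))"

section \<open>Classes of measurable functions\<close>

text \<open>Measurable functions on the line modulo equality almost everywhere. (Each Lebesgue
  measurable function is a.e. equal to a Borel one, so Borel representatives suffice.)
  Functions on \<open>[a, b]\<close> are identified with their extensions by zero.\<close>

quotient_type L0 = "real \<Rightarrow> complex" / partial:
  "\<lambda>f g. f \<in> borel_measurable lborel \<and> g \<in> borel_measurable lborel \<and> (AE x in lborel. f x = g x)"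
proof (rule part_equivpI)
  show "\<exists>f::real \<Rightarrow> complex. f \<in> borel_measurable lborel \<and> f \<in> borel_measurable lborel \<and>
      (AE x in lborel. f x = f x)"
    by (rule exI[of _ "\<lambda>_. 0"]) simp
qed (auto simp: symp_def transp_def elim: eventually_mono eventually_elim2)

instantiation L0 :: comm_ring_1
begin

lift_definition zero_L0 :: L0 is "\<lambda>_. 0" by simp
lift_definition one_L0 :: L0 is "\<lambda>_. 1" by simp
lift_definition plus_L0 :: "L0 \<Rightarrow> L0 \<Rightarrow> L0" is "\<lambda>f g x. f x + g x" by auto
lift_definition minus_L0 :: "L0 \<Rightarrow> L0 \<Rightarrow> L0" is "\<lambda>f g x. f x - g x" by auto
lift_definition uminus_L0 :: "L0 \<Rightarrow> L0" is "\<lambda>f x. - f x" by auto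
lift_definition times_L0 :: "L0 \<Rightarrow> L0 \<Rightarrow> L0" is "\<lambda>f g x. f x * g x" by auto

instance
proof
  have "\<not> (AE x in (lborel :: real measure). False)"
    by (simp add: AE_iff_measurable[OF _ refl])
  then show "(0::L0) \<noteq> 1"
    by transfer simp
qed (transfer; auto simp: algebra_simps)+

end

instantiation L0 :: complex_vector
begin
lift_definition scaleC_L0 :: "complex \<Rightarrow> L0 \<Rightarrow> L0" is "\<lambda>c f x. c * f x" by auto
instance by standard (transfer; auto simp: algebra_simps)+
end

section \<open>Lebesgue and Sobolev spaces on a segment\<close>

lift_definition in_Lp :: "real \<Rightarrow> real \<Rightarrow> ennreal \<Rightarrow> L0 \<Rightarrow> bool" is
  "\<lambda>a b p f. (AE x in lborel. x \<notin> {a..b} \<longrightarrow> f x = 0) \<and>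
     (if p = \<infinity> then esssup lborel (\<lambda>x. ennreal (cmod (f x))) < \<infinity>
      else integrable lborel (\<lambda>x. cmod (f x) powr enn2real p))"
proof -
  fix a b :: real and p :: ennreal and f g :: "real \<Rightarrow> complex"
  assume fg: "f \<in> borel_measurable lborel \<and> g \<in> borel_measurable lborel \<and> (AE x in lborel. f x = g x)"
  then have [measurable]: "f \<in> borel_measurable borel" "g \<in> borel_measurable borel"
    and ae: "AE x in lborel. f x = g x" by auto
  have "(AE x in lborel. x \<notin> {a..b} \<longrightarrow> f x = 0) \<longleftrightarrow> (AE x in lborel. x \<notin> {a..b} \<longrightarrow> g x = 0)"
    using ae by (auto elim: eventually_elim2)
  moreover have "esssup lborel (\<lambda>x. ennreal (cmod (f x))) = esssup lborel (\<lambda>x. ennreal (cmod (g x)))"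
    using ae by (intro esssup_AE_cong) auto
  moreover have "integrable lborel (\<lambda>x. cmod (f x) powr enn2real p) \<longleftrightarrow>
      integrable lborel (\<lambda>x. cmod (g x) powr enn2real p)"
    using ae by (intro integrable_cong_AE) auto
  ultimately show "((AE x in lborel. x \<notin> {a..b} \<longrightarrow> f x = 0) \<and>
     (if p = \<infinity> then esssup lborel (\<lambda>x. ennreal (cmod (f x))) < \<infinity>
      else integrable lborel (\<lambda>x. cmod (f x) powr enn2real p))) =
    ((AE x in lborel. x \<notin> {a..b} \<longrightarrow> g x = 0) \<and>
     (if p = \<infinity> then esssup lborel (\<lambda>x. ennreal (cmod (g x))) < \<infinity>
      else integrable lborel (\<lambda>x. cmod (g x) powr enn2real p)))" by simp
qed

lift_definition Lp_norm :: "ennreal \<Rightarrow> L0 \<Rightarrow> real" is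
  "\<lambda>p f. if p = \<infinity> then enn2real (esssup lborel (\<lambda>x. ennreal (cmod (f x))))
     else (LINT x|lborel. cmod (f x) powr enn2real p) powr (1 / enn2real p)"
proof -
  fix p :: ennreal and f g :: "real \<Rightarrow> complex"
  assume fg: "f \<in> borel_measurable lborel \<and> g \<in> borel_measurable lborel \<and> (AE x in lborel. f x = g x)"
  then have [measurable]: "f \<in> borel_measurable borel" "g \<in> borel_measurable borel"
    and ae: "AE x in lborel. f x = g x" by auto
  have "esssup lborel (\<lambda>x. ennreal (cmod (f x))) = esssup lborel (\<lambda>x. ennreal (cmod (g x)))"
    using ae by (intro esssup_AE_cong) auto
  moreover have "(LINT x|lborel. cmod (f x) powr enn2real p) = (LINT x|lborel. cmod (g x) powr enn2real p)"
    using ae by (intro integral_cong_AE) auto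
  ultimately show "(if p = \<infinity> then enn2real (esssup lborel (\<lambda>x. ennreal (cmod (f x))))
     else (LINT x|lborel. cmod (f x) powr enn2real p) powr (1 / enn2real p)) =
    (if p = \<infinity> then enn2real (esssup lborel (\<lambda>x. ennreal (cmod (g x))))
     else (LINT x|lborel. cmod (g x) powr enn2real p) powr (1 / enn2real p))" by simp
qed

text \<open>\<open>\<phi>\<close> is a continuously differentiable function with compact support in the open
  interval \<open>(a, b)\<close>, and \<open>\<phi>'\<close> is its derivative. Integration by parts against these is
  equivalent to integration by parts against smooth \<open>\<phi>\<close>.\<close>

definition test_function :: "real \<Rightarrow> real \<Rightarrow> (real \<Rightarrow> real) \<Rightarrow> (real \<Rightarrow> real) \<Rightarrow> bool" where
  "test_function a b \<phi> \<phi>' \<longleftrightarrow>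
     (\<forall>x. (\<phi> has_real_derivative \<phi>' x) (at x)) \<and> continuous_on UNIV \<phi>' \<and>
     (\<exists>c d. a < c \<and> d < b \<and> (\<forall>x. x \<notin> {c..d} \<longrightarrow> \<phi> x = 0))"

text \<open>Both integrals converge because \<open>f\<close> and \<open>g\<close> will be in \<open>L\<^sub>1\<close>;
  see \<open>has_derivative_L1\<close>.\<close>

lift_definition integrates_by_parts :: "real \<Rightarrow> real \<Rightarrow> L0 \<Rightarrow> L0 \<Rightarrow> bool" is
  "\<lambda>a b f g. \<forall>\<phi> \<phi>'. test_function a b \<phi> \<phi>' \<longrightarrow>
     (LINT x|lborel. \<phi>' x *\<^sub>R f x) = - (LINT x|lborel. \<phi> x *\<^sub>R g x)"
proof -
  fix a b :: real and f f1 g g1 :: "real \<Rightarrow> complex"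
  assume "f \<in> borel_measurable lborel \<and> f1 \<in> borel_measurable lborel \<and> (AE x in lborel. f x = f1 x)"
    and "g \<in> borel_measurable lborel \<and> g1 \<in> borel_measurable lborel \<and> (AE x in lborel. g x = g1 x)"
  then have [measurable]: "f \<in> borel_measurable borel" "f1 \<in> borel_measurable borel"
      "g \<in> borel_measurable borel" "g1 \<in> borel_measurable borel"
    and ae: "AE x in lborel. f x = f1 x" "AE x in lborel. g x = g1 x" by auto
  have "(LINT x|lborel. \<phi>' x *\<^sub>R f x) = (LINT x|lborel. \<phi>' x *\<^sub>R f1 x) \<and>
      (LINT x|lborel. \<phi> x *\<^sub>R g x) = (LINT x|lborel. \<phi> x *\<^sub>R g1 x)"
    if "test_function a b \<phi> \<phi>'" for \<phi> \<phi>'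
  proof -
    have "continuous_on UNIV \<phi>'" "continuous_on UNIV \<phi>"
      using that by (auto simp: test_function_def intro!: DERIV_continuous_on)
    then have [measurable]: "\<phi> \<in> borel_measurable borel" "\<phi>' \<in> borel_measurable borel"
      by (auto intro: borel_measurable_continuous_onI)
    show ?thesis
      using ae by (intro conjI integral_cong_AE) auto
  qed
  then show "(\<forall>\<phi> \<phi>'. test_function a b \<phi> \<phi>' \<longrightarrow>
       (LINT x|lborel. \<phi>' x *\<^sub>R f x) = - (LINT x|lborel. \<phi> x *\<^sub>R g x)) =
     (\<forall>\<phi> \<phi>'. test_function a b \<phi> \<phi>' \<longrightarrow>
       (LINT x|lborel. \<phi>' x *\<^sub>R f1 x) = - (LINT x|lborel. \<phi> x *\<^sub>R g1 x))"
    by simp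
qed

text \<open>The generalized derivative on \<open>(a, b)\<close>. It is unique when it exists, because the
  elements of \<open>L\<^sub>1\<close> vanish outside \<open>[a, b]\<close>.\<close>

definition has_derivative_L1 :: "real \<Rightarrow> real \<Rightarrow> L0 \<Rightarrow> L0 \<Rightarrow> bool" where
  "has_derivative_L1 a b f g \<longleftrightarrow> in_Lp a b 1 f \<and> in_Lp a b 1 g \<and> integrates_by_parts a b f g"

definition derivative_L1 :: "real \<Rightarrow> real \<Rightarrow> L0 \<Rightarrow> L0" where
  "derivative_L1 a b f = (THE g. has_derivative_L1 a b f g)"

primrec sobolev :: "real \<Rightarrow> real \<Rightarrow> ennreal \<Rightarrow> nat \<Rightarrow> L0 set" where
  "sobolev a b p 0 = {f. in_Lp a b p f}"
| "sobolev a b p (Suc n) =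
     {f. in_Lp a b p f \<and> (\<exists>g. has_derivative_L1 a b f g \<and> g \<in> sobolev a b p n)}"

definition sobolev_norm :: "real \<Rightarrow> real \<Rightarrow> ennreal \<Rightarrow> nat \<Rightarrow> L0 \<Rightarrow> real" where
  "sobolev_norm a b p n f = (\<Sum>k\<le>n. Lp_norm p ((derivative_L1 a b ^^ k) f))"

definition sobolev_vec :: "real \<Rightarrow> real \<Rightarrow> ennreal \<Rightarrow> nat \<Rightarrow> (L0 ^ 'm) set" where
  "sobolev_vec a b p n = {y. \<forall>i. y $ i \<in> sobolev a b p n}"

definition sobolev_vec_norm :: "real \<Rightarrow> real \<Rightarrow> ennreal \<Rightarrow> nat \<Rightarrow> L0 ^ 'm \<Rightarrow> real" where
  "sobolev_vec_norm a b p n y = (\<Sum>i\<in>UNIV. sobolev_norm a b p n (y $ i))"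

definition sobolev_mat :: "real \<Rightarrow> real \<Rightarrow> ennreal \<Rightarrow> nat \<Rightarrow> (L0 ^ 'm ^ 'm) set" where
  "sobolev_mat a b p n = {A. \<forall>i j. A $ i $ j \<in> sobolev a b p n}"

definition diff_op :: "real \<Rightarrow> real \<Rightarrow> L0 ^ 'm ^ 'm \<Rightarrow> L0 ^ 'm \<Rightarrow> L0 ^ 'm" where
  "diff_op a b A y = (\<chi> i. derivative_L1 a b (y $ i)) + A *v y"

end

theory Submission
  imports Defs
begin

text \<open>Adding finitely many scalar conditions to a surjective operator \<open>L\<close> with an \<open>m\<close>-dimensional
  kernel gives an operator \<open>(L, B)\<close> of index \<open>m - r\<close>, whatever the linear map \<open>B\<close> into \<open>\<complex>\<^sup>r\<close> is:
  everything that \<open>(L, B)\<close> does is decided by the restriction of \<open>B\<close> to \<open>ker L\<close>, a linear map between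
  spaces of dimensions \<open>m\<close> and \<open>r\<close>. This is \<open>index_of_augmented_surjection\<close>. It remains to see that
  \<open>L y = y' + A y\<close> is bounded from \<open>W\<^sub>p\<^sup>n\<close> onto \<open>W\<^sub>p\<^sup>n\<^sup>-\<^sup>1\<close> and that its kernel has dimension \<open>m\<close>.

  The generalized derivative is made concrete first: a class \<open>f\<close> has the derivative \<open>g\<close> in \<open>L\<^sub>1\<close> iff it is
  represented on \<open>[a, b]\<close> by a constant plus the primitive of \<open>g\<close> (\<open>has_derivative_ac\<close> and
  \<open>has_derivative_imp_ac\<close>). One direction is Fubini's theorem on a triangle, which also gives the product
  rule; the other is the lemma of du Bois-Reymond.

  By this description, \<open>y' + A y = f\<close> with the initial value \<open>c\<close> is the integral equation
  \<open>y(t) = c + \<integral>\<^sub>a\<^sup>t (f - A y)\<close>. The coefficients are only integrable, but the Picard operator is still a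
  contraction of the bounded continuous functions in a suitable weighted supremum norm. So there is exactly
  one solution for all \<open>c\<close> and \<open>f\<close>, and \<open>c \<mapsto> y\<close> is, for \<open>f = 0\<close>, an isomorphism of \<open>\<complex>\<^sup>m\<close> onto the
  solutions of the homogeneous equation. Products of Sobolev functions (\<open>sobolev_mult\<close>) yield the
  boundedness of \<open>L\<close>, and they put the solutions into \<open>W\<^sub>p\<^sup>n\<close> when \<open>A\<close> and \<open>f\<close> have entries in
  \<open>W\<^sub>p\<^sup>n\<^sup>-\<^sup>1\<close>.\<close>

section \<open>Linear algebra of the index\<close>

lemma linear_operator_add:
  "linear_operator X Y T \<Longrightarrow> x \<in> X \<Longrightarrow> y \<in> X \<Longrightarrow> T (x + y) = T x + T y"
  and linear_operator_scale:
  "linear_operator X Y T \<Longrightarrow> x \<in> X \<Longrightarrow> T (c *\<^sub>C x) = c *\<^sub>C T x"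
  by (auto simp: linear_operator_def)

lemma linear_operator_zero:
  assumes "linear_operator X Y T" "complex_vector.subspace X"
  shows "T 0 = 0"
  using linear_operator_scale[OF assms(1) complex_vector.subspace_0[OF assms(2)], of 0]
  by simp

lemma linear_operator_diff:
  assumes "linear_operator X Y T" "complex_vector.subspace X" "x \<in> X" "y \<in> X"
  shows "T (x - y) = T x - T y"
  using linear_operator_add[OF assms(1), of "x - y" y] assms
    complex_vector.subspace_diff[OF assms(2), of x y] by simp

lemma linear_operator_sum:
  assumes "linear_operator X Y T" "complex_vector.subspace X" "finite S" "S \<subseteq> X"
  shows "T (\<Sum>s\<in>S. c s *\<^sub>C s) = (\<Sum>s\<in>S. c s *\<^sub>C T s)"
  using assms(3,4)
proof (induction S rule: finite_induct)
  case empty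
  show ?case using linear_operator_zero[OF assms(1,2)] by simp
next
  case (insert s S)
  have "(\<Sum>s\<in>S. c s *\<^sub>C s) \<in> X" "c s *\<^sub>C s \<in> X"
    using insert.prems
    by (auto intro!: complex_vector.subspace_sum[OF assms(2)] complex_vector.subspace_scale[OF assms(2)])
  then show ?case
    using insert by (simp add: linear_operator_add[OF assms(1)] linear_operator_scale[OF assms(1)])
qed

lemma subspace_kernel:
  assumes "linear_operator X Y T" "complex_vector.subspace X"
  shows "complex_vector.subspace (kernel X T)"
  using assms(2)
  by (intro complex_vector.subspaceI)
     (auto simp: kernel_def linear_operator_zero[OF assms] linear_operator_add[OF assms(1)]
        linear_operator_scale[OF assms(1)] complex_vector.subspace_0
        complex_vector.subspace_add complex_vector.subspace_scale)

lemma subspace_image: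
  assumes T: "linear_operator X Y T" and X: "complex_vector.subspace X"
  shows "complex_vector.subspace (T ` X)"
proof (intro complex_vector.subspaceI)
  show "0 \<in> T ` X"
    using linear_operator_zero[OF assms] complex_vector.subspace_0[OF X] by (metis image_eqI)
qed (auto simp: linear_operator_add[OF T, symmetric] linear_operator_scale[OF T, symmetric]
       complex_vector.subspace_add[OF X] complex_vector.subspace_scale[OF X])

text \<open>The exchange argument modulo \<open>V\<close>: an element of \<open>S\<close> is congruent to a combination of
  \<open>S'\<close>, and these combinations stay independent because a dependence between them would
  be one between the classes of the elements of \<open>S\<close>.\<close>

lemma quotient_basis_card_le:
  assumes V: "complex_vector.subspace V"
    and S: "quotient_basis Y V S" and S': "quotient_basis Y V S'"
  shows "card S \<le> card S'"
proof -
  have fin: "finite S" "finite S'" and SY: "S \<subseteq> Y"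
    and ind: "\<And>c s. (\<Sum>s\<in>S. c s *\<^sub>C s) \<in> V \<Longrightarrow> s \<in> S \<Longrightarrow> c s = 0"
    using S S' by (auto simp: quotient_basis_def)
  have "\<forall>s\<in>S. \<exists>u \<in> complex_vector.span S'. s - u \<in> V"
    using S' SY unfolding quotient_basis_def
    by (blast intro: complex_vector.span_sum complex_vector.span_scale complex_vector.span_base)
  then obtain u where u: "\<And>s. s \<in> S \<Longrightarrow> u s \<in> complex_vector.span S'"
      "\<And>s. s \<in> S \<Longrightarrow> s - u s \<in> V"
    by metis
  have lift: "c s = 0" if "(\<Sum>s\<in>S. c s *\<^sub>C u s) = 0" "s \<in> S" for c s
  proof -
    have "(\<Sum>s\<in>S. c s *\<^sub>C s) = (\<Sum>s\<in>S. c s *\<^sub>C (s - u s))"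
      using that(1) by (simp add: complex_vector.scale_right_diff_distrib sum_subtractf)
    also have "\<dots> \<in> V"
      using u(2) V by (intro complex_vector.subspace_sum complex_vector.subspace_scale) auto
    finally show ?thesis using ind that(2) by blast
  qed
  have inj: "inj_on u S"
  proof (rule inj_onI, rule ccontr)
    fix s t assume st: "s \<in> S" "t \<in> S" "u s = u t" "s \<noteq> t"
    define c where "c = (\<lambda>x. if x = s then 1 else if x = t then - 1 else 0 :: complex)"
    have "(\<Sum>x\<in>S. c x *\<^sub>C u x) = (\<Sum>x\<in>{s, t}. c x *\<^sub>C u x)"
      using fin st by (intro sum.mono_neutral_right) (auto simp: c_def)
    also have "\<dots> = 0" using st by (simp add: c_def complex_vector.scale_minus_left)
    finally have "c s = 0" using lift st by blast
    then show False by (simp add: c_def)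
  qed
  have "complex_vector.independent (u ` S)"
  proof (rule complex_vector.independent_if_scalars_zero)
    fix f x assume "(\<Sum>x\<in>u ` S. f x *\<^sub>C x) = 0" "x \<in> u ` S"
    then show "f x = 0"
      using lift[of "f \<circ> u"] by (auto simp: sum.reindex[OF inj])
  qed (use fin in auto)
  then have "card (u ` S) \<le> card S'"
    using complex_vector.independent_span_bound[of S' "u ` S"] fin u(1) by auto
  then show ?thesis by (simp add: card_image[OF inj])
qed

lemma dim_quotient_eq_card:
  assumes "complex_vector.subspace V" "quotient_basis Y V S"
  shows "dim_quotient Y V = card S"
proof -
  have "quotient_basis Y V (SOME S. quotient_basis Y V S)"
    using assms(2) by (rule someI)
  then show ?thesis
    unfolding dim_quotient_def
    using quotient_basis_card_le[OF assms(1)] assms(2) by (meson antisym)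
qed

text \<open>Hence the dimension theory of \<open>(*s)\<close> on \<open>complex ^ 'n\<close> applies.\<close>

lemma scaleC_vec_eq: "(scaleC :: complex \<Rightarrow> complex ^ 'n \<Rightarrow> _) = (*s)"
  by (auto simp: fun_eq_iff scaleC_vec_def scaleC_complex_def vec_eq_iff)

lemma span_complex_vec: "complex_vector.span (S :: (complex ^ 'n) set) = vec.span S"
  and dependent_complex_vec: "complex_vector.dependent (S :: (complex ^ 'n) set) = vec.dependent S"
  by (simp_all add: scaleC_vec_eq)

lemma card_basis_complex_vec:
  fixes E :: "(complex ^ 'n) set"
  assumes "complex_vector.independent E" "complex_vector.span E = UNIV"
  shows "finite E" "card E = CARD('n)"
proof -
  have "vec.independent E" "vec.span E = UNIV"
    using assms by (simp_all add: span_complex_vec dependent_complex_vec)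
  then show "finite E" "card E = CARD('n)"
    using vec.finiteI_independent vec.dim_eq_card[of E UNIV]
    by (auto simp: vec.dim_UNIV card_cart_basis)
qed

lemma independent_disjoint_sums:
  assumes ind: "complex_vector.independent (P \<union> Q)" and fin: "finite P" "finite Q" and disj: "P \<inter> Q = {}"
    and eq: "(\<Sum>p\<in>P. c p *\<^sub>C p) \<in> complex_vector.span Q" and p: "p \<in> P"
  shows "c p = 0"
proof -
  obtain d where d: "(\<Sum>p\<in>P. c p *\<^sub>C p) = (\<Sum>q\<in>Q. d q *\<^sub>C q)"
    using eq by (auto simp: complex_vector.span_finite[OF fin(2)])
  define e where "e = (\<lambda>x. if x \<in> P then c x else - d x)"
  have "(\<Sum>x\<in>P \<union> Q. e x *\<^sub>C x) = (\<Sum>x\<in>P. e x *\<^sub>C x) + (\<Sum>x\<in>Q. e x *\<^sub>C x)"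
    by (rule sum.union_disjoint[OF fin disj])
  also have "(\<Sum>x\<in>P. e x *\<^sub>C x) = (\<Sum>p\<in>P. c p *\<^sub>C p)"
    by (rule sum.cong) (auto simp: e_def)
  also have "(\<Sum>x\<in>Q. e x *\<^sub>C x) = (\<Sum>x\<in>Q. - (d x *\<^sub>C x))"
    using disj by (intro sum.cong) (auto simp: e_def complex_vector.scale_minus_left)
  finally have "(\<Sum>x\<in>P \<union> Q. e x *\<^sub>C x) = 0" using d by (simp add: sum_negf)
  then have "e p = 0"
    using complex_vector.independentD[OF ind _ subset_refl, of e p] fin p by auto
  then show ?thesis using p by (simp add: e_def)
qed

text \<open>Let \<open>K\<close> be a basis of \<open>ker L \<inter> ker B\<close>, extended by \<open>E1\<close> to one of \<open>ker L\<close>. Then \<open>B ` E1\<close> is a basis of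
  \<open>B (ker L)\<close>; extend it by \<open>N\<close> to one of \<open>\<complex>\<^sup>r\<close>. As \<open>L\<close> is onto, the range of \<open>(L, B)\<close> meets every class
  modulo \<open>{0} \<times> \<complex>\<^sup>r\<close>, and it meets \<open>{0} \<times> \<complex>\<^sup>r\<close> in \<open>{0} \<times> B (ker L)\<close>, so \<open>N\<close> represents a basis of the quotient. The index is
  \<open>card K - card N = (m - card E1) - (r - card E1)\<close>.\<close>

theorem index_of_augmented_surjection:
  fixes B :: "'a::complex_vector \<Rightarrow> complex ^ 'r" and L :: "'a \<Rightarrow> 'b::complex_vector"
  assumes X: "complex_vector.subspace X"
    and L: "linear_operator X Z L" and onto: "L ` X = Z"
    and B: "linear_operator X UNIV B"
    and E: "finite E" "complex_vector.independent E" "complex_vector.span E = kernel X L"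
  defines "T \<equiv> \<lambda>y. (L y, B y)"
  shows "finite_dimensional (kernel X T)"
    and "finite_dimensional_quotient (Z \<times> UNIV) (T ` X)"
    and "fredholm_index X (Z \<times> UNIV) T = int (card E) - int CARD('r)"
proof -
  have T: "linear_operator X (Z \<times> UNIV) T"
    using L B by (auto simp: linear_operator_def T_def scaleC_prod_def)
  have kerT: "kernel X T = {x \<in> kernel X L. B x = 0}"
    by (auto simp: kernel_def T_def zero_prod_def)
  have subT: "complex_vector.subspace (kernel X T)" and subL: "complex_vector.subspace (kernel X L)"
    using subspace_kernel[OF T X] subspace_kernel[OF L X] .
  have kerX: "kernel X L \<subseteq> X" by (auto simp: kernel_def)
  have BK: "linear_operator (kernel X L) UNIV B"
    using B kerX by (auto simp: linear_operator_def subset_iff)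
  obtain K where K: "K \<subseteq> kernel X T" "complex_vector.independent K" "kernel X T \<subseteq> complex_vector.span K"
    by (rule complex_vector.maximal_independent_subset)
  have spanK: "complex_vector.span K = kernel X T"
    by (rule complex_vector.span_subspace[OF K(1,3) subT])
  have "K \<subseteq> kernel X L" using K(1) kerT by auto
  then obtain E' where E': "K \<subseteq> E'" "E' \<subseteq> kernel X L" "complex_vector.independent E'"
      "kernel X L \<subseteq> complex_vector.span E'"
    by (rule complex_vector.maximal_independent_subset_extend[OF _ K(2)])
  have spanE': "complex_vector.span E' = kernel X L"
    by (rule complex_vector.span_subspace[OF E'(2,4) subL])
  have finE': "finite E'"
    using complex_vector.independent_span_bound[OF E(1) E'(3)] E'(2) E(3) by auto
  have cardE': "card E' = card E"
    by (metis E(2,3) E'(3) spanE' complex_vector.dim_span_eq_card_independent)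
  define E1 where "E1 = E' - K"
  have finK: "finite K" and finE1: "finite E1" and E1: "E1 \<subseteq> kernel X L"
    using finE' E'(1,2) finite_subset by (auto simp: E1_def)
  have unE: "E1 \<union> K = E'" "E1 \<inter> K = {}" using E'(1) by (auto simp: E1_def)
  \<comment> \<open>A combination of \<open>E1\<close> killed by \<open>B\<close> lies in the kernel of \<open>T\<close>, which \<open>K\<close> spans.\<close>
  have indB: "c e = 0" if "(\<Sum>e\<in>E1. c e *\<^sub>C B e) = 0" "e \<in> E1" for c e
  proof (rule independent_disjoint_sums[of E1 K c e])
    have "(\<Sum>e\<in>E1. c e *\<^sub>C e) \<in> kernel X L"
      using E1 by (intro complex_vector.subspace_sum[OF subL] complex_vector.subspace_scale[OF subL]) auto
    moreover have "B (\<Sum>e\<in>E1. c e *\<^sub>C e) = 0"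
      using linear_operator_sum[OF BK subL finE1 E1] that(1) by simp
    ultimately show "(\<Sum>e\<in>E1. c e *\<^sub>C e) \<in> complex_vector.span K"
      by (simp add: spanK kerT)
  qed (use unE E'(3) finK finE1 that(2) in auto)
  have injB: "inj_on B E1"
  proof (rule inj_onI, rule ccontr)
    fix s t assume st: "s \<in> E1" "t \<in> E1" "B s = B t" "s \<noteq> t"
    define c where "c = (\<lambda>x. if x = s then 1 else if x = t then - 1 else 0 :: complex)"
    have "(\<Sum>x\<in>E1. c x *\<^sub>C B x) = (\<Sum>x\<in>{s, t}. c x *\<^sub>C B x)"
      using finE1 st by (intro sum.mono_neutral_right) (auto simp: c_def)
    also have "\<dots> = 0" using st by (simp add: c_def complex_vector.scale_minus_left)
    finally have "c s = 0" using indB st by blast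
    then show False by (simp add: c_def)
  qed
  define F where "F = B ` E1"
  have indF: "complex_vector.independent F"
  proof (rule complex_vector.independent_if_scalars_zero)
    fix f x assume "(\<Sum>x\<in>F. f x *\<^sub>C x) = 0" "x \<in> F"
    then show "f x = 0"
      using indB[of "f \<circ> B"] by (auto simp: F_def sum.reindex[OF injB])
  qed (use finE1 in \<open>auto simp: F_def\<close>)
  have spanF: "complex_vector.span F = B ` kernel X L"
  proof
    show "complex_vector.span F \<subseteq> B ` kernel X L"
      using E1 subspace_image[OF BK subL]
      by (intro complex_vector.span_minimal) (auto simp: F_def)
    show "B ` kernel X L \<subseteq> complex_vector.span F"
    proof safe
      fix y assume "y \<in> kernel X L"
      then obtain c where "y = (\<Sum>e\<in>E'. c e *\<^sub>C e)"
        using spanE' complex_vector.span_finite[OF finE'] by auto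
      then have "B y = (\<Sum>e\<in>E'. c e *\<^sub>C B e)"
        using linear_operator_sum[OF BK subL finE' E'(2)] by simp
      also have "\<dots> \<in> complex_vector.span F"
      proof (intro complex_vector.span_sum complex_vector.span_scale)
        fix e assume "e \<in> E'"
        show "B e \<in> complex_vector.span F"
        proof (cases "e \<in> K")
          case True
          then have "B e = 0" using K(1) kerT by auto
          then show ?thesis by (simp add: complex_vector.span_zero)
        qed (use \<open>e \<in> E'\<close> in \<open>auto simp: F_def E1_def intro!: complex_vector.span_base\<close>)
      qed
      finally show "B y \<in> complex_vector.span F" .
    qed
  qed
  define F' where "F' = complex_vector.extend_basis F"
  have F': "F \<subseteq> F'" "complex_vector.independent F'" "complex_vector.span F' = UNIV"
    using complex_vector.extend_basis_superset[OF indF] complex_vector.independent_extend_basis[OF indF]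
      complex_vector.span_extend_basis[OF indF] by (simp_all add: F'_def)
  note finF' = card_basis_complex_vec[OF F'(2,3)]
  define N where "N = F' - F"
  have unF: "N \<union> F = F'" "N \<inter> F = {}" and finN: "finite N" "finite F"
    using F'(1) finF'(1) finite_subset by (auto simp: N_def)
  define S where "S = (\<lambda>v. (0 :: 'b, v)) ` N"
  have sumS: "(\<Sum>s\<in>S. c s *\<^sub>C s) = (0, \<Sum>v\<in>N. c (0, v) *\<^sub>C v)" for c
  proof -
    have inj: "inj_on (\<lambda>v. (0 :: 'b, v)) N" by (simp add: inj_on_def)
    show ?thesis
      by (simp add: S_def sum.reindex[OF inj] scaleC_prod_def sum_prod)
  qed
  have Z: "complex_vector.subspace Z" using subspace_image[OF L X] onto by simp
  have qb: "quotient_basis (Z \<times> UNIV) (T ` X) S"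
    unfolding quotient_basis_def
  proof (intro conjI ballI allI impI)
    show "finite S" "S \<subseteq> Z \<times> UNIV"
      using finN Z by (auto simp: S_def complex_vector.subspace_0)
  next
    fix y :: "'b \<times> (complex ^ 'r)" assume "y \<in> Z \<times> UNIV"
    then obtain x d where x: "x \<in> X" "y = (L x, d)" using onto by auto
    have "d - B x \<in> complex_vector.span (F \<union> N)" using F'(3) unF by (simp add: Un_commute)
    then obtain f g where fg: "d - B x = f + g" "f \<in> complex_vector.span F" "g \<in> complex_vector.span N"
      unfolding complex_vector.span_Un by auto
    then obtain k c where k: "k \<in> kernel X L" "f = B k" and c: "g = (\<Sum>v\<in>N. c v *\<^sub>C v)"
      using spanF complex_vector.span_finite[OF finN(1)] by auto
    have kX: "k \<in> X" "L k = 0" using k by (auto simp: kernel_def)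
    have "d = B x + B k + g" using fg(1) k(2) by (simp add: algebra_simps)
    then have "y - (\<Sum>s\<in>S. c (snd s) *\<^sub>C s) = T (x + k)"
      by (simp add: sumS T_def x c linear_operator_add[OF L x(1) kX(1)]
          linear_operator_add[OF B x(1) kX(1)] kX(2))
    moreover have "x + k \<in> X" using x(1) kX(1) by (rule complex_vector.subspace_add[OF X])
    ultimately show "\<exists>c. y - (\<Sum>s\<in>S. c s *\<^sub>C s) \<in> T ` X"
      by (intro exI[of _ "\<lambda>s. c (snd s)"] image_eqI)
  next
    fix c s assume "(\<Sum>s\<in>S. c s *\<^sub>C s) \<in> T ` X" "s \<in> S"
    then obtain x v where x: "x \<in> X" "L x = 0" "B x = (\<Sum>v\<in>N. c (0, v) *\<^sub>C v)"
      and v: "v \<in> N" "s = (0, v)"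
      unfolding sumS by (auto simp: T_def S_def)
    have "(\<Sum>v\<in>N. c (0, v) *\<^sub>C v) \<in> complex_vector.span F"
      using x by (auto simp: spanF kernel_def x(3)[symmetric])
    then show "c s = 0"
      using independent_disjoint_sums[of N F "\<lambda>v. c (0, v)" v] unF F'(2) finN v by auto
  qed
  have "card S = card N" by (simp add: S_def card_image inj_on_def)
  then have dimQ: "dim_quotient (Z \<times> UNIV) (T ` X) = card N"
    using dim_quotient_eq_card[OF subspace_image[OF T X] qb] by simp
  have dimK: "complex_vector.dim (kernel X T) = card K"
    using complex_vector.dim_span_eq_card_independent[OF K(2)] spanK by simp
  have "card N + card F = CARD('r)"
    using card_Un_disjoint[OF finN unF(2)] unF finF' by simp
  moreover have "card E1 + card K = card E"
    using card_Un_disjoint[OF finE1 finK unE(2)] unE cardE' by simp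
  moreover have "card F = card E1" by (simp add: F_def card_image injB)
  ultimately show "fredholm_index X (Z \<times> UNIV) T = int (card E) - int CARD('r)"
    by (simp add: fredholm_index_def dimQ dimK)
  show "finite_dimensional (kernel X T)"
    using finK spanK by (auto simp: finite_dimensional_def)
  show "finite_dimensional_quotient (Z \<times> UNIV) (T ` X)"
    using qb by (auto simp: finite_dimensional_quotient_def)
qed

section \<open>Primitives of integrable functions\<close>

text \<open>Integrating from \<open>-\<infinity>\<close> needs no base point: functions on \<open>[a, b]\<close> are extended by zero, so
  their primitives vanish at \<open>a\<close>.\<close>

definition primitive :: "(real \<Rightarrow> 'e::{banach, second_countable_topology}) \<Rightarrow> real \<Rightarrow> 'e" where
  "primitive g x = (LINT t|lborel. indicator {..x} t *\<^sub>R g t)"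

lemma integrable_atMost:
  fixes g :: "real \<Rightarrow> 'e::{banach, second_countable_topology}"
  assumes "integrable lborel g"
  shows "integrable lborel (\<lambda>t. indicator {..x} t *\<^sub>R g t)"
  by (rule integrable_mult_indicator[OF _ assms]) simp

lemma norm_primitive_le:
  assumes "integrable lborel g"
  shows "norm (primitive g x) \<le> (LINT t|lborel. norm (g t))"
  unfolding primitive_def
  by (rule order_trans[OF integral_norm_bound])
     (intro integral_mono integrable_norm integrable_atMost assms, auto simp: indicator_def)

lemma primitive_diff_le:
  assumes "integrable lborel g"
  shows "norm (primitive g x - primitive g y) \<le> (LINT t|lborel. norm (g t))"
proof -
  have "primitive g x - primitive g y =
      (LINT t|lborel. indicator {..x} t *\<^sub>R g t - indicator {..y} t *\<^sub>R g t)"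
    unfolding primitive_def
    by (rule Bochner_Integration.integral_diff[symmetric]; rule integrable_atMost[OF assms])
  also have "norm \<dots> \<le> (LINT t|lborel. norm (indicator {..x} t *\<^sub>R g t - indicator {..y} t *\<^sub>R g t))"
    by (rule integral_norm_bound)
  also have "\<dots> \<le> (LINT t|lborel. norm (g t))"
    by (intro integral_mono integrable_norm Bochner_Integration.integrable_diff
        integrable_atMost assms) (auto simp: indicator_def)
  finally show ?thesis .
qed

lemma primitive_add:
  assumes "integrable lborel f" "integrable lborel g"
  shows "primitive (\<lambda>t. f t + g t) x = primitive f x + primitive g x"
  unfolding primitive_def
  by (simp add: scaleR_add_right integrable_atMost assms)

lemma primitive_diff:
  assumes "integrable lborel f" "integrable lborel g"
  shows "primitive (\<lambda>t. f t - g t) x = primitive f x - primitive g x"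
  unfolding primitive_def
  by (simp add: scaleR_diff_right integrable_atMost assms)

lemma primitive_mult_left: "primitive (\<lambda>t. c * g t) x = (c :: complex) * primitive g x"
  unfolding primitive_def by (simp flip: mult_scaleR_right)

lemma primitive_cong_AE:
  assumes "f \<in> borel_measurable lborel" "g \<in> borel_measurable lborel" "AE t in lborel. f t = g t"
  shows "primitive f x = primitive g x"
  unfolding primitive_def
  using assms by (intro integral_cong_AE) auto

lemma isCont_primitive:
  assumes g: "integrable lborel g"
  shows "isCont (primitive g) x"
proof (rule continuous_at_sequentiallyI)
  fix u assume u: "u \<longlonglongrightarrow> x"
  have [measurable]: "g \<in> borel_measurable borel" using g by auto
  show "(\<lambda>n. primitive g (u n)) \<longlonglongrightarrow> primitive g x"
    unfolding primitive_def
  proof (rule integral_dominated_convergence[where w="\<lambda>t. norm (g t)"])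
    show "AE t in lborel. (\<lambda>n. indicator {..u n} t *\<^sub>R g t) \<longlonglongrightarrow> indicator {..x} t *\<^sub>R g t"
      using AE_lborel_singleton[of x]
    proof eventually_elim
      fix t assume "t \<noteq> x"
      then have "eventually (\<lambda>n. t \<le> u n \<longleftrightarrow> t \<le> x) sequentially"
        using order_tendstoD(1)[OF u, of t] order_tendstoD(2)[OF u, of t]
        by (cases "t < x") (auto elim!: eventually_mono)
      then have "eventually (\<lambda>n. indicator {..u n} t *\<^sub>R g t = indicator {..x} t *\<^sub>R g t) sequentially"
        by eventually_elim (auto simp: indicator_def)
      then show "(\<lambda>n. indicator {..u n} t *\<^sub>R g t) \<longlonglongrightarrow> indicator {..x} t *\<^sub>R g t"
        by (rule tendsto_eventually)
    qed
  qed (use g in \<open>auto simp: indicator_def\<close>)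
qed

lemma continuous_on_primitive: "integrable lborel g \<Longrightarrow> continuous_on S (primitive g)"
  by (intro continuous_at_imp_continuous_on ballI isCont_primitive)

lemma borel_measurable_primitive: "integrable lborel g \<Longrightarrow> primitive g \<in> borel_measurable borel"
  by (intro borel_measurable_continuous_onI continuous_on_primitive)

lemma integrable_bounded_mult:
  fixes f g :: "real \<Rightarrow> complex"
  assumes f: "integrable lborel f" and g: "g \<in> borel_measurable borel" and bd: "\<And>x. cmod (g x) \<le> C"
  shows "integrable lborel (\<lambda>x. f x * g x)"
proof (rule Bochner_Integration.integrable_bound)
  show "integrable lborel (\<lambda>x. C * cmod (f x))" using f by auto
  show "(\<lambda>x. f x * g x) \<in> borel_measurable lborel" using f g by auto
  show "AE x in lborel. norm (f x * g x) \<le> norm (C * cmod (f x))"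
  proof (rule AE_I2)
    fix x
    have "cmod (f x) * cmod (g x) \<le> cmod (f x) * \<bar>C\<bar>"
      by (intro mult_left_mono order_trans[OF bd]) auto
    then show "norm (f x * g x) \<le> norm (C * cmod (f x))"
      by (simp add: norm_mult abs_mult mult.commute)
  qed
qed

lemma integrable_mult_primitive:
  assumes "integrable lborel f" "integrable lborel (g :: real \<Rightarrow> complex)"
  shows "integrable lborel (\<lambda>x. f x * primitive g x)"
  using assms norm_primitive_le by (intro integrable_bounded_mult borel_measurable_primitive)

text \<open>The plane \<open>\<real> \<times> \<real>\<close> is split along the diagonal into two half-planes, and the order of
  integration is exchanged in one of them. Both the weak derivative of a primitive and the product rule
  are special cases.\<close>

lemma primitive_by_parts:
  fixes u v :: "real \<Rightarrow> complex"
  assumes u: "integrable lborel u" and v: "integrable lborel v"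
  shows "(LINT s|lborel. u s * primitive v s) + (LINT t|lborel. v t * primitive u t) =
      (LINT s|lborel. u s) * (LINT t|lborel. v t)"
proof -
  have [measurable]: "u \<in> borel_measurable borel" "v \<in> borel_measurable borel" using u v by auto
  define f where "f = (\<lambda>s t. indicator {s..} t *\<^sub>R (u s * v t))"
  have f_eq: "f s t = (if s \<le> t then u s * v t else 0)" for s t
    by (simp add: f_def)
  have int_f: "integrable (lborel \<Otimes>\<^sub>M lborel) (case_prod f)"
  proof (rule lborel_pair.Fubini_integrable)
    show m: "case_prod f \<in> borel_measurable (lborel \<Otimes>\<^sub>M lborel)"
      unfolding f_eq by measurable
    have "integrable lborel (\<lambda>s. cmod (u s) * (LINT t|lborel. cmod (v t)))"
      using u by simp
    then show "integrable lborel (\<lambda>s. LINT t|lborel. norm (case (s, t) of (s, t) \<Rightarrow> f s t))"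
    proof (rule Bochner_Integration.integrable_bound)
      show "AE s in lborel. norm (LINT t|lborel. norm (case (s, t) of (s, t) \<Rightarrow> f s t))
          \<le> norm (cmod (u s) * (LINT t|lborel. cmod (v t)))"
      proof (rule AE_I2)
        fix s
        have "(LINT t|lborel. norm (f s t)) \<le> (LINT t|lborel. cmod (u s) * cmod (v t))"
          using v by (intro integral_mono_AE') (auto simp: f_eq norm_mult)
        also have "\<dots> = cmod (u s) * (LINT t|lborel. cmod (v t))" by simp
        finally show "norm (LINT t|lborel. norm (case (s, t) of (s, t) \<Rightarrow> f s t))
          \<le> norm (cmod (u s) * (LINT t|lborel. cmod (v t)))"
          by simp
      qed
    qed (use m in measurable)
    show "AE s in lborel. integrable lborel (\<lambda>t. case (s, t) of (s, t) \<Rightarrow> f s t)"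
      using v by (auto simp: f_def intro!: integrable_mult_indicator)
  qed
  have "(LINT s|lborel. u s * primitive v s) + (LINT s|lborel. LINT t|lborel. f s t) =
      (LINT s|lborel. u s * primitive v s + (LINT t|lborel. f s t))"
    using lborel_pair.integrable_fst'[OF int_f] integrable_mult_primitive[OF u v]
    by (simp add: case_prod_unfold)
  also have "\<dots> = (LINT s|lborel. u s * (LINT t|lborel. v t))"
  proof (rule Bochner_Integration.integral_cong[OF refl])
    fix s
    have "primitive v s + (LINT t|lborel. indicator {s..} t *\<^sub>R v t) =
        (LINT t|lborel. indicator {..s} t *\<^sub>R v t + indicator {s..} t *\<^sub>R v t)"
      unfolding primitive_def using v
      by (intro Bochner_Integration.integral_add[symmetric] integrable_mult_indicator) auto
    also have "\<dots> = (LINT t|lborel. v t)"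
      using AE_lborel_singleton[of s]
      by (intro integral_cong_AE) (auto simp: indicator_def elim!: eventually_mono)
    finally show "u s * primitive v s + (LINT t|lborel. f s t) = u s * (LINT t|lborel. v t)"
      by (simp add: f_def distrib_left[symmetric] mult_scaleR_right[symmetric] del: mult_scaleR_right)
  qed
  also have "(LINT s|lborel. LINT t|lborel. f s t) = (LINT t|lborel. LINT s|lborel. f s t)"
    using lborel_pair.Fubini_integral[OF int_f] by simp
  also have "(\<lambda>t. LINT s|lborel. f s t) = (\<lambda>t. v t * primitive u t)"
  proof
    fix t
    have "f s t = v t * (indicator {..t} s *\<^sub>R u s)" for s
      by (simp add: f_eq)
    then show "(LINT s|lborel. f s t) = v t * primitive u t"
      unfolding primitive_def by (simp only: integral_mult_right_zero)
  qed
  finally show ?thesis by simp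
qed

text \<open>The product rule for absolutely continuous functions: \<open>primitive_by_parts\<close> for \<open>f\<close> and \<open>g\<close>
  cut off at \<open>x\<close>, with the contributions of the constants added.\<close>

lemma primitive_product:
  fixes f g :: "real \<Rightarrow> complex" and c d :: complex
  assumes f: "integrable lborel f" and g: "integrable lborel g"
  defines "F \<equiv> \<lambda>x. c + primitive f x" and "G \<equiv> \<lambda>x. d + primitive g x"
  shows "integrable lborel (\<lambda>t. f t * G t + F t * g t)"
    and "F x * G x = c * d + primitive (\<lambda>t. f t * G t + F t * g t) x"
proof -
  have fg: "integrable lborel (\<lambda>t. f t * primitive g t)" and gf: "integrable lborel (\<lambda>t. g t * primitive f t)"
    using integrable_mult_primitive f g by blast+
  have eq: "f t * G t + F t * g t =
      (f t * d + g t * c) + (f t * primitive g t + g t * primitive f t)" for t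
    by (simp add: F_def G_def algebra_simps)
  show "integrable lborel (\<lambda>t. f t * G t + F t * g t)"
    unfolding eq using f g fg gf by (intro Bochner_Integration.integrable_add) auto
  define u where "u = (\<lambda>t. indicator {..x} t *\<^sub>R f t)"
  define v where "v = (\<lambda>t. indicator {..x} t *\<^sub>R g t)"
  have uv: "integrable lborel u" "integrable lborel v"
    unfolding u_def v_def using f g by (auto intro: integrable_atMost)
  have pr: "primitive u t = primitive f t" "primitive v t = primitive g t" if "t \<le> x" for t
    using that unfolding primitive_def u_def v_def
    by (auto intro!: Bochner_Integration.integral_cong simp: indicator_def)
  have "primitive f x * primitive g x = (LINT s|lborel. u s) * (LINT t|lborel. v t)"
    by (simp add: primitive_def u_def v_def)
  also have "\<dots> = (LINT s|lborel. u s * primitive v s) + (LINT t|lborel. v t * primitive u t)"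
    by (rule primitive_by_parts[OF uv, symmetric])
  also have "(\<lambda>s. u s * primitive v s) = (\<lambda>t. indicator {..x} t *\<^sub>R (f t * primitive g t))"
    by (auto simp: fun_eq_iff u_def indicator_def pr)
  also have "(\<lambda>s. v s * primitive u s) = (\<lambda>t. indicator {..x} t *\<^sub>R (g t * primitive f t))"
    by (auto simp: fun_eq_iff v_def indicator_def pr)
  finally have "primitive (\<lambda>t. f t * primitive g t) x + primitive (\<lambda>t. g t * primitive f t) x =
      primitive f x * primitive g x"
    by (simp add: primitive_def)
  moreover have "primitive (\<lambda>t. f t * G t + F t * g t) x = d * primitive f x + c * primitive g x +
      (primitive (\<lambda>t. f t * primitive g t) x + primitive (\<lambda>t. g t * primitive f t) x)"
  proof -
    have i: "integrable lborel (\<lambda>t. d * f t)" "integrable lborel (\<lambda>t. c * g t)" using f g by auto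
    show ?thesis
      unfolding eq using i fg gf
      by (simp add: primitive_add Bochner_Integration.integrable_add mult.commute[of _ c] mult.commute[of _ d] primitive_mult_left)
  qed
  ultimately show "F x * G x = c * d + primitive (\<lambda>t. f t * G t + F t * g t) x"
    by (simp add: F_def G_def algebra_simps)
qed

lemma test_function_derivative_zero:
  assumes "test_function a b \<phi> \<phi>'"
  obtains c d where "a < c" "d < b" "\<And>x. x \<notin> {c..d} \<Longrightarrow> \<phi> x = 0" "\<And>x. x \<notin> {c..d} \<Longrightarrow> \<phi>' x = 0"
proof -
  obtain c d where cd: "a < c" "d < b" "\<And>x. x \<notin> {c..d} \<Longrightarrow> \<phi> x = 0"
    and D: "\<And>x. (\<phi> has_real_derivative \<phi>' x) (at x)"
    using assms unfolding test_function_def by blast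
  have "\<phi>' x = 0" if "x \<notin> {c..d}" for x
  proof -
    have "eventually (\<lambda>y. y \<in> - {c..d}) (nhds x)"
      using that by (intro eventually_nhds_in_open) auto
    then have "eventually (\<lambda>y. \<phi> y = 0) (nhds x)"
      by eventually_elim (use cd in auto)
    then have "(\<phi> has_real_derivative 0) (at x) \<longleftrightarrow> ((\<lambda>_. 0) has_real_derivative 0) (at x)"
      by (intro DERIV_cong_ev) auto
    then show ?thesis using D[of x] DERIV_unique by auto
  qed
  with cd that show ?thesis by blast
qed

lemma integrable_compact_support:
  fixes f :: "real \<Rightarrow> 'e::{banach, second_countable_topology}"
  assumes "continuous_on UNIV f" "\<And>x. x \<notin> {c..d} \<Longrightarrow> f x = 0"
  shows "integrable lborel f"
proof -
  have "integrable lborel (\<lambda>x. indicator {c..d} x *\<^sub>R f x)"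
    by (intro borel_integrable_compact) (auto intro: continuous_on_subset[OF assms(1)])
  also have "(\<lambda>x. indicator {c..d} x *\<^sub>R f x) = f"
    using assms(2) by (force simp: fun_eq_iff indicator_def)
  finally show ?thesis .
qed

lemma test_function_primitive:
  assumes "test_function a b \<phi> \<phi>'"
  shows "integrable lborel \<phi>'" "primitive \<phi>' x = \<phi> x" "(LINT t|lborel. \<phi>' t) = 0"
proof -
  obtain c d where cd: "a < c" "d < b" "\<And>x. x \<notin> {c..d} \<Longrightarrow> \<phi> x = 0" "\<And>x. x \<notin> {c..d} \<Longrightarrow> \<phi>' x = 0"
    using test_function_derivative_zero[OF assms] by blast
  have D: "(\<phi> has_real_derivative \<phi>' x) (at x)" for x
    using assms by (auto simp: test_function_def)
  have cont: "continuous_on UNIV \<phi>'"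
    using assms by (auto simp: test_function_def)
  have FTC: "(LINT t|lborel. indicator {u..v} t *\<^sub>R \<phi>' t) = \<phi> v - \<phi> u" if "u \<le> v" for u v
    using that D cont by (intro integral_FTC_atLeastAtMost)
      (auto simp: has_real_derivative_iff_has_vector_derivative intro: has_vector_derivative_at_within continuous_on_subset)
  show "integrable lborel \<phi>'" by (rule integrable_compact_support[OF cont cd(4)])
  show "primitive \<phi>' x = \<phi> x"
  proof (cases "x < c")
    case True
    then have "(\<lambda>t. indicator {..x} t *\<^sub>R \<phi>' t) = (\<lambda>t. 0)"
      using cd(4) by (force simp: fun_eq_iff indicator_def)
    then show ?thesis using cd(3) True by (simp add: primitive_def)
  next
    case False
    have "(\<lambda>t. indicator {..x} t *\<^sub>R \<phi>' t) = (\<lambda>t. indicator {c - 1..x} t *\<^sub>R \<phi>' t)"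
      using cd(4) by (force simp: fun_eq_iff indicator_def)
    then show ?thesis using FTC[of "c - 1" x] False cd(3)[of "c - 1"] by (simp add: primitive_def)
  qed
  have "\<phi>' = (\<lambda>t. indicator {c - 1..max c d + 1} t *\<^sub>R \<phi>' t)"
    using cd(4) by (force simp: fun_eq_iff indicator_def)
  then have "(LINT t|lborel. \<phi>' t) = \<phi> (max c d + 1) - \<phi> (c - 1)"
    using FTC[of "c - 1" "max c d + 1"] by simp
  also have "\<phi> (max c d + 1) = 0" by (rule cd(3)) (auto simp: max_def)
  also have "\<phi> (c - 1) = 0" by (rule cd(3)) auto
  finally show "(LINT t|lborel. \<phi>' t) = 0" by simp
qed

text \<open>This is \<open>primitive_by_parts\<close> for \<open>\<phi>'\<close> and \<open>g\<close>: the product of the integrals and the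
  contribution of \<open>c\<close> vanish, because \<open>\<phi>'\<close> has integral zero.\<close>

lemma primitive_weak_derivative:
  fixes g :: "real \<Rightarrow> complex"
  assumes \<phi>: "test_function a b \<phi> \<phi>'" and g: "integrable lborel g"
  shows "(LINT x|lborel. \<phi>' x *\<^sub>R (c + primitive g x)) = - (LINT x|lborel. \<phi> x *\<^sub>R g x)"
proof -
  note t = test_function_primitive[OF \<phi>]
  define u where "u = (\<lambda>x. complex_of_real (\<phi>' x))"
  have u: "integrable lborel u" using t(1) by (simp add: u_def)
  have pu: "primitive u x = complex_of_real (\<phi> x)" for x
    unfolding t(2)[symmetric] primitive_def u_def integral_complex_of_real[symmetric]
    by (simp add: scaleR_conv_of_real)
  have "(LINT x|lborel. u x * primitive g x) + (LINT x|lborel. g x * primitive u x) = 0"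
    unfolding primitive_by_parts[OF u g] using t(3) by (simp add: u_def)
  moreover have "(LINT x|lborel. \<phi>' x *\<^sub>R (c + primitive g x)) = (LINT x|lborel. u x * c + u x * primitive g x)"
    by (simp add: u_def scaleR_conv_of_real algebra_simps)
  moreover have "\<dots> = (LINT x|lborel. u x * c) + (LINT x|lborel. u x * primitive g x)"
    using u integrable_mult_primitive[OF u g] by (intro Bochner_Integration.integral_add) auto
  moreover have "(LINT x|lborel. u x * c) = 0" using u t(3) by (simp add: u_def)
  ultimately show ?thesis
    by (simp add: pu scaleR_conv_of_real mult.commute[of "g _"] add_eq_0_iff)
qed

section \<open>The lemma of du Bois-Reymond\<close>

text \<open>Almost every value of \<open>h\<close> is the limit of the averages of \<open>h\<close> over short intervals.\<close>

lemma AE_eq_const_of_averages: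
  fixes h :: "real \<Rightarrow> complex"
  assumes h: "integrable lborel h"
    and avg: "\<And>c d. a < c \<Longrightarrow> c < d \<Longrightarrow> d < b \<Longrightarrow> (LINT x|lborel. indicator {c..d} x *\<^sub>R h x) = (d - c) *\<^sub>R C"
  shows "AE x in lborel. x \<in> {a<..<b} \<longrightarrow> h x = C"
proof -
  have int: "set_integrable lborel {c..d} h" for c d
    unfolding set_integrable_def by (rule integrable_mult_indicator[OF _ h]) simp
  obtain N where N: "negligible N" and lim:
    "\<And>x e. x \<notin> N \<Longrightarrow> 0 < e \<Longrightarrow> \<exists>d>0. \<forall>k. 0 < k \<and> k < d \<longrightarrow>
        norm (integral (cbox x (x + k *\<^sub>R One)) h /\<^sub>R k ^ DIM(real) - h x) < e"
    using integrable_ccontinuous_explicit[of h] set_borel_integral_eq_integral(1)[OF int]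
    unfolding cbox_interval by blast
  have "h x = C" if x: "x \<notin> N" "a < x" "x < b" for x
  proof (rule ccontr)
    assume "h x \<noteq> C"
    then obtain d where d: "d > 0" and near: "\<And>k. 0 < k \<Longrightarrow> k < d \<Longrightarrow>
        norm (integral {x..x + k} h /\<^sub>R k - h x) < norm (C - h x)"
      using lim[OF x(1), of "norm (C - h x)"] by auto
    define k where "k = min d (b - x) / 2"
    have k: "0 < k" "k < d" "x + k < b" using d x by (auto simp: k_def min_def field_simps)
    have "integral {x..x + k} h = k *\<^sub>R C"
      using set_borel_integral_eq_integral(2)[OF int[of x "x + k"]] avg[of x "x + k"] x k
      by (simp add: set_lebesgue_integral_def)
    then show False using near[OF k(1,2)] k(1) by simp
  qed
  then have sub: "{x. \<not> (x \<in> {a<..<b} \<longrightarrow> h x = C)} \<subseteq> N" by auto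
  have "AE x in lebesgue. x \<in> {a<..<b} \<longrightarrow> h x = C"
    by (rule AE_I'[of N]) (use N sub in \<open>auto simp: negligible_iff_null_sets\<close>)
  then show ?thesis by (simp add: AE_completion_iff)
qed

text \<open>An antiderivative of \<open>\<psi>\<close> is constant on either side of the support, and the two constants agree
  because \<open>\<psi>\<close> has integral zero; subtracting their value leaves a test function.\<close>

lemma continuous_test_function:
  assumes cont: "continuous_on UNIV \<psi>" and supp: "\<And>x. x \<notin> {c..d} \<Longrightarrow> \<psi> x = 0"
    and cd: "a < c" "c \<le> d" "d < b" and zero: "(LINT x|lborel. \<psi> x) = 0"
  obtains \<phi> where "test_function a b \<phi> \<psi>"
proof -
  have "isCont \<psi> x" for x using cont by (simp add: continuous_on_eq_continuous_at)
  then obtain F where F: "\<And>x. (F has_vector_derivative \<psi> x) (at x)"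
    using einterval_antiderivative[of "-\<infinity>" \<infinity> \<psi>] by auto
  have FTC: "(LINT t|lborel. indicator {u..v} t *\<^sub>R \<psi> t) = F v - F u" if "u \<le> v" for u v
    using that F cont by (intro integral_FTC_atLeastAtMost)
      (auto intro: has_vector_derivative_at_within continuous_on_subset)
  have low: "F x = F c" if "x < c" for x
  proof -
    have "(\<lambda>t. indicator {x..c} t *\<^sub>R \<psi> t) = (\<lambda>t. if t = c then \<psi> c else 0)"
      using that supp by (force simp: fun_eq_iff indicator_def)
    moreover have "(LINT t|lborel. (if t = c then \<psi> c else 0)) = (LINT (t::real)|lborel. (0::real))"
    proof (rule integral_cong_AE)
      show "AE t in lborel. (if t = c then \<psi> c else 0) = 0"
        using AE_lborel_singleton[of c] by eventually_elim simp
    qed simp_all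
    ultimately show ?thesis using FTC[of x c] that by simp
  qed
  have high: "F x = F c" if "d < x" for x
  proof -
    have "(LINT t|lborel. indicator {c..x} t *\<^sub>R \<psi> t) = (LINT t|lborel. \<psi> t)"
      using supp that by (intro Bochner_Integration.integral_cong) (force simp: indicator_def)+
    then show ?thesis using FTC[of c x] that cd zero by simp
  qed
  have "test_function a b (\<lambda>x. F x - F c) \<psi>"
    unfolding test_function_def
  proof (intro conjI allI)
    fix x
    show "((\<lambda>x. F x - F c) has_real_derivative \<psi> x) (at x)"
      using F[of x] unfolding has_real_derivative_iff_has_vector_derivative
      by (auto intro!: derivative_eq_intros)
  next
    have "F x - F c = 0" if "x \<notin> {c..d}" for x
      using that low[of x] high[of x] by (cases "x < c") auto
    then show "\<exists>u v. a < u \<and> v < b \<and> (\<forall>x. x \<notin> {u..v} \<longrightarrow> F x - F c = 0)"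
      using cd by blast
  qed (rule cont)
  then show ?thesis by (rule that)
qed

text \<open>Continuous approximations from below of the indicator function of \<open>[c, d]\<close>. Since they are
  supported in \<open>[c, d]\<close>, they can be used for intervals arbitrarily close to the boundary of \<open>(a, b)\<close>.\<close>

definition trapezoid :: "real \<Rightarrow> real \<Rightarrow> nat \<Rightarrow> real \<Rightarrow> real" where
  "trapezoid c d n x = max 0 (min 1 (min (real n * (x - c)) (real n * (d - x))))"

lemma continuous_trapezoid: "continuous_on UNIV (trapezoid c d n)"
  unfolding trapezoid_def by (intro continuous_intros)

lemma trapezoid_bounds: "0 \<le> trapezoid c d n x" "trapezoid c d n x \<le> 1"
  by (auto simp: trapezoid_def)

lemma trapezoid_outside: "x \<notin> {c..d} \<Longrightarrow> trapezoid c d n x = 0"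
  unfolding trapezoid_def
  by (rule max_absorb1, cases "x < c") (auto simp: min_le_iff_disj mult_le_0_iff)

lemma trapezoid_le_indicator: "trapezoid c d n x \<le> indicator {c..d} x"
  using trapezoid_bounds(2) trapezoid_outside by (auto simp: indicator_def)

lemma trapezoid_tendsto:
  assumes "x \<noteq> c" "x \<noteq> d"
  shows "(\<lambda>n. trapezoid c d n x) \<longlonglongrightarrow> indicator {c..d} x"
proof (cases "x \<in> {c..d}")
  case True
  then have pos: "x - c > 0" "d - x > 0" using assms by auto
  have "eventually (\<lambda>n. real n * (x - c) \<ge> 1) sequentially"
    "eventually (\<lambda>n. real n * (d - x) \<ge> 1) sequentially"
    using pos by real_asymp+
  then have "eventually (\<lambda>n. trapezoid c d n x = 1) sequentially"
    by eventually_elim (simp add: trapezoid_def)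
  then show ?thesis using True by (auto intro: tendsto_eventually)
qed (simp add: trapezoid_outside)

lemma integral_trapezoid_tendsto:
  fixes h :: "real \<Rightarrow> complex"
  assumes "integrable lborel h"
  shows "(\<lambda>n. LINT x|lborel. trapezoid c d n x *\<^sub>R h x) \<longlonglongrightarrow> (LINT x|lborel. indicator {c..d} x *\<^sub>R h x)"
proof (rule integral_dominated_convergence[where w="\<lambda>x. norm (h x)"])
  have [measurable]: "h \<in> borel_measurable borel" "trapezoid c d n \<in> borel_measurable borel" for n
    using assms continuous_trapezoid by (auto intro: borel_measurable_continuous_onI)
  show "(\<lambda>x. indicator {c..d} x *\<^sub>R h x) \<in> borel_measurable lborel"
    "\<And>n. (\<lambda>x. trapezoid c d n x *\<^sub>R h x) \<in> borel_measurable lborel" by measurable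
  show "AE x in lborel. (\<lambda>n. trapezoid c d n x *\<^sub>R h x) \<longlonglongrightarrow> indicator {c..d} x *\<^sub>R h x"
    using AE_lborel_singleton[of c] AE_lborel_singleton[of d]
    by eventually_elim (intro tendsto_scaleR trapezoid_tendsto tendsto_const)
  show "AE x in lborel. norm (trapezoid c d n x *\<^sub>R h x) \<le> norm (h x)" for n
    using trapezoid_bounds[of c d n] by (auto intro!: mult_left_le_one_le)
qed (use assms in auto)

lemma integral_trapezoid_measure_tendsto:
  assumes "c \<le> d"
  shows "(\<lambda>n. LINT x|lborel. trapezoid c d n x) \<longlonglongrightarrow> d - c"
proof -
  have [measurable]: "trapezoid c d n \<in> borel_measurable borel" for n
    using continuous_trapezoid by (auto intro: borel_measurable_continuous_onI)
  have "(\<lambda>n. LINT x|lborel. trapezoid c d n x) \<longlonglongrightarrow> (LINT x|lborel. indicator {c..d} x)"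
  proof (rule integral_dominated_convergence[where w="indicator {c..d}"])
    show "AE x in lborel. (\<lambda>n. trapezoid c d n x) \<longlonglongrightarrow> indicator {c..d} x"
      using AE_lborel_singleton[of c] AE_lborel_singleton[of d]
      by eventually_elim (rule trapezoid_tendsto)
  qed (use assms trapezoid_bounds trapezoid_le_indicator in \<open>auto simp: integrable_indicator_iff\<close>)
  then show ?thesis using assms by simp
qed

text \<open>A combination of two trapezoids with integral zero is the derivative of a test function. In the
  limit this says that \<open>h\<close> has the same average over any two subintervals.\<close>

lemma du_Bois_Reymond:
  fixes h :: "real \<Rightarrow> complex"
  assumes ab: "a < b" and h: "integrable lborel h"
    and weak: "\<And>\<phi> \<phi>'. test_function a b \<phi> \<phi>' \<Longrightarrow> (LINT x|lborel. \<phi>' x *\<^sub>R h x) = 0"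
  obtains C where "AE x in lborel. x \<in> {a<..<b} \<longrightarrow> h x = C"
proof -
  define I where "I c d = (LINT x|lborel. indicator {c..d} x *\<^sub>R h x)" for c d
  define J where "J c d n = (LINT x|lborel. trapezoid c d n x *\<^sub>R h x)" for c d n
  define M where "M c d n = (LINT x|lborel. trapezoid c d n x)" for c d n
  have int: "integrable lborel (trapezoid c d n)" for c d n
    by (rule integrable_compact_support[OF continuous_trapezoid trapezoid_outside])
  have inth: "integrable lborel (\<lambda>x. trapezoid c d n x *\<^sub>R h x)" for c d n
  proof (rule Bochner_Integration.integrable_bound[OF integrable_norm[OF h]])
    show "(\<lambda>x. trapezoid c d n x *\<^sub>R h x) \<in> borel_measurable lborel"
      using h int[of c d n] by auto
    show "AE x in lborel. norm (trapezoid c d n x *\<^sub>R h x) \<le> norm (norm (h x))"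
      using trapezoid_bounds[of c d n] by (auto intro!: mult_left_le_one_le)
  qed
  have proportional: "(v - u) *\<^sub>R I c d = (d - c) *\<^sub>R I u v"
    if "a < c" "c \<le> d" "d < b" "a < u" "u \<le> v" "v < b" for c d u v
  proof -
    have "M u v n *\<^sub>R J c d n = M c d n *\<^sub>R J u v n" for n
    proof -
      \<comment> \<open>The coefficients are chosen to make the integral vanish.\<close>
      define \<psi> where "\<psi> x = M u v n * trapezoid c d n x - M c d n * trapezoid u v n x" for x
      have "continuous_on UNIV \<psi>"
        unfolding \<psi>_def by (intro continuous_intros continuous_trapezoid)
      moreover have "\<psi> x = 0" if "x \<notin> {min c u..max d v}" for x
      proof -
        have "x \<notin> {c..d}" "x \<notin> {u..v}" using that by auto
        then show ?thesis by (simp add: \<psi>_def trapezoid_outside)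
      qed
      moreover have "a < min c u" "min c u \<le> max d v" "max d v < b" using that by auto
      moreover have "(LINT x|lborel. \<psi> x) = 0"
        using int by (simp add: \<psi>_def M_def)
      ultimately obtain \<phi> where "test_function a b \<phi> \<psi>"
        by (rule continuous_test_function)
      from weak[OF this] show ?thesis
        using inth by (simp add: \<psi>_def J_def scaleR_diff_left flip: scaleR_scaleR)
    qed
    moreover have "(\<lambda>n. M u v n *\<^sub>R J c d n) \<longlonglongrightarrow> (v - u) *\<^sub>R I c d"
      "(\<lambda>n. M c d n *\<^sub>R J u v n) \<longlonglongrightarrow> (d - c) *\<^sub>R I u v"
      unfolding M_def J_def I_def using that h
      by (auto intro!: tendsto_scaleR integral_trapezoid_measure_tendsto integral_trapezoid_tendsto)
    ultimately show ?thesis using LIMSEQ_unique by simp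
  qed
  \<comment> \<open>Any fixed subinterval serves for comparison.\<close>
  define u v where "u = a + (b - a) / 3" and "v = b - (b - a) / 3"
  have uv: "a < u" "u < v" "v < b" using ab by (auto simp: u_def v_def field_simps)
  have "I c d = (d - c) *\<^sub>R (I u v /\<^sub>R (v - u))" if "a < c" "c < d" "d < b" for c d
  proof -
    have "(v - u) *\<^sub>R I c d = (d - c) *\<^sub>R I u v" using proportional uv that by simp
    then have "I c d = (1 / (v - u)) *\<^sub>R ((d - c) *\<^sub>R I u v)"
      using uv by (simp flip: \<open>_ = (d - c) *\<^sub>R I u v\<close>)
    then show ?thesis by (simp add: divide_inverse mult.commute)
  qed
  then show ?thesis
    using that AE_eq_const_of_averages[OF h] unfolding I_def by metis
qed

section \<open>Caratheodory's existence theorem\<close>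

lemma truncation_integral_le:
  fixes \<alpha> :: "real \<Rightarrow> real"
  assumes \<alpha>: "integrable lborel \<alpha>" "\<And>x. 0 \<le> \<alpha> x" and "0 < e"
  obtains M :: nat where "0 < M" "(LINT x|lborel. \<alpha> x - min (\<alpha> x) (real M)) \<le> e"
proof -
  have [measurable]: "\<alpha> \<in> borel_measurable borel" using \<alpha> by auto
  have "(\<lambda>n. LINT x|lborel. \<alpha> x - min (\<alpha> x) (real n)) \<longlonglongrightarrow> (LINT (x::real)|lborel. (0::real))"
  proof (rule integral_dominated_convergence[where w=\<alpha>])
    show "AE x in lborel. (\<lambda>n. \<alpha> x - min (\<alpha> x) (real n)) \<longlonglongrightarrow> 0"
    proof (rule AE_I2)
      fix x
      have "eventually (\<lambda>n. real n \<ge> \<alpha> x) sequentially" by real_asymp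
      then have "eventually (\<lambda>n. \<alpha> x - min (\<alpha> x) (real n) = 0) sequentially"
        by eventually_elim simp
      then show "(\<lambda>n. \<alpha> x - min (\<alpha> x) (real n)) \<longlonglongrightarrow> 0" by (rule tendsto_eventually)
    qed
  qed (use \<alpha> in \<open>auto simp: abs_le_iff min_def\<close>)
  then have "(\<lambda>n. LINT x|lborel. \<alpha> x - min (\<alpha> x) (real n)) \<longlonglongrightarrow> 0" by simp
  then have "eventually (\<lambda>n. (LINT x|lborel. \<alpha> x - min (\<alpha> x) (real n)) < e) sequentially"
    using \<open>0 < e\<close> by (rule order_tendstoD)
  then have "eventually (\<lambda>n. 0 < n \<and> (LINT x|lborel. \<alpha> x - min (\<alpha> x) (real n)) < e) sequentially"
    using eventually_gt_at_top[of 0] by eventually_elim simp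
  then obtain M where "0 < M" "(LINT x|lborel. \<alpha> x - min (\<alpha> x) (real M)) < e"
    unfolding eventually_sequentially by blast
  then show ?thesis using that by simp
qed

text \<open>A weight for Bielecki's norm. If \<open>\<alpha> \<le> M\<close>, the weight \<open>exp (4 M (t - a))\<close> does; an
  integrable \<open>\<alpha>\<close> is bounded by some \<open>M\<close> up to a remainder whose integral is at most \<open>1/4\<close>.\<close>

lemma bielecki_weight:
  fixes \<alpha> :: "real \<Rightarrow> real"
  assumes ab: "a \<le> b" and \<alpha>: "integrable lborel \<alpha>" "\<And>x. 0 \<le> \<alpha> x" "\<And>x. x \<notin> {a..b} \<Longrightarrow> \<alpha> x = 0"
  obtains w W where "continuous_on UNIV w" "\<And>t. 1 \<le> w t" "\<And>t. w t \<le> W"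
    "\<And>t. primitive (\<lambda>s. \<alpha> s * w s) t \<le> w t / 2"
proof -
  have [measurable]: "\<alpha> \<in> borel_measurable borel" using \<alpha> by auto
  obtain M :: nat where M: "0 < M" "(LINT x|lborel. \<alpha> x - min (\<alpha> x) (real M)) \<le> 1 / 4"
    using truncation_integral_le[OF \<alpha>(1,2), of "1/4"] by auto
  define \<rho> where "\<rho> x = \<alpha> x - min (\<alpha> x) (real M)" for x
  define w where "w t = exp (4 * real M * (min (max t a) b - a))" for t
  have cont: "continuous_on UNIV w" unfolding w_def by (intro continuous_intros)
  then have [measurable]: "w \<in> borel_measurable borel" by (rule borel_measurable_continuous_onI)
  have mono: "w s \<le> w t" if "s \<le> t" for s t
    using that M(1) by (auto simp: w_def intro!: mult_left_mono)
  have w1: "1 \<le> w t" for t using ab by (simp add: w_def)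
  have wW: "w t \<le> w b" for t using ab M(1) by (auto simp: w_def intro!: mult_left_mono)
  have \<rho>: "integrable lborel \<rho>" "\<And>x. 0 \<le> \<rho> x"
  proof -
    show "0 \<le> \<rho> x" for x by (simp add: \<rho>_def)
    show "integrable lborel \<rho>"
      unfolding \<rho>_def using \<alpha>(2)
      by (intro Bochner_Integration.integrable_bound[OF \<alpha>(1)]) auto
  qed
  have \<rho>w: "integrable lborel (\<lambda>s. \<rho> s * w s)" and \<alpha>w: "integrable lborel (\<lambda>s. \<alpha> s * w s)"
  proof -
    have "integrable lborel (\<lambda>s. f s * w s)" if "integrable lborel f" for f :: "real \<Rightarrow> real"
    proof (rule Bochner_Integration.integrable_bound)
      show "integrable lborel (\<lambda>s. w b * f s)" using that by simp
      show "AE s in lborel. norm (f s * w s) \<le> norm (w b * f s)"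
      proof (rule AE_I2)
        fix s
        have "\<bar>w s\<bar> \<le> \<bar>w b\<bar>" using wW[of s] w1[of s] by linarith
        then show "norm (f s * w s) \<le> norm (w b * f s)"
          by (simp add: abs_mult mult.commute[of "\<bar>w b\<bar>"] mult_left_mono)
      qed
    qed (use that in measurable)
    then show "integrable lborel (\<lambda>s. \<rho> s * w s)" "integrable lborel (\<lambda>s. \<alpha> s * w s)"
      using \<rho> \<alpha> by auto
  qed
  have "primitive (\<lambda>s. \<alpha> s * w s) t \<le> w t / 2" for t
  proof -
    define t' where "t' = min (max t a) b"
    have t': "a \<le> t'" "w t = exp (4 * real M * (t' - a))" using ab by (auto simp: t'_def w_def)
    define e where "e s = real M * exp (4 * real M * (s - a))" for s
    have ce: "continuous_on S e" for S unfolding e_def by (intro continuous_intros)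
    have ei: "integrable lborel (\<lambda>s. indicator {a..t'} s *\<^sub>R e s)"
      by (intro borel_integrable_compact ce) simp
    have "(LINT s|lborel. indicator {a..t'} s *\<^sub>R e s) = exp (4 * real M * (t' - a)) / 4 - exp (4 * real M * (a - a)) / 4"
    proof (rule integral_FTC_atLeastAtMost[OF t'(1) _ ce])
      fix x
      show "((\<lambda>s. exp (4 * real M * (s - a)) / 4) has_vector_derivative e x) (at x within {a..t'})"
        unfolding has_real_derivative_iff_has_vector_derivative[symmetric] e_def
        by (auto intro!: derivative_eq_intros)
    qed
    then have bounded_part: "(LINT s|lborel. indicator {a..t'} s *\<^sub>R e s) \<le> w t / 4" using t'(2) by simp
    have "primitive (\<lambda>s. \<alpha> s * w s) t \<le> (LINT s|lborel. indicator {a..t'} s *\<^sub>R e s + w t * \<rho> s)"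
      unfolding primitive_def
    proof (rule integral_mono_AE)
      show "integrable lborel (\<lambda>s. indicator {..t} s *\<^sub>R (\<alpha> s * w s))"
        by (rule integrable_atMost[OF \<alpha>w])
      show "integrable lborel (\<lambda>s. indicator {a..t'} s *\<^sub>R e s + w t * \<rho> s)"
        using ei \<rho> by auto
      show "AE s in lborel. indicator {..t} s *\<^sub>R (\<alpha> s * w s) \<le> indicator {a..t'} s *\<^sub>R e s + w t * \<rho> s"
      proof (rule AE_I2)
        fix s
        have wt: "0 \<le> w t * \<rho> s" using w1[of t] \<rho>(2)[of s] by auto
        show "indicator {..t} s *\<^sub>R (\<alpha> s * w s) \<le> indicator {a..t'} s *\<^sub>R e s + w t * \<rho> s"
        proof (cases "s \<le> t \<and> s \<in> {a..b}")
          case True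
          have ws: "0 \<le> w s" "w s \<le> w t" using mono[of s t] w1[of s] True by auto
          have "\<alpha> s * w s = min (\<alpha> s) (real M) * w s + w s * \<rho> s" by (simp add: \<rho>_def algebra_simps)
          also have "\<dots> \<le> real M * w s + w t * \<rho> s"
            using ws \<rho>(2) by (intro add_mono mult_right_mono) auto
          also have "real M * w s = e s" using True by (simp add: e_def w_def)
          finally show ?thesis using True by (auto simp: t'_def)
        next
          case False
          then have "indicator {..t} s *\<^sub>R (\<alpha> s * w s) = 0" using \<alpha>(3)[of s] by (auto simp: indicator_def)
          moreover have "0 \<le> indicator {a..t'} s *\<^sub>R e s" by (simp add: e_def)
          ultimately show ?thesis using wt by linarith
        qed
      qed
    qed
    also have "\<dots> = (LINT s|lborel. indicator {a..t'} s *\<^sub>R e s) + w t * (LINT s|lborel. \<rho> s)"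
      using ei \<rho> by simp
    also have "\<dots> \<le> w t / 4 + w t * (1 / 4)"
      using bounded_part M(2) w1[of t] by (intro add_mono mult_left_mono) (auto simp: \<rho>_def)
    finally show ?thesis by simp
  qed
  with cont w1 wW show ?thesis by (rule that)
qed

lemma bcontfunD:
  assumes "y \<in> bcontfun"
  shows "continuous_on UNIV y" "\<exists>K. \<forall>t. norm (y t :: 'e::real_normed_vector) \<le> K"
  using assms norm_bounded[of "Bcontfun y"] by (auto simp: bcontfun_def Bcontfun_inverse)

text \<open>Substituting \<open>y = w z\<close> turns Bielecki's norm into the supremum norm of \<open>z\<close>. The weight of
  \<open>bielecki_weight\<close> makes the Picard operator a contraction with factor \<open>1/2\<close> although \<open>\<alpha>\<close> may be unbounded and its
  integral large. Working on the whole line keeps the space of continuous functions free of endpoints.\<close>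

theorem caratheodory_integral_equation:
  fixes N :: "real \<Rightarrow> 'e::{banach, second_countable_topology} \<Rightarrow> 'e" and c :: 'e
  assumes ab: "a \<le> b" and \<alpha>: "integrable lborel \<alpha>" "\<And>x. 0 \<le> \<alpha> x" "\<And>x. x \<notin> {a..b} \<Longrightarrow> \<alpha> x = (0::real)"
    and int: "\<And>y. y \<in> bcontfun \<Longrightarrow> integrable lborel (\<lambda>s. N s (y s))"
    and lip: "\<And>s u v. norm (N s u - N s v) \<le> \<alpha> s * norm (u - v)"
  shows "\<exists>!y. y \<in> bcontfun \<and> (\<forall>t. y t = c + primitive (\<lambda>s. N s (y s)) t)"
proof -
  obtain w W where w: "continuous_on UNIV w" "\<And>t. 1 \<le> w t" "\<And>t. w t \<le> W"
      "\<And>t. primitive (\<lambda>s. \<alpha> s * w s) t \<le> w t / 2"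
    using bielecki_weight[OF ab \<alpha>] by blast
  have w0: "0 < w t" "\<bar>w t\<bar> = w t" for t using w(2)[of t] by linarith+
  have [measurable]: "\<alpha> \<in> borel_measurable borel" "w \<in> borel_measurable borel"
    using \<alpha> w(1) by (auto intro: borel_measurable_continuous_onI)
  have \<alpha>w: "integrable lborel (\<lambda>s. \<alpha> s * w s)"
  proof (rule Bochner_Integration.integrable_bound)
    show "integrable lborel (\<lambda>s. W * \<alpha> s)" using \<alpha> by simp
    show "AE s in lborel. norm (\<alpha> s * w s) \<le> norm (W * \<alpha> s)"
    proof (rule AE_I2)
      fix s
      have "\<bar>w s\<bar> \<le> \<bar>W\<bar>" using w(3)[of s] w0[of s] by linarith
      then show "norm (\<alpha> s * w s) \<le> norm (W * \<alpha> s)"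
        by (simp add: abs_mult mult.commute[of "\<bar>W\<bar>"] mult_left_mono)
    qed
  qed simp
  have weighted: "(\<lambda>s. w s *\<^sub>R z s) \<in> bcontfun" if z: "z \<in> bcontfun" for z :: "real \<Rightarrow> 'e"
  proof -
    obtain K where K: "\<And>t. norm (z t) \<le> K" using bcontfunD(2)[OF z] by blast
    have le: "norm (w t *\<^sub>R z t) \<le> W * K" for t
      using K[of t] w(3)[of t] w0[of t] by (auto intro!: mult_mono)
    have "continuous_on UNIV (\<lambda>s. w s *\<^sub>R z s)"
      using w(1) bcontfunD(1)[OF z] by (intro continuous_intros)
    then show ?thesis using le by (rule bcontfun_normI)
  qed
  have unweighted: "(\<lambda>s. z s /\<^sub>R w s) \<in> bcontfun"
    if "continuous_on UNIV z" "\<And>t. norm (z t) \<le> K" for z :: "real \<Rightarrow> 'e" and K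
  proof (rule bcontfun_normI)
    show "norm (z t /\<^sub>R w t) \<le> K" for t
    proof -
      have "norm (z t /\<^sub>R w t) = norm (z t) / w t" using w0[of t] by (simp add: divide_inverse mult.commute)
      also have "\<dots> \<le> norm (z t)" using mult_right_mono[OF w(2)[of t] norm_ge_zero[of "z t"]] w0[of t]
        by (simp add: divide_le_eq mult.commute)
      finally show ?thesis using that(2)[of t] by simp
    qed
    show "continuous_on UNIV (\<lambda>s. z s /\<^sub>R w s)"
      using that(1) w(1) w0(1) by (intro continuous_intros) (auto simp: less_imp_neq[symmetric])
  qed
  define P where "P z t = c + primitive (\<lambda>s. N s (z s)) t" for z t
  have P: "continuous_on UNIV (P z)" "norm (P z t) \<le> norm c + (LINT s|lborel. norm (N s (z s)))"
    if "z \<in> bcontfun" for z t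
  proof -
    show "continuous_on UNIV (P z)"
      unfolding P_def by (intro continuous_intros continuous_on_primitive int that)
    show "norm (P z t) \<le> norm c + (LINT s|lborel. norm (N s (z s)))"
      unfolding P_def using norm_primitive_le[OF int[OF that]] by (intro norm_triangle_mono) auto
  qed
  \<comment> \<open>The Picard operator \<open>P\<close>, conjugated by the weight.\<close>
  define \<Phi> where "\<Phi> z = Bcontfun (\<lambda>t. P (\<lambda>s. w s *\<^sub>R apply_bcontfun z s) t /\<^sub>R w t)" for z
  have \<Phi>: "apply_bcontfun (\<Phi> z) t = P (\<lambda>s. w s *\<^sub>R apply_bcontfun z s) t /\<^sub>R w t" for z t
    unfolding \<Phi>_def using unweighted[OF P[OF weighted]] apply_bcontfun
    by (subst Bcontfun_inverse) auto
  have contraction: "dist (\<Phi> x) (\<Phi> y) \<le> 1 / 2 * dist x y" for x y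
  proof (rule dist_bound)
    fix t
    define X where "X s = w s *\<^sub>R apply_bcontfun x s" for s
    define Y where "Y s = w s *\<^sub>R apply_bcontfun y s" for s
    have XY: "integrable lborel (\<lambda>s. N s (X s))" "integrable lborel (\<lambda>s. N s (Y s))"
      unfolding X_def Y_def by (intro int weighted apply_bcontfun)+
    have bound: "norm (N s (X s) - N s (Y s)) \<le> dist x y * (\<alpha> s * w s)" for s
    proof -
      have "norm (N s (X s) - N s (Y s)) \<le> \<alpha> s * norm (X s - Y s)" by (rule lip)
      also have "norm (X s - Y s) = w s * dist (apply_bcontfun x s) (apply_bcontfun y s)"
        using w0[of s] by (simp add: X_def Y_def dist_norm flip: scaleR_diff_right)
      also have "\<dots> \<le> w s * dist x y" using w0[of s] by (intro mult_left_mono dist_bounded) auto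
      finally have "norm (N s (X s) - N s (Y s)) \<le> \<alpha> s * (w s * dist x y)"
        using \<alpha>(2)[of s] by (simp add: mult_left_mono)
      then show ?thesis by (simp add: mult_ac)
    qed
    have "P X t - P Y t = primitive (\<lambda>s. N s (X s) - N s (Y s)) t"
      by (simp add: P_def primitive_diff XY)
    also have "norm \<dots> \<le> (LINT s|lborel. norm (indicator {..t} s *\<^sub>R (N s (X s) - N s (Y s))))"
      unfolding primitive_def by (rule integral_norm_bound)
    also have "\<dots> \<le> (LINT s|lborel. dist x y * (indicator {..t} s *\<^sub>R (\<alpha> s * w s)))"
    proof (rule integral_mono)
      show "integrable lborel (\<lambda>s. norm (indicator {..t} s *\<^sub>R (N s (X s) - N s (Y s))))"
        using XY by (intro integrable_norm integrable_atMost) auto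
      show "integrable lborel (\<lambda>s. dist x y * (indicator {..t} s *\<^sub>R (\<alpha> s * w s)))"
        by (intro integrable_mult_right integrable_atMost \<alpha>w)
    qed (use bound in \<open>auto simp: indicator_def\<close>)
    also have "\<dots> = dist x y * primitive (\<lambda>s. \<alpha> s * w s) t"
      unfolding primitive_def by (rule integral_mult_right_zero)
    also have "\<dots> \<le> dist x y * (w t / 2)" using w(4) by (intro mult_left_mono) auto
    finally have "norm (P X t - P Y t) / w t \<le> dist x y / 2" using w0[of t] by (simp add: field_simps)
    moreover have "dist (apply_bcontfun (\<Phi> x) t) (apply_bcontfun (\<Phi> y) t) = norm (P X t - P Y t) / w t"
      using w0[of t] unfolding \<Phi> X_def[symmetric] Y_def[symmetric] dist_norm
      by (simp add: divide_inverse mult.commute flip: scaleR_diff_right)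
    ultimately show "dist (apply_bcontfun (\<Phi> x) t) (apply_bcontfun (\<Phi> y) t) \<le> 1 / 2 * dist x y" by simp
  qed
  have "\<exists>!z. \<Phi> z = z"
    using contraction by (intro banach_fix_type[of "1/2"]) auto
  then obtain z where z: "\<Phi> z = z" and uniq: "\<And>z'. \<Phi> z' = z' \<Longrightarrow> z' = z" by blast
  show ?thesis
  proof (rule ex1I)
    define y where "y s = w s *\<^sub>R apply_bcontfun z s" for s
    have y: "(\<lambda>s. w s *\<^sub>R apply_bcontfun z s) = y" by (simp add: fun_eq_iff y_def)
    have "y t = P y t" for t
      using \<Phi>[of z t] w0[of t] unfolding z y by (simp add: y_def)
    then show "y \<in> bcontfun \<and> (\<forall>t. y t = c + primitive (\<lambda>s. N s (y s)) t)"
      using weighted[OF apply_bcontfun[of z]] unfolding P_def y by blast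
    fix y' assume y': "y' \<in> bcontfun \<and> (\<forall>t. y' t = c + primitive (\<lambda>s. N s (y' s)) t)"
    note cy = bcontfunD(1)[OF conjunct1[OF y']]
    obtain K where K: "\<And>t. norm (y' t) \<le> K" using bcontfunD(2)[OF conjunct1[OF y']] by blast
    define z' where "z' = Bcontfun (\<lambda>s. y' s /\<^sub>R w s)"
    have z': "apply_bcontfun z' s = y' s /\<^sub>R w s" for s
      unfolding z'_def using unweighted[OF cy K] by (subst Bcontfun_inverse) auto
    have reweighted: "(\<lambda>s. w s *\<^sub>R apply_bcontfun z' s) = y'"
      using w0(1) by (auto simp: fun_eq_iff z' less_imp_neq[symmetric])
    have "\<Phi> z' = z'"
    proof (rule bcontfun_eqI)
      fix t
      have "P y' t = y' t" using y' unfolding P_def by metis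
      then show "apply_bcontfun (\<Phi> z') t = apply_bcontfun z' t"
        unfolding \<Phi> reweighted unfolding z' by simp
    qed
    then have "z' = z" by (rule uniq)
    then show "y' = y" using reweighted y by simp
  qed
qed

section \<open>Representatives of classes of functions\<close>

lemma L0_cases:
  obtains f where "f \<in> borel_measurable borel" "F = abs_L0 f"
  by (rule L0.abs_induct[of "\<lambda>F. (\<forall>f. f \<in> borel_measurable borel \<longrightarrow> F = abs_L0 f \<longrightarrow> thesis) \<longrightarrow> thesis" F, rule_format])
     (auto intro: that)

lemma abs_L0_eq_iff:
  assumes "f \<in> borel_measurable borel" "g \<in> borel_measurable borel"
  shows "abs_L0 f = abs_L0 g \<longleftrightarrow> (AE x in lborel. f x = g x)"
  using Quotient3_rel[OF Quotient3_L0, of f g] assms by simp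

lemma abs_L0_scaleC:
  assumes "f \<in> borel_measurable borel"
  shows "c *\<^sub>C abs_L0 f = abs_L0 (\<lambda>x. c * f x)"
  using assms by (simp add: scaleC_L0.abs_eq)

lemma
  assumes "f \<in> borel_measurable borel" "g \<in> borel_measurable borel"
  shows abs_L0_add: "abs_L0 f + abs_L0 g = abs_L0 (\<lambda>x. f x + g x)"
    and abs_L0_diff: "abs_L0 f - abs_L0 g = abs_L0 (\<lambda>x. f x - g x)"
    and abs_L0_mult: "abs_L0 f * abs_L0 g = abs_L0 (\<lambda>x. f x * g x)"
  using assms by (simp_all add: plus_L0.abs_eq minus_L0.abs_eq times_L0.abs_eq)

lemma scaleC_L0_mult: "(c *\<^sub>C F) * G = c *\<^sub>C (F * G)" "F * (c *\<^sub>C G) = c *\<^sub>C (F * G)" for F G :: L0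
  by (transfer; auto)+

section \<open>Lebesgue spaces\<close>

lemma in_Lp_abs:
  assumes "f \<in> borel_measurable borel"
  shows "in_Lp a b p (abs_L0 f) \<longleftrightarrow> (AE x in lborel. x \<notin> {a..b} \<longrightarrow> f x = 0) \<and>
     (if p = \<infinity> then esssup lborel (\<lambda>x. ennreal (cmod (f x))) < \<infinity>
      else integrable lborel (\<lambda>x. cmod (f x) powr enn2real p))"
  using assms by (simp add: in_Lp.abs_eq)

lemma Lp_norm_abs:
  assumes "f \<in> borel_measurable borel"
  shows "Lp_norm p (abs_L0 f) = (if p = \<infinity> then enn2real (esssup lborel (\<lambda>x. ennreal (cmod (f x))))
     else (LINT x|lborel. cmod (f x) powr enn2real p) powr (1 / enn2real p))"
  using assms by (simp add: Lp_norm.abs_eq)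

lemma in_L1_abs:
  assumes "f \<in> borel_measurable borel"
  shows "in_Lp a b 1 (abs_L0 f) \<longleftrightarrow> (AE x in lborel. x \<notin> {a..b} \<longrightarrow> f x = 0) \<and> integrable lborel f"
  using assms by (simp add: in_Lp_abs integrable_norm_iff)

lemma Lp_norm_1_abs:
  assumes "f \<in> borel_measurable borel"
  shows "Lp_norm 1 (abs_L0 f) = (LINT x|lborel. cmod (f x))"
  using assms by (simp add: Lp_norm_abs)

lemma Lp_norm_nonneg: "0 \<le> Lp_norm p F"
  by (cases F rule: L0_cases) (simp add: Lp_norm_abs)

lemma L_infinity_bound:
  assumes f: "f \<in> borel_measurable borel" and F: "in_Lp a b \<infinity> (abs_L0 f)"
  shows "AE x in lborel. cmod (f x) \<le> Lp_norm \<infinity> (abs_L0 f)"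
proof -
  have fin: "esssup lborel (\<lambda>x. ennreal (cmod (f x))) < \<infinity>" using F f by (simp add: in_Lp_abs)
  have "AE x in lborel. ennreal (cmod (f x)) \<le> esssup lborel (\<lambda>x. ennreal (cmod (f x)))"
    by (rule esssup_AE)
  then show ?thesis
  proof eventually_elim
    fix x assume "ennreal (cmod (f x)) \<le> esssup lborel (\<lambda>x. ennreal (cmod (f x)))"
    from enn2real_mono[OF this] fin show "cmod (f x) \<le> Lp_norm \<infinity> (abs_L0 f)"
      by (simp add: Lp_norm_abs f)
  qed
qed

lemma L_infinityI:
  assumes f: "f \<in> borel_measurable borel" and supp: "AE x in lborel. x \<notin> {a..b} \<longrightarrow> f x = 0"
    and K: "0 \<le> K" "AE x in lborel. cmod (f x) \<le> K"
  shows "in_Lp a b \<infinity> (abs_L0 f)" "Lp_norm \<infinity> (abs_L0 f) \<le> K"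
proof -
  have le: "esssup lborel (\<lambda>x. ennreal (cmod (f x))) \<le> ennreal K"
    using f K(2) by (intro esssup_I) (auto elim!: eventually_mono intro: ennreal_leI)
  then show "in_Lp a b \<infinity> (abs_L0 f)" "Lp_norm \<infinity> (abs_L0 f) \<le> K"
    using f supp K(1) enn2real_mono[OF le]
    by (auto simp: in_Lp_abs Lp_norm_abs intro: le_less_trans)
qed

lemma enn2real_ge_1:
  assumes "1 \<le> p" "p \<noteq> \<infinity>"
  shows "1 \<le> enn2real p"
  using enn2real_mono[of 1 p] assms by (simp add: top.not_eq_extremum)

text \<open>Domination almost everywhere reduces all estimates in \<open>L\<^sub>p\<close> except the triangle inequality to
  pointwise ones, for finite \<open>p\<close> and for \<open>p = \<infinity>\<close> alike.\<close>

lemma Lp_dominated: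
  assumes p: "1 \<le> p" and f: "f \<in> borel_measurable borel" and g: "g \<in> borel_measurable borel"
    and G: "in_Lp a b p (abs_L0 g)" and K: "0 \<le> K" "AE x in lborel. cmod (f x) \<le> K * cmod (g x)"
  shows "in_Lp a b p (abs_L0 f)" "Lp_norm p (abs_L0 f) \<le> K * Lp_norm p (abs_L0 g)"
proof -
  have supp: "AE x in lborel. x \<notin> {a..b} \<longrightarrow> f x = 0"
    using G K(2) unfolding in_Lp_abs[OF g] by (auto elim: eventually_elim2)
  have "in_Lp a b p (abs_L0 f) \<and> Lp_norm p (abs_L0 f) \<le> K * Lp_norm p (abs_L0 g)"
  proof (cases "p = \<infinity>")
    case True
    have "AE x in lborel. cmod (f x) \<le> K * Lp_norm \<infinity> (abs_L0 g)"
      using K(2) L_infinity_bound[OF g G[unfolded True]]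
      by eventually_elim (meson K(1) mult_left_mono order_trans)
    then show ?thesis
      using L_infinityI[OF f supp, of "K * Lp_norm \<infinity> (abs_L0 g)"] K(1) Lp_norm_nonneg True by simp
  next
    case False
    define q where "q = enn2real p"
    have q: "1 \<le> q" using enn2real_ge_1[OF p False] by (simp add: q_def)
    have [measurable]: "f \<in> borel_measurable borel" "g \<in> borel_measurable borel" by fact+
    have gi: "integrable lborel (\<lambda>x. cmod (g x) powr q)"
      using G False by (simp add: in_Lp_abs g q_def)
    have le: "AE x in lborel. cmod (f x) powr q \<le> K powr q * cmod (g x) powr q"
      using K(2)
    proof eventually_elim
      fix x assume "cmod (f x) \<le> K * cmod (g x)"
      then have "cmod (f x) powr q \<le> (K * cmod (g x)) powr q" using q by (intro powr_mono2) auto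
      then show "cmod (f x) powr q \<le> K powr q * cmod (g x) powr q" using K(1) by (simp add: powr_mult)
    qed
    have fi: "integrable lborel (\<lambda>x. cmod (f x) powr q)"
      by (rule Bochner_Integration.integrable_bound[of _ "\<lambda>x. K powr q * cmod (g x) powr q"])
         (use gi le in auto)
    have "(LINT x|lborel. cmod (f x) powr q) \<le> (LINT x|lborel. K powr q * cmod (g x) powr q)"
      using fi gi le by (intro integral_mono_AE) auto
    then have "(LINT x|lborel. cmod (f x) powr q) powr (1 / q)
        \<le> (K powr q * (LINT x|lborel. cmod (g x) powr q)) powr (1 / q)"
      using q by (intro powr_mono2) auto
    also have "\<dots> = K * (LINT x|lborel. cmod (g x) powr q) powr (1 / q)"
      using K(1) q by (simp add: powr_mult powr_powr)
    finally show ?thesis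
      using fi supp False by (simp add: in_Lp_abs Lp_norm_abs f g q_def)
  qed
  then show "in_Lp a b p (abs_L0 f)" "Lp_norm p (abs_L0 f) \<le> K * Lp_norm p (abs_L0 g)" by auto
qed

lemma Lp_zero: "in_Lp a b p 0"
  by (simp add: zero_L0.abs_eq in_Lp_abs)
     (use L_infinityI[of "\<lambda>_. 0" a b 0] in \<open>simp add: in_Lp_abs\<close>)

lemma Lp_scaleC:
  assumes "1 \<le> p" "in_Lp a b p F"
  shows "in_Lp a b p (c *\<^sub>C F)" "Lp_norm p (c *\<^sub>C F) \<le> cmod c * Lp_norm p F"
proof -
  obtain f where f: "f \<in> borel_measurable borel" "F = abs_L0 f" by (rule L0_cases)
  then show "in_Lp a b p (c *\<^sub>C F)" "Lp_norm p (c *\<^sub>C F) \<le> cmod c * Lp_norm p F"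
    using Lp_dominated[OF assms(1), of "\<lambda>x. c * f x" f a b "cmod c"] assms(2)
    by (auto simp: abs_L0_scaleC norm_mult)
qed

lemma Lp_norm_eq_0:
  assumes "1 \<le> p" "in_Lp a b p F" "Lp_norm p F = 0"
  shows "F = 0"
proof -
  obtain f where f: "f \<in> borel_measurable borel" "F = abs_L0 f" by (rule L0_cases)
  have "AE x in lborel. f x = 0"
  proof (cases "p = \<infinity>")
    case True
    then show ?thesis using L_infinity_bound[OF f(1), of a b] assms f(2) by simp
  next
    case False
    then have "integrable lborel (\<lambda>x. cmod (f x) powr enn2real p)"
      "(LINT x|lborel. cmod (f x) powr enn2real p) = 0"
      using assms f by (auto simp: in_Lp_abs Lp_norm_abs)
    then show ?thesis
      by (subst (asm) integral_nonneg_eq_0_iff_AE) auto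
  qed
  then show ?thesis using f by (simp add: zero_L0.abs_eq abs_L0_eq_iff)
qed

lemma powr_convex_nonneg:
  fixes x y :: real
  assumes q: "1 \<le> q" and xy: "0 \<le> x" "0 \<le> y" and t: "0 \<le> t" "t \<le> 1"
  shows "(t * x + (1 - t) * y) powr q \<le> t * x powr q + (1 - t) * y powr q"
proof -
  have scale: "(s * z) powr q \<le> s * z powr q" if "0 \<le> s" "s \<le> 1" "0 \<le> z" for s z :: real
  proof -
    have "s powr q \<le> s" using that q powr_mono'[of 1 q s] by simp
    then show ?thesis using that by (auto simp: powr_mult intro: mult_right_mono)
  qed
  consider "x = 0" | "y = 0" | "0 < x" "0 < y" using xy by linarith
  then show ?thesis
  proof cases
    case 3
    then show ?thesis
      using convex_onD[OF powr_convex[OF q], of "1 - t" x y] t by simp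
  qed (use scale[of t x] scale[of "1 - t" y] t xy in auto)
qed

text \<open>Minkowski's inequality. For finite \<open>p\<close> and norms \<open>u, v > 0\<close> it follows from the convexity of \<open>x powr p\<close>: \<open>\<bar>f + g\<bar> / (u + v)\<close> is at most the combination of
  \<open>\<bar>f\<bar> / u\<close> and \<open>\<bar>g\<bar> / v\<close> with weights \<open>u / (u + v)\<close> and \<open>v / (u + v)\<close>.\<close>

lemma Lp_add:
  assumes p: "1 \<le> p" and FG: "in_Lp a b p F" "in_Lp a b p G"
  shows "in_Lp a b p (F + G)" "Lp_norm p (F + G) \<le> Lp_norm p F + Lp_norm p G"
proof -
  obtain f where f: "f \<in> borel_measurable borel" "F = abs_L0 f" by (rule L0_cases)
  obtain g where g: "g \<in> borel_measurable borel" "G = abs_L0 g" by (rule L0_cases)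
  have [measurable]: "f \<in> borel_measurable borel" "g \<in> borel_measurable borel" by fact+
  have supp: "AE x in lborel. x \<notin> {a..b} \<longrightarrow> f x + g x = 0"
    using FG f g unfolding in_Lp_abs[OF f(1)] in_Lp_abs[OF g(1)]
    by (auto simp: in_Lp_abs elim: eventually_elim2)
  define u where "u = Lp_norm p F"
  define v where "v = Lp_norm p G"
  have uv: "0 \<le> u" "0 \<le> v" by (auto simp: u_def v_def Lp_norm_nonneg)
  have "in_Lp a b p (F + G) \<and> Lp_norm p (F + G) \<le> u + v"
  proof (cases "u = 0 \<or> v = 0")
    case True
    then have "F = 0 \<or> G = 0" using Lp_norm_eq_0[OF p] FG by (auto simp: u_def v_def)
    then show ?thesis using FG uv by (auto simp: u_def v_def)
  next
    case False
    then have pos: "0 < u" "0 < v" using uv by auto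
    show ?thesis
    proof (cases "p = \<infinity>")
      case True
      have "AE x in lborel. cmod (f x + g x) \<le> u + v"
        using L_infinity_bound[OF f(1), of a b] L_infinity_bound[OF g(1), of a b] FG f g True
        by (auto simp: u_def v_def elim!: eventually_elim2 intro: norm_triangle_mono)
      then show ?thesis
        using L_infinityI[OF _ supp, of "u + v"] uv f g True by (simp add: abs_L0_add)
    next
      case False
      define q where "q = enn2real p"
      have q: "1 \<le> q" using enn2real_ge_1[OF p False] by (simp add: q_def)
      have fi: "integrable lborel (\<lambda>x. cmod (f x) powr q)" and gi: "integrable lborel (\<lambda>x. cmod (g x) powr q)"
        using FG f g False by (auto simp: in_Lp_abs q_def)
      have uq: "(LINT x|lborel. cmod (f x) powr q) = u powr q" and vq: "(LINT x|lborel. cmod (g x) powr q) = v powr q"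
        using q f g False by (auto simp: u_def v_def Lp_norm_abs q_def[symmetric] powr_powr)
      define t where "t = u / (u + v)"
      have t: "0 \<le> t" "t \<le> 1" "t / u = 1 / (u + v)" "(1 - t) / v = 1 / (u + v)"
      proof -
        have "0 < u + v" using pos by simp
        then show "0 \<le> t" "t \<le> 1" "t / u = 1 / (u + v)" using pos by (simp_all add: t_def)
        have "1 - t = v / (u + v)" using \<open>0 < u + v\<close> by (simp add: t_def field_simps)
        then show "(1 - t) / v = 1 / (u + v)" using pos by simp
      qed
      define H where "H x = (u + v) powr q * (t * (cmod (f x) powr q / u powr q) + (1 - t) * (cmod (g x) powr q / v powr q))" for x
      have le: "cmod (f x + g x) powr q \<le> H x" for x
      proof -
        have "cmod (f x + g x) \<le> cmod (f x) + cmod (g x)" by (rule norm_triangle_ineq)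
        also have "\<dots> = (u + v) * (t / u * cmod (f x) + (1 - t) / v * cmod (g x))"
          using pos by (simp add: t(3,4) flip: add_divide_distrib)
        also have "\<dots> = (u + v) * (t * (cmod (f x) / u) + (1 - t) * (cmod (g x) / v))" by simp
        finally have "cmod (f x + g x) powr q \<le> ((u + v) * (t * (cmod (f x) / u) + (1 - t) * (cmod (g x) / v))) powr q"
          using q by (intro powr_mono2) auto
        also have "\<dots> = (u + v) powr q * (t * (cmod (f x) / u) + (1 - t) * (cmod (g x) / v)) powr q"
          using pos t by (simp add: powr_mult)
        also have "\<dots> \<le> (u + v) powr q * (t * (cmod (f x) / u) powr q + (1 - t) * (cmod (g x) / v) powr q)"
          using pos t q by (intro mult_left_mono powr_convex_nonneg) auto
        also have "\<dots> = H x" using pos by (simp add: H_def powr_divide)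
        finally show ?thesis .
      qed
      have Hi: "integrable lborel H" unfolding H_def using fi gi by auto
      have hi: "integrable lborel (\<lambda>x. cmod (f x + g x) powr q)"
        by (rule Bochner_Integration.integrable_bound[OF Hi]) (use le order_trans[OF _ abs_ge_self] in auto)
      have "(LINT x|lborel. cmod (f x + g x) powr q) \<le> (LINT x|lborel. H x)"
        using hi Hi le by (intro integral_mono) auto
      also have "\<dots> = (u + v) powr q * (t * (u powr q / u powr q) + (1 - t) * (v powr q / v powr q))"
        unfolding H_def using fi gi uq vq by simp
      also have "\<dots> = (u + v) powr q" using pos by simp
      finally have "(LINT x|lborel. cmod (f x + g x) powr q) powr (1 / q) \<le> ((u + v) powr q) powr (1 / q)"
        using q by (intro powr_mono2) auto
      also have "\<dots> = u + v" using q pos by (simp add: powr_powr)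
      finally show ?thesis
        using hi supp False f g by (simp add: abs_L0_add in_Lp_abs Lp_norm_abs q_def)
    qed
  qed
  then show "in_Lp a b p (F + G)" "Lp_norm p (F + G) \<le> Lp_norm p F + Lp_norm p G"
    by (auto simp: u_def v_def)
qed

lemma subspace_Lp: "1 \<le> p \<Longrightarrow> complex_vector.subspace {F. in_Lp a b p F}"
  by (rule complex_vector.subspaceI) (auto intro: Lp_zero Lp_add Lp_scaleC)

text \<open>If \<open>p\<close> is finite, then for every \<open>\<lambda> > 0\<close> one has \<open>\<bar>f\<bar> \<le> \<lambda> + \<lambda> powr (1 - p) * \<bar>f\<bar> powr p\<close>; integrating over
  \<open>[a, b]\<close> with \<open>\<lambda> = \<parallel>f\<parallel>\<^sub>p\<close> bounds the norm of \<open>L\<^sub>1\<close> without Hoelder's inequality.\<close>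

lemma Lp_imp_L1:
  assumes ab: "a \<le> b" and p: "1 \<le> p" and F: "in_Lp a b p F"
  shows "in_Lp a b 1 F" "Lp_norm 1 F \<le> (b - a + 1) * Lp_norm p F"
proof -
  obtain f where f: "f \<in> borel_measurable borel" "F = abs_L0 f" by (rule L0_cases)
  have [measurable]: "f \<in> borel_measurable borel" by fact
  have supp: "AE x in lborel. x \<notin> {a..b} \<longrightarrow> f x = 0" using F f by (simp add: in_Lp_abs)
  define l where "l = Lp_norm p F"
  have l0: "0 \<le> l" by (simp add: l_def Lp_norm_nonneg)
  have ind: "integrable lborel (indicator {a..b} :: real \<Rightarrow> real)" "(LINT x|lborel. indicator {a..b} x) = b - a"
    using ab by (auto simp: integrable_indicator_iff)
  have "\<exists>H. integrable lborel H \<and> (AE x in lborel. cmod (f x) \<le> H x) \<and> (LINT x|lborel. H x) \<le> (b - a + 1) * l"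
  proof (cases "p = \<infinity>")
    case True
    have "AE x in lborel. cmod (f x) \<le> l * indicator {a..b} x"
      using L_infinity_bound[OF f(1), of a b] F f(2) True supp
      by (auto simp: l_def indicator_def elim!: eventually_elim2)
    then show ?thesis
      using ind l0 by (intro exI[of _ "\<lambda>x. l * indicator {a..b} x"]) (auto simp: algebra_simps)
  next
    case False
    define q where "q = enn2real p"
    have q: "1 \<le> q" using enn2real_ge_1[OF p False] by (simp add: q_def)
    show ?thesis
    proof (cases "l = 0")
      case True
      then have "F = 0" using Lp_norm_eq_0[OF p F] by (simp add: l_def)
      then have "AE x in lborel. f x = 0" using f by (simp add: zero_L0.abs_eq abs_L0_eq_iff)
      then show ?thesis using True by (intro exI[of _ "\<lambda>_. 0"]) auto
    next
      case l: False
      then have l0: "0 < l" using l0 by simp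
      have fi: "integrable lborel (\<lambda>x. cmod (f x) powr q)" and lq: "(LINT x|lborel. cmod (f x) powr q) = l powr q"
        using F f q False by (auto simp: in_Lp_abs l_def Lp_norm_abs q_def[symmetric] powr_powr)
      define H where "H x = l * indicator {a..b} x + l powr (1 - q) * cmod (f x) powr q" for x
      have "cmod (f x) \<le> H x" if "x \<notin> {a..b} \<longrightarrow> f x = 0" for x
      proof (cases "cmod (f x) \<le> l")
        case True
        then show ?thesis using that by (cases "x \<in> {a..b}") (auto simp: H_def intro: add_increasing2)
      next
        case False
        have "cmod (f x) = cmod (f x) powr (1 - q) * cmod (f x) powr q"
          using False l0 by (simp flip: powr_add)
        also have "\<dots> \<le> l powr (1 - q) * cmod (f x) powr q"
          using False l0 q by (intro mult_right_mono powr_mono2') auto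
        also have "\<dots> \<le> H x" using l0 by (simp add: H_def)
        finally show ?thesis .
      qed
      then have "AE x in lborel. cmod (f x) \<le> H x" using supp by (auto elim: eventually_mono)
      moreover have "integrable lborel H" unfolding H_def using ind fi by auto
      moreover have "(LINT x|lborel. H x) = l * (b - a) + l powr (1 - q) * l powr q"
        unfolding H_def using ind fi lq by simp
      moreover have "l powr (1 - q) * l powr q = l" using l0 by (simp flip: powr_add)
      ultimately show ?thesis by (intro exI[of _ H]) (simp add: algebra_simps)
    qed
  qed
  then obtain H where H: "integrable lborel H" "AE x in lborel. cmod (f x) \<le> H x" "(LINT x|lborel. H x) \<le> (b - a + 1) * l"
    by blast
  have fi: "integrable lborel f"
    by (rule Bochner_Integration.integrable_bound[OF H(1)])
       (use H(2) in \<open>auto elim!: eventually_mono\<close>)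
  have "(LINT x|lborel. cmod (f x)) \<le> (LINT x|lborel. H x)"
    using fi H by (intro integral_mono_AE) auto
  then show "in_Lp a b 1 F" "Lp_norm 1 F \<le> (b - a + 1) * Lp_norm p F"
    using H(3) f fi supp by (auto simp: in_L1_abs Lp_norm_1_abs l_def)
qed

lemma L1_supported_representative:
  assumes "in_Lp a b 1 F"
  obtains f where "f \<in> borel_measurable borel" "integrable lborel f" "\<And>x. x \<notin> {a..b} \<Longrightarrow> f x = 0" "F = abs_L0 f"
proof -
  obtain f where f: "f \<in> borel_measurable borel" "F = abs_L0 f" by (rule L0_cases)
  have [measurable]: "f \<in> borel_measurable borel" by fact
  have fi: "integrable lborel f" "AE x in lborel. x \<notin> {a..b} \<longrightarrow> f x = 0"
    using assms f by (auto simp: in_L1_abs)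
  define g where "g x = indicator {a..b} x *\<^sub>R f x" for x
  have g: "g \<in> borel_measurable borel" unfolding g_def by measurable
  have "AE x in lborel. f x = g x" using fi(2) by (auto simp: g_def indicator_def elim: eventually_mono)
  then have "F = abs_L0 g" using f g by (simp add: abs_L0_eq_iff)
  moreover have "integrable lborel g" unfolding g_def by (rule integrable_mult_indicator[OF _ fi(1)]) simp
  ultimately show ?thesis using that[OF g] by (auto simp: g_def)
qed

lemma L1_representative:
  assumes "in_Lp a b 1 F"
  obtains f where "f \<in> borel_measurable borel" "integrable lborel f" "F = abs_L0 f"
  using assms by (rule L1_supported_representative)

section \<open>Generalized derivatives and primitives\<close>

text \<open>The absolutely continuous function with value \<open>c\<close> at \<open>a\<close> and derivative \<open>g\<close>, cut off to \<open>[a, b]\<close>.\<close>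

lift_definition ac_function :: "real \<Rightarrow> real \<Rightarrow> complex \<Rightarrow> L0 \<Rightarrow> L0" is
  "\<lambda>a b c g x. indicator {a..b} x *\<^sub>R (c + primitive g x)"
proof -
  fix a b :: real and c :: complex and f g :: "real \<Rightarrow> complex"
  assume fg: "f \<in> borel_measurable lborel \<and> g \<in> borel_measurable lborel \<and> (AE x in lborel. f x = g x)"
  have "primitive h \<in> borel_measurable borel" if [measurable]: "h \<in> borel_measurable borel" for h :: "real \<Rightarrow> complex"
  proof -
    have "(\<lambda>x. LINT t|lborel. (if t \<le> x then h t else 0)) \<in> borel_measurable borel"
      by (rule lborel.borel_measurable_lebesgue_integral) measurable
    also have "(\<lambda>x. LINT t|lborel. (if t \<le> x then h t else 0)) = primitive h"
      unfolding primitive_def fun_eq_iff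
      by (auto intro!: Bochner_Integration.integral_cong)
    finally show ?thesis .
  qed
  then have [measurable]: "primitive f \<in> borel_measurable borel" "primitive g \<in> borel_measurable borel"
    using fg by auto
  have "primitive f = primitive g" using fg by (intro ext primitive_cong_AE) auto
  then show "(\<lambda>x. indicator {a..b} x *\<^sub>R (c + primitive f x)) \<in> borel_measurable lborel \<and>
      (\<lambda>x. indicator {a..b} x *\<^sub>R (c + primitive g x)) \<in> borel_measurable lborel \<and>
      (AE x in lborel. indicator {a..b} x *\<^sub>R (c + primitive f x) = indicator {a..b} x *\<^sub>R (c + primitive g x))"
    by simp
qed

lemma ac_function_abs:
  assumes "g \<in> borel_measurable borel"
  shows "ac_function a b c (abs_L0 g) = abs_L0 (\<lambda>x. indicator {a..b} x *\<^sub>R (c + primitive g x))"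
  using assms by (simp add: ac_function.abs_eq)

lemma borel_measurable_ac:
  assumes "integrable lborel g"
  shows "(\<lambda>x. indicator {a..b} x *\<^sub>R (c + primitive g x :: complex)) \<in> borel_measurable borel"
  using borel_measurable_primitive[OF assms] by measurable

lemma ac_function_add:
  assumes "in_Lp a b 1 F" "in_Lp a b 1 G"
  shows "ac_function a b (c + d) (F + G) = ac_function a b c F + ac_function a b d G"
proof -
  obtain f where f: "f \<in> borel_measurable borel" "integrable lborel f" "F = abs_L0 f" by (rule L1_representative[OF assms(1)])
  obtain g where g: "g \<in> borel_measurable borel" "integrable lborel g" "G = abs_L0 g" by (rule L1_representative[OF assms(2)])
  show ?thesis
    using f g by (simp add: abs_L0_add ac_function_abs borel_measurable_ac)
      (simp add: primitive_add algebra_simps)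
qed

lemma ac_function_scaleC: "ac_function a b (k * c) (k *\<^sub>C F) = k *\<^sub>C ac_function a b c F"
  if F: "in_Lp a b 1 F"
proof -
  obtain f where f: "f \<in> borel_measurable borel" "integrable lborel f" "F = abs_L0 f" by (rule L1_representative[OF F])
  show ?thesis
    using f by (simp add: abs_L0_scaleC ac_function_abs borel_measurable_ac)
      (simp add: primitive_mult_left algebra_simps)
qed

lemma ac_function_inject:
  assumes ab: "a < b" and F: "in_Lp a b 1 F" and eq: "ac_function a b c F = ac_function a b d F"
  shows "c = d"
proof (rule ccontr)
  assume "c \<noteq> d"
  obtain f where f: "f \<in> borel_measurable borel" "integrable lborel f" "F = abs_L0 f" by (rule L1_representative[OF F])
  have "AE x in lborel. x \<notin> {a..b}"
    using eq \<open>c \<noteq> d\<close>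
    by (simp add: f ac_function_abs abs_L0_eq_iff borel_measurable_ac)
       (auto elim!: eventually_mono simp: indicator_def)
  then have "emeasure lborel {a..b} = 0"
    by (subst (asm) AE_iff_measurable[of "{a..b}"]) auto
  then show False using ab by simp
qed

lemma in_L1_ac:
  assumes ab: "a \<le> b" and F: "in_Lp a b 1 F"
  shows "in_Lp a b 1 (ac_function a b c F)"
proof -
  obtain f where f: "f \<in> borel_measurable borel" "integrable lborel f" "F = abs_L0 f" by (rule L1_representative[OF F])
  have "integrable lborel (\<lambda>x. indicator {a..b} x *\<^sub>R (c + primitive f x))"
    by (intro borel_integrable_compact continuous_intros continuous_on_primitive f) auto
  then show ?thesis
    by (simp add: f ac_function_abs in_L1_abs borel_measurable_ac)
qed

lemma test_function_derivative_support:
  assumes "test_function a b \<phi> \<phi>'" "x \<notin> {a..b}"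
  shows "\<phi>' x = 0"
proof -
  obtain c d where "a < c" "d < b" "\<And>x. x \<notin> {c..d} \<Longrightarrow> \<phi>' x = 0"
    using test_function_derivative_zero[OF assms(1)] by metis
  then show ?thesis using assms(2) by auto
qed

lemma has_derivative_ac:
  assumes ab: "a < b" and F: "in_Lp a b 1 F"
  shows "has_derivative_L1 a b (ac_function a b c F) F"
proof -
  obtain f where f: "f \<in> borel_measurable borel" "integrable lborel f" "F = abs_L0 f" by (rule L1_representative[OF F])
  have "integrates_by_parts a b (ac_function a b c F) F"
    unfolding f(3) ac_function_abs[OF f(1)]
  proof (subst integrates_by_parts.abs_eq, goal_cases)
    case 3
    show ?case
    proof (intro allI impI)
      fix \<phi> \<phi>' assume \<phi>: "test_function a b \<phi> \<phi>'"
      have "\<phi>' x = 0" if "x \<notin> {a..b}" for x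
        using test_function_derivative_support[OF \<phi>] that by auto
      then have "(\<lambda>x. \<phi>' x *\<^sub>R indicator {a..b} x *\<^sub>R (c + primitive f x)) = (\<lambda>x. \<phi>' x *\<^sub>R (c + primitive f x))"
        by (intro ext) (metis indicator_simps scaleR_one scaleR_zero_left)
      then show "(LINT x|lborel. \<phi>' x *\<^sub>R indicator {a..b} x *\<^sub>R (c + primitive f x)) = - (LINT x|lborel. \<phi> x *\<^sub>R f x)"
        using primitive_weak_derivative[OF \<phi> f(2), of c] by simp
    qed
  qed (use f borel_measurable_ac in auto)
  then show ?thesis
    using F in_L1_ac[OF less_imp_le[OF ab] F] by (simp add: has_derivative_L1_def)
qed

lemma AE_lborel_closed_interval:
  assumes "AE x in lborel. x \<in> {a<..<b} \<longrightarrow> P x"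
  shows "AE x in lborel. x \<in> {a..b} \<longrightarrow> P (x :: real)"
  using assms AE_lborel_singleton[of a] AE_lborel_singleton[of b]
  by eventually_elim auto

text \<open>The difference of \<open>F\<close> and the primitive of \<open>G\<close> has the weak derivative zero, so it is constant by
  the lemma of du Bois-Reymond.\<close>

lemma has_derivative_imp_ac:
  assumes ab: "a < b" and FG: "has_derivative_L1 a b F G"
  obtains c where "F = ac_function a b c G"
proof -
  have F: "in_Lp a b 1 F" and G: "in_Lp a b 1 G" and parts: "integrates_by_parts a b F G"
    using FG by (auto simp: has_derivative_L1_def)
  obtain f where f: "f \<in> borel_measurable borel" "integrable lborel f" "\<And>x. x \<notin> {a..b} \<Longrightarrow> f x = 0" "F = abs_L0 f"
    by (rule L1_supported_representative[OF F], rule that)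
  obtain g where g: "g \<in> borel_measurable borel" "integrable lborel g" "G = abs_L0 g" by (rule L1_representative[OF G])
  define h where "h x = f x - indicator {a..b} x *\<^sub>R primitive g x" for x
  have hi': "integrable lborel (\<lambda>x. indicator {a..b} x *\<^sub>R primitive g x)"
    by (intro borel_integrable_compact continuous_on_primitive g) auto
  have hi: "integrable lborel h" unfolding h_def using f(2) hi' by (rule Bochner_Integration.integrable_diff)
  have "(LINT x|lborel. \<phi>' x *\<^sub>R h x) = 0" if \<phi>: "test_function a b \<phi> \<phi>'" for \<phi> \<phi>'
  proof -
    note supp = test_function_derivative_support[OF \<phi>]
    have c\<phi>: "continuous_on UNIV \<phi>'" using \<phi> by (simp add: test_function_def)
    have int: "integrable lborel (\<lambda>x. \<phi>' x *\<^sub>R k x)" if k: "integrable lborel k" for k :: "real \<Rightarrow> complex"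
    proof -
      have "bounded (\<phi>' ` {a..b})"
        by (intro compact_imp_bounded compact_continuous_image continuous_on_subset[OF c\<phi>]) auto
      then obtain K where "\<forall>x\<in>{a..b}. \<bar>\<phi>' x\<bar> \<le> K" by (auto simp: bounded_iff)
      then have "cmod (complex_of_real (\<phi>' x)) \<le> max K 0" for x
        using supp[of x] by (cases "x \<in> {a..b}") (auto simp: le_max_iff_disj)
      then have "integrable lborel (\<lambda>x. k x * complex_of_real (\<phi>' x))"
        using k c\<phi> by (intro integrable_bounded_mult[where C="max K 0"] borel_measurable_continuous_onI continuous_intros) auto
      then show ?thesis by (simp add: scaleR_conv_of_real mult.commute)
    qed
    have "(\<lambda>x. \<phi>' x *\<^sub>R h x) = (\<lambda>x. \<phi>' x *\<^sub>R f x - \<phi>' x *\<^sub>R (0 + primitive g x))"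
    proof
      fix x
      show "\<phi>' x *\<^sub>R h x = \<phi>' x *\<^sub>R f x - \<phi>' x *\<^sub>R (0 + primitive g x)"
        using supp[of x] by (cases "x \<in> {a..b}") (simp_all add: h_def scaleR_diff_right)
    qed
    then have "(LINT x|lborel. \<phi>' x *\<^sub>R h x) = (LINT x|lborel. \<phi>' x *\<^sub>R f x - \<phi>' x *\<^sub>R (0 + primitive g x))"
      by simp
    also have "\<dots> = (LINT x|lborel. \<phi>' x *\<^sub>R f x) - (LINT x|lborel. \<phi>' x *\<^sub>R (0 + primitive g x))"
    proof (rule Bochner_Integration.integral_diff[OF int[OF f(2)]])
      have "(\<lambda>x. \<phi>' x *\<^sub>R (0 + primitive g x)) = (\<lambda>x. \<phi>' x *\<^sub>R (indicator {a..b} x *\<^sub>R primitive g x))"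
      proof
        fix x
        show "\<phi>' x *\<^sub>R (0 + primitive g x) = \<phi>' x *\<^sub>R (indicator {a..b} x *\<^sub>R primitive g x)"
          using supp[of x] by (cases "x \<in> {a..b}") simp_all
      qed
      then show "integrable lborel (\<lambda>x. \<phi>' x *\<^sub>R (0 + primitive g x))" using int[OF hi'] by simp
    qed
    also have "\<dots> = - (LINT x|lborel. \<phi> x *\<^sub>R g x) + (LINT x|lborel. \<phi> x *\<^sub>R g x)"
      using parts \<phi> f g unfolding primitive_weak_derivative[OF \<phi> g(2), of 0]
      by (simp add: integrates_by_parts.abs_eq)
    finally show ?thesis by simp
  qed
  then obtain C where "AE x in lborel. x \<in> {a<..<b} \<longrightarrow> h x = C"
    using du_Bois_Reymond[OF ab hi] by blast
  then have "AE x in lborel. x \<in> {a..b} \<longrightarrow> h x = C" by (rule AE_lborel_closed_interval)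
  then have "AE x in lborel. f x = indicator {a..b} x *\<^sub>R (C + primitive g x)"
    by eventually_elim (use f(3) in \<open>auto simp: h_def indicator_def algebra_simps\<close>)
  then have "F = ac_function a b C G"
    using f g by (simp add: ac_function_abs abs_L0_eq_iff borel_measurable_ac)
  then show ?thesis by (rule that)
qed

text \<open>Uniqueness of the generalized derivative comes from this: the continuous function
  \<open>c + primitive g\<close> vanishes almost everywhere on \<open>(a, b)\<close>, hence everywhere there, and so its increments, which are the integrals of \<open>g\<close> over
  subintervals, are zero.\<close>

lemma ac_function_eq_0:
  assumes ab: "a < b" and G: "in_Lp a b 1 G" and eq: "ac_function a b c G = 0"
  shows "G = 0"
proof -
  obtain g where g: "g \<in> borel_measurable borel" "integrable lborel g" "\<And>x. x \<notin> {a..b} \<Longrightarrow> g x = 0" "G = abs_L0 g"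
    by (rule L1_supported_representative[OF G], rule that)
  have null: "AE x in lborel. x \<in> {a<..<b} \<longrightarrow> c + primitive g x = 0"
    using eq by (simp add: g ac_function_abs zero_L0.abs_eq abs_L0_eq_iff borel_measurable_ac)
       (auto elim!: eventually_mono simp: indicator_def)
  have all: "c + primitive g x = 0" if "x \<in> {a<..<b}" for x
  proof (rule ccontr)
    assume "c + primitive g x \<noteq> 0"
    have cont: "continuous_on {a<..<b} (\<lambda>x. c + primitive g x)"
      by (intro continuous_intros continuous_on_primitive g)
    define U where "U = (\<lambda>x. c + primitive g x) -` (- {0}) \<inter> {a<..<b}"
    have U: "open U" "x \<in> U"
      using continuous_open_preimage[OF cont, of "- {0}"] that \<open>c + primitive g x \<noteq> 0\<close>
      by (auto simp: U_def Int_commute)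
    have "AE x in lborel. x \<notin> U" using null by eventually_elim (auto simp: U_def)
    then have "emeasure lborel U = 0" using U(1)
      by (subst (asm) AE_iff_measurable[of U]) auto
    then have "U \<in> null_sets lborel" using U(1) by (intro null_setsI) auto
    then have "negligible U" by (simp add: negligible_iff_null_sets null_sets_completionI)
    then show False using U open_not_negligible by blast
  qed
  have "AE x in lborel. x \<in> {a<..<b} \<longrightarrow> g x = 0"
  proof (rule AE_eq_const_of_averages[OF g(2)])
    fix u v assume uv: "a < u" "u < v" "v < b"
    have "(LINT x|lborel. indicator {u..v} x *\<^sub>R g x) = (LINT x|lborel. indicator {..v} x *\<^sub>R g x - indicator {..u} x *\<^sub>R g x)"
    proof (rule integral_cong_AE)
      have [measurable]: "g \<in> borel_measurable borel" by fact
      show "(\<lambda>x. indicator {u..v} x *\<^sub>R g x) \<in> borel_measurable lborel"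
        "(\<lambda>x. indicator {..v} x *\<^sub>R g x - indicator {..u} x *\<^sub>R g x) \<in> borel_measurable lborel" by measurable
      show "AE x in lborel. indicator {u..v} x *\<^sub>R g x = indicator {..v} x *\<^sub>R g x - indicator {..u} x *\<^sub>R g x"
        using AE_lborel_singleton[of u] by eventually_elim (use uv in \<open>auto simp: indicator_def\<close>)
    qed
    also have "\<dots> = primitive g v - primitive g u"
      unfolding primitive_def by (rule Bochner_Integration.integral_diff; rule integrable_atMost[OF g(2)])
    also have "\<dots> = (c + primitive g v) - (c + primitive g u)" by simp
    also have "\<dots> = 0" using all[of u] all[of v] uv by simp
    finally show "(LINT x|lborel. indicator {u..v} x *\<^sub>R g x) = (v - u) *\<^sub>R 0" by simp
  qed
  then have "AE x in lborel. x \<in> {a..b} \<longrightarrow> g x = 0" by (rule AE_lborel_closed_interval)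
  then have "AE x in lborel. g x = 0" by eventually_elim (use g(3) in auto)
  then show ?thesis using g by (simp add: zero_L0.abs_eq abs_L0_eq_iff)
qed

lemma has_derivative_L1_add:
  assumes "a < b" "has_derivative_L1 a b F F'" "has_derivative_L1 a b G G'"
  shows "has_derivative_L1 a b (F + G) (F' + G')"
proof -
  obtain c d where cd: "F = ac_function a b c F'" "G = ac_function a b d G'"
    using has_derivative_imp_ac assms by metis
  have L1: "in_Lp a b 1 F'" "in_Lp a b 1 G'" using assms by (auto simp: has_derivative_L1_def)
  show ?thesis
    unfolding cd ac_function_add[OF L1, symmetric]
    by (intro has_derivative_ac assms Lp_add L1) simp
qed

lemma has_derivative_L1_scaleC:
  assumes "a < b" "has_derivative_L1 a b F F'"
  shows "has_derivative_L1 a b (k *\<^sub>C F) (k *\<^sub>C F')"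
proof -
  obtain c where c: "F = ac_function a b c F'"
    using has_derivative_imp_ac assms by metis
  have L1: "in_Lp a b 1 F'" using assms by (auto simp: has_derivative_L1_def)
  show ?thesis
    unfolding c ac_function_scaleC[OF L1, symmetric]
    by (intro has_derivative_ac assms Lp_scaleC L1) simp
qed

lemma has_derivative_L1_unique:
  assumes ab: "a < b" and G: "has_derivative_L1 a b F G" and H: "has_derivative_L1 a b F H"
  shows "G = H"
proof -
  have "has_derivative_L1 a b (F + (-1) *\<^sub>C F) (G + (-1) *\<^sub>C H)"
    by (intro has_derivative_L1_add has_derivative_L1_scaleC ab G H)
  then have 0: "has_derivative_L1 a b 0 (G - H)"
    by (simp add: complex_vector.scale_minus_left)
  then obtain c where "ac_function a b c (G - H) = 0" using has_derivative_imp_ac[OF ab] by metis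
  moreover have "in_Lp a b 1 (G - H)" using 0 by (simp add: has_derivative_L1_def)
  ultimately show ?thesis using ac_function_eq_0[OF ab] by force
qed

lemma derivative_L1_eq:
  assumes "a < b" "has_derivative_L1 a b F G"
  shows "derivative_L1 a b F = G"
  unfolding derivative_L1_def using assms has_derivative_L1_unique by blast

text \<open>The product of the continuous representatives is of the required form by \<open>primitive_product\<close>.\<close>

lemma has_derivative_L1_mult:
  assumes ab: "a < b" and FF: "has_derivative_L1 a b F F'" and GG: "has_derivative_L1 a b G G'"
  shows "has_derivative_L1 a b (F * G) (F' * G + F * G')"
proof -
  have L1: "in_Lp a b 1 F'" "in_Lp a b 1 G'" using FF GG by (auto simp: has_derivative_L1_def)
  obtain f where f: "f \<in> borel_measurable borel" "integrable lborel f" "\<And>x. x \<notin> {a..b} \<Longrightarrow> f x = 0" "F' = abs_L0 f"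
    by (rule L1_supported_representative[OF L1(1)], rule that)
  obtain g where g: "g \<in> borel_measurable borel" "integrable lborel g" "\<And>x. x \<notin> {a..b} \<Longrightarrow> g x = 0" "G' = abs_L0 g"
    by (rule L1_supported_representative[OF L1(2)], rule that)
  obtain c where c: "F = ac_function a b c F'" by (rule has_derivative_imp_ac[OF ab FF])
  obtain d where d: "G = ac_function a b d G'" by (rule has_derivative_imp_ac[OF ab GG])
  define h where "h t = f t * (d + primitive g t) + (c + primitive f t) * g t" for t
  have h: "integrable lborel h" "(c + primitive f x) * (d + primitive g x) = c * d + primitive h x" for x
    unfolding h_def using primitive_product[OF f(2) g(2), where c=c and d=d] by auto
  define F0 where "F0 x = indicator {a..b} x *\<^sub>R (c + primitive f x)" for x
  define G0 where "G0 x = indicator {a..b} x *\<^sub>R (d + primitive g x)" for x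
  have F0: "F0 \<in> borel_measurable borel" "F = abs_L0 F0"
    using f d by (auto simp: F0_def[abs_def] c ac_function_abs borel_measurable_ac)
  have G0: "G0 \<in> borel_measurable borel" "G = abs_L0 G0"
    using g d by (auto simp: G0_def[abs_def] ac_function_abs borel_measurable_ac)
  have "h = (\<lambda>x. f x * G0 x + F0 x * g x)"
  proof
    fix x show "h x = f x * G0 x + F0 x * g x"
      using f(3)[of x] g(3)[of x] by (cases "x \<in> {a..b}") (simp_all add: h_def F0_def G0_def)
  qed
  then have der: "abs_L0 h = F' * G + F * G'"
    using f(1) g(1) F0(1) G0(1) by (simp add: F0(2) G0(2) f(4) g(4) abs_L0_mult abs_L0_add)
  have "h x = 0" if "x \<notin> {a..b}" for x using that f(3) g(3) by (simp add: h_def)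
  then have L1h: "in_Lp a b 1 (abs_L0 h)" using h by (simp add: in_L1_abs)
  have "ac_function a b (c * d) (abs_L0 h) = abs_L0 (\<lambda>x. indicator {a..b} x *\<^sub>R ((c + primitive f x) * (d + primitive g x)))"
    using h by (simp add: ac_function_abs)
  also have "(\<lambda>x. indicator {a..b} x *\<^sub>R ((c + primitive f x) * (d + primitive g x))) = (\<lambda>x. F0 x * G0 x)"
    by (auto simp: fun_eq_iff F0_def G0_def indicator_def)
  also have "abs_L0 \<dots> = F * G"
    using F0 G0 by (simp add: abs_L0_mult)
  finally show ?thesis
    using has_derivative_ac[OF ab L1h, of "c * d"] der by simp
qed

text \<open>A function with an integrable derivative differs from each of its values by at most the
  integral of the derivative; averaging over \<open>[a, b]\<close> gives its supremum bound.\<close>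

lemma Lp_mult_ac:
  assumes ab: "a < b" and p: "1 \<le> p" and F: "in_Lp a b p F" and GG: "has_derivative_L1 a b G G'"
  shows "in_Lp a b p (F * G)"
    and "Lp_norm p (F * G) \<le> (1 + 1 / (b - a)) * Lp_norm p F * (Lp_norm 1 G + Lp_norm 1 G')"
proof -
  have L1: "in_Lp a b 1 G'" "in_Lp a b 1 G" using GG by (auto simp: has_derivative_L1_def)
  obtain g where g: "g \<in> borel_measurable borel" "integrable lborel g" "\<And>x. x \<notin> {a..b} \<Longrightarrow> g x = 0" "G' = abs_L0 g"
    by (rule L1_supported_representative[OF L1(1)], rule that)
  obtain f where f: "f \<in> borel_measurable borel" "F = abs_L0 f" by (rule L0_cases)
  obtain d where d: "G = ac_function a b d G'" by (rule has_derivative_imp_ac[OF ab GG])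
  define G0 where "G0 x = indicator {a..b} x *\<^sub>R (d + primitive g x)" for x
  have G0: "G0 \<in> borel_measurable borel" "G = abs_L0 G0"
    using g d by (auto simp: G0_def[abs_def] ac_function_abs borel_measurable_ac)
  have G0i: "integrable lborel G0" using L1(2) G0 by (simp add: in_L1_abs)
  define I where "I = (LINT t|lborel. cmod (g t))"
  define J where "J = (LINT t|lborel. cmod (G0 t))"
  have IJ: "Lp_norm 1 G' = I" "Lp_norm 1 G = J" "0 \<le> I" "0 \<le> J"
    using g G0 by (auto simp: I_def J_def Lp_norm_1_abs)
  define K where "K = J / (b - a) + I"
  have bound: "cmod (G0 x) \<le> K" for x
  proof (cases "x \<in> {a..b}")
    case True
    have near: "indicator {a..b} y * cmod (d + primitive g x) \<le> cmod (G0 y) + I * indicator {a..b} y" for y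
    proof (cases "y \<in> {a..b}")
      case True
      have "cmod (d + primitive g x) \<le> cmod (d + primitive g y) + cmod (primitive g x - primitive g y)"
        using norm_triangle_ineq[of "d + primitive g y" "primitive g x - primitive g y"] by simp
      also have "cmod (primitive g x - primitive g y) \<le> I"
        unfolding I_def by (rule primitive_diff_le[OF g(2)])
      finally show ?thesis using True by (simp add: G0_def)
    qed (simp add: G0_def)
    have ind: "integrable lborel (indicator {a..b} :: real \<Rightarrow> real)" "(LINT x|lborel. indicator {a..b} x) = b - a"
      using ab by (auto simp: integrable_indicator_iff)
    have "(b - a) * cmod (d + primitive g x) = (LINT y|lborel. indicator {a..b} y * cmod (d + primitive g x))"
      using ind by simp
    also have "\<dots> \<le> (LINT y|lborel. cmod (G0 y) + I * indicator {a..b} y)"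
      using ind G0i near by (intro integral_mono) auto
    also have "\<dots> = J + I * (b - a)" using ind G0i by (simp add: J_def)
    finally have "(b - a) * cmod (d + primitive g x) \<le> (b - a) * K"
      using ab by (simp add: K_def distrib_left mult.commute)
    then show ?thesis using ab True by (simp add: G0_def)
  qed (use IJ ab in \<open>simp add: G0_def K_def\<close>)
  have K: "0 \<le> K" "K \<le> (1 + 1 / (b - a)) * (J + I)" 
  proof -
    show "0 \<le> K" using IJ(3,4) ab by (simp add: K_def)
    have "(1 + 1 / (b - a)) * (J + I) = K + (J + I / (b - a))"
      by (simp add: K_def distrib_left distrib_right add_divide_distrib)
    then show "K \<le> (1 + 1 / (b - a)) * (J + I)" using IJ(3,4) ab by simp
  qed
  have FG: "F * G = abs_L0 (\<lambda>x. f x * G0 x)" using f G0 by (simp add: abs_L0_mult)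
  have le: "AE x in lborel. cmod (f x * G0 x) \<le> K * cmod (f x)"
    using bound by (intro AE_I2) (simp add: norm_mult mult.commute[of K] mult_left_mono)
  have m: "(\<lambda>x. f x * G0 x) \<in> borel_measurable borel" using f G0 by auto
  note dom = Lp_dominated[OF p m f(1) F[unfolded f(2)] K(1) le]
  show "in_Lp a b p (F * G)" using dom(1) FG by simp
  have "Lp_norm p (F * G) \<le> K * Lp_norm p F" using dom(2) FG f(2) by simp
  also have "\<dots> \<le> ((1 + 1 / (b - a)) * (J + I)) * Lp_norm p F"
    using K(2) Lp_norm_nonneg by (rule mult_right_mono)
  finally show "Lp_norm p (F * G) \<le> (1 + 1 / (b - a)) * Lp_norm p F * (Lp_norm 1 G + Lp_norm 1 G')"
    by (simp add: IJ mult_ac)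
qed

lemma Lp_ac:
  assumes ab: "a < b" and p: "1 \<le> p" and G: "in_Lp a b 1 G"
  shows "in_Lp a b p (ac_function a b c G)"
proof -
  obtain g where g: "g \<in> borel_measurable borel" "integrable lborel g" "G = abs_L0 g" by (rule L1_representative[OF G])
  have "in_Lp a b p (abs_L0 (indicator {a..b}))"
  proof (cases "p = \<infinity>")
    case True
    then show ?thesis using L_infinityI(1)[of "indicator {a..b}" a b 1] by (simp add: indicator_def)
  next
    case False
    have "(\<lambda>x. cmod (indicator {a..b} x) powr enn2real p) = (indicator {a..b} :: real \<Rightarrow> real)"
      by (auto simp: indicator_def)
    then show ?thesis using False ab by (simp add: in_Lp_abs integrable_indicator_iff indicator_def)
  qed
  then have "in_Lp a b p (abs_L0 (indicator {a..b}) * ac_function a b c G)"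
    by (rule Lp_mult_ac(1)[OF ab p _ has_derivative_ac[OF ab G]])
  also have "abs_L0 (indicator {a..b}) * ac_function a b c G = ac_function a b c G"
    using g by (simp add: ac_function_abs abs_L0_mult borel_measurable_ac)
       (auto simp: indicator_def intro!: arg_cong[where f=abs_L0])
  finally show ?thesis .
qed

section \<open>Sobolev spaces\<close>

lemma sobolev_Suc_iff:
  assumes "a < b"
  shows "f \<in> sobolev a b p (Suc k) \<longleftrightarrow>
    in_Lp a b p f \<and> has_derivative_L1 a b f (derivative_L1 a b f) \<and> derivative_L1 a b f \<in> sobolev a b p k"
  using derivative_L1_eq[OF assms] by auto

lemma sobolev_imp_Lp: "f \<in> sobolev a b p k \<Longrightarrow> in_Lp a b p f"
  by (cases k) auto

lemma subspace_sobolev: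
  assumes ab: "a < b" and p: "1 \<le> p"
  shows "complex_vector.subspace (sobolev a b p k)"
proof (induction k)
  case 0
  show ?case using subspace_Lp[OF p] by simp
next
  case (Suc k)
  have 0: "has_derivative_L1 a b 0 0"
    using has_derivative_L1_scaleC[OF ab has_derivative_ac[OF ab Lp_zero], of 0] by simp
  show ?case
  proof (rule complex_vector.subspaceI)
    show "0 \<in> sobolev a b p (Suc k)"
      using 0 Lp_zero complex_vector.subspace_0[OF Suc] by auto
  next
    fix f g assume "f \<in> sobolev a b p (Suc k)" "g \<in> sobolev a b p (Suc k)"
    then show "f + g \<in> sobolev a b p (Suc k)"
      using has_derivative_L1_add[OF ab] Lp_add(1)[OF p] complex_vector.subspace_add[OF Suc]
      unfolding sobolev.simps mem_Collect_eq by blast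
  next
    fix c f assume "f \<in> sobolev a b p (Suc k)"
    then show "c *\<^sub>C f \<in> sobolev a b p (Suc k)"
      using has_derivative_L1_scaleC[OF ab] Lp_scaleC(1)[OF p] complex_vector.subspace_scale[OF Suc]
      unfolding sobolev.simps mem_Collect_eq by blast
  qed
qed

lemma sobolev_Suc_subset: "sobolev a b p (Suc k) \<subseteq> sobolev a b p k"
  by (induction k) auto

lemma sobolev_antimono: "j \<le> k \<Longrightarrow> sobolev a b p k \<subseteq> sobolev a b p j"
  by (rule lift_Suc_antimono_le[of "sobolev a b p"]) (rule sobolev_Suc_subset)

lemma derivative_L1_add:
  assumes "a < b" "has_derivative_L1 a b f f'" "has_derivative_L1 a b g g'"
  shows "derivative_L1 a b (f + g) = derivative_L1 a b f + derivative_L1 a b g"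
  using assms by (simp add: derivative_L1_eq has_derivative_L1_add)

lemma derivative_L1_scaleC:
  assumes "a < b" "has_derivative_L1 a b f f'"
  shows "derivative_L1 a b (c *\<^sub>C f) = c *\<^sub>C derivative_L1 a b f"
  using assms by (simp add: derivative_L1_eq has_derivative_L1_scaleC)

lemma sobolev_norm_0: "sobolev_norm a b p 0 f = Lp_norm p f"
  by (simp add: sobolev_norm_def)

lemma sobolev_norm_Suc:
  "sobolev_norm a b p (Suc k) f = Lp_norm p f + sobolev_norm a b p k (derivative_L1 a b f)"
  by (simp add: sobolev_norm_def sum.atMost_Suc_shift funpow_swap1 del: sum.atMost_Suc)

lemma sobolev_norm_nonneg: "0 \<le> sobolev_norm a b p k f"
  by (simp add: sobolev_norm_def sum_nonneg Lp_norm_nonneg)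

lemma Lp_norm_le_sobolev_norm: "Lp_norm p f \<le> sobolev_norm a b p k f"
  by (cases k) (simp_all add: sobolev_norm_0 sobolev_norm_Suc sobolev_norm_nonneg)

lemma sobolev_norm_le_Suc: "sobolev_norm a b p k f \<le> sobolev_norm a b p (Suc k) f"
  by (simp add: sobolev_norm_def Lp_norm_nonneg)

lemma sobolev_norm_add:
  assumes ab: "a < b" and p: "1 \<le> p" and "f \<in> sobolev a b p k" "g \<in> sobolev a b p k"
  shows "sobolev_norm a b p k (f + g) \<le> sobolev_norm a b p k f + sobolev_norm a b p k g"
  using assms(3,4)
proof (induction k arbitrary: f g)
  case 0
  then show ?case by (simp add: sobolev_norm_0 Lp_add(2)[OF p])
next
  case (Suc k)
  note f = Suc.prems(1)[unfolded sobolev_Suc_iff[OF ab]] and g = Suc.prems(2)[unfolded sobolev_Suc_iff[OF ab]]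
  have "derivative_L1 a b (f + g) = derivative_L1 a b f + derivative_L1 a b g"
    using derivative_L1_add[OF ab] f g by blast
  then show ?case
    using Suc.IH[of "derivative_L1 a b f" "derivative_L1 a b g"] Lp_add(2)[OF p, of a b f g] f g
    by (simp add: sobolev_norm_Suc)
qed

lemma sobolev_norm_scaleC:
  assumes ab: "a < b" and p: "1 \<le> p" and "f \<in> sobolev a b p k"
  shows "sobolev_norm a b p k (c *\<^sub>C f) \<le> cmod c * sobolev_norm a b p k f"
  using assms(3)
proof (induction k arbitrary: f)
  case 0
  then show ?case by (simp add: sobolev_norm_0 Lp_scaleC(2)[OF p])
next
  case (Suc k)
  note f = Suc.prems(1)[unfolded sobolev_Suc_iff[OF ab]]
  have "derivative_L1 a b (c *\<^sub>C f) = c *\<^sub>C derivative_L1 a b f"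
    using derivative_L1_scaleC[OF ab] f by blast
  then show ?case
    using Suc.IH[of "derivative_L1 a b f"] Lp_scaleC(2)[OF p, of a b f c] f
    by (simp add: sobolev_norm_Suc distrib_left)
qed

lemma sobolev_norm_sum:
  assumes ab: "a < b" and p: "1 \<le> p" and "finite J" "\<And>j. j \<in> J \<Longrightarrow> f j \<in> sobolev a b p k"
  shows "sobolev_norm a b p k (\<Sum>j\<in>J. f j) \<le> (\<Sum>j\<in>J. sobolev_norm a b p k (f j))"
  using assms(3,4)
proof (induction J rule: finite_induct)
  case empty
  have "0 \<in> sobolev a b p k" by (rule complex_vector.subspace_0[OF subspace_sobolev[OF ab p]])
  then show ?case using sobolev_norm_scaleC[OF ab p, of 0 k 0] by simp
next
  case (insert j J)
  have "(\<Sum>j\<in>J. f j) \<in> sobolev a b p k"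
    using insert.prems by (intro complex_vector.subspace_sum[OF subspace_sobolev[OF ab p]]) auto
  then show ?case
    using sobolev_norm_add[OF ab p, of "f j" k "\<Sum>j\<in>J. f j"] insert by fastforce
qed

lemma Lp_norm_mult_le:
  assumes ab: "a < b" and p: "1 \<le> p" and f: "in_Lp a b p f" and g: "in_Lp a b p g" "has_derivative_L1 a b g g'"
  shows "Lp_norm p (f * g) \<le> (1 + 1 / (b - a)) * (b - a + 1) * (Lp_norm p f * (Lp_norm p g + Lp_norm 1 g'))"
proof -
  have "Lp_norm 1 g \<le> (b - a + 1) * Lp_norm p g" using Lp_imp_L1(2)[OF less_imp_le[OF ab] p g(1)] .
  moreover have "Lp_norm 1 g' \<le> (b - a + 1) * Lp_norm 1 g'"
    using ab mult_right_mono[of 1 "b - a + 1" "Lp_norm 1 g'"] Lp_norm_nonneg by simp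
  ultimately have le: "Lp_norm 1 g + Lp_norm 1 g' \<le> (b - a + 1) * (Lp_norm p g + Lp_norm 1 g')"
    by (simp add: distrib_left)
  have "Lp_norm p (f * g) \<le> (1 + 1 / (b - a)) * Lp_norm p f * (Lp_norm 1 g + Lp_norm 1 g')"
    by (rule Lp_mult_ac(2)[OF ab p f g(2)])
  also have "\<dots> \<le> (1 + 1 / (b - a)) * Lp_norm p f * ((b - a + 1) * (Lp_norm p g + Lp_norm 1 g'))"
    using le ab Lp_norm_nonneg by (intro mult_left_mono mult_nonneg_nonneg) auto
  finally show ?thesis by (simp add: mult_ac)
qed

text \<open>Induction by \<open>(f g)' = f' g + g' f\<close>, where the second factor of each product again has a
  derivative in \<open>L\<^sub>1\<close>. The bound uses the norm of \<open>g'\<close> in \<open>L\<^sub>1\<close> only, since for \<open>k = 0\<close> the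
  derivative of \<open>g\<close> need not be in \<open>L\<^sub>p\<close>. That case makes the regularity of solutions start; for
  \<open>k \<ge> 1\<close> every \<open>g\<close> in \<open>W\<^sub>p\<^sup>k\<close> has a derivative, so that \<open>W\<^sub>p\<^sup>k\<close> is an algebra.\<close>

lemma sobolev_mult:
  assumes ab: "a < b" and p: "1 \<le> p"
  shows "\<exists>C\<ge>0. \<forall>f g g'. f \<in> sobolev a b p k \<longrightarrow> g \<in> sobolev a b p k \<longrightarrow> has_derivative_L1 a b g g' \<longrightarrow>
     f * g \<in> sobolev a b p k \<and>
     sobolev_norm a b p k (f * g) \<le> C * (sobolev_norm a b p k f * (sobolev_norm a b p k g + Lp_norm 1 g'))"
proof (induction k)
  case 0
  show ?case
    using Lp_mult_ac(1)[OF ab p] Lp_norm_mult_le[OF ab p] ab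
    by (intro exI[of _ "(1 + 1 / (b - a)) * (b - a + 1)"]) (auto simp: sobolev_norm_0)
next
  case (Suc k)
  let ?N = "sobolev_norm a b p" and ?D = "derivative_L1 a b"
  obtain C where C: "0 \<le> C"
    and IH: "\<And>f g g'. f \<in> sobolev a b p k \<Longrightarrow> g \<in> sobolev a b p k \<Longrightarrow> has_derivative_L1 a b g g' \<Longrightarrow>
      f * g \<in> sobolev a b p k \<and> ?N k (f * g) \<le> C * (?N k f * (?N k g + Lp_norm 1 g'))"
    using Suc by blast
  define C0 where "C0 = (1 + 1 / (b - a)) * (b - a + 1)"
  have C0: "0 \<le> C0" using ab by (simp add: C0_def)
  define K where "K = b - a + 1"
  have K: "0 \<le> K" using ab by (simp add: K_def)
  show ?case
  proof (intro exI[of _ "C0 + (C + C * (1 + K))"] conjI allI impI)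
    show "0 \<le> C0 + (C + C * (1 + K))" using C C0 K by simp
  next
    fix f g g' assume fW: "f \<in> sobolev a b p (Suc k)" and gW: "g \<in> sobolev a b p (Suc k)"
      and g': "has_derivative_L1 a b g g'"
    have fk: "f \<in> sobolev a b p k" and gk: "g \<in> sobolev a b p k" using fW gW sobolev_Suc_subset by blast+
    note f = fW[unfolded sobolev_Suc_iff[OF ab]] and g = gW[unfolded sobolev_Suc_iff[OF ab]]
    have Dg: "?D g = g'" by (rule derivative_L1_eq[OF ab g'])
    have g'W: "g' \<in> sobolev a b p k" using g Dg by simp
    define f' where "f' = ?D f"
    have f': "has_derivative_L1 a b f f'" "f' \<in> sobolev a b p k" using f by (auto simp: f'_def)
    note 1 = IH[OF f'(2) gk g'] and 2 = IH[OF g'W fk f'(1)]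
    have der: "has_derivative_L1 a b (f * g) (f' * g + f * g')" by (rule has_derivative_L1_mult[OF ab f'(1) g'])
    have prodW: "f' * g \<in> sobolev a b p k" "f * g' \<in> sobolev a b p k" using 1 2 by (auto simp: mult.commute)
    then have sumW: "f' * g + f * g' \<in> sobolev a b p k"
      by (rule complex_vector.subspace_add[OF subspace_sobolev[OF ab p]])
    have fgp: "in_Lp a b p (f * g)" by (rule Lp_mult_ac(1)[OF ab p _ g']) (use f in blast)
    show "f * g \<in> sobolev a b p (Suc k)" using fgp der sumW by auto
    define F where "F = ?N (Suc k) f"
    define G where "G = ?N (Suc k) g + Lp_norm 1 g'"
    have nn: "0 \<le> ?N j h" "0 \<le> Lp_norm q h" for j h q by (rule sobolev_norm_nonneg Lp_norm_nonneg)+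
    have Fs: "Lp_norm p f \<le> F" "?N k f \<le> F" "?N k f' \<le> F"
      using Lp_norm_le_sobolev_norm sobolev_norm_le_Suc nn by (auto simp: F_def sobolev_norm_Suc f'_def)
    have Gs: "Lp_norm p g + Lp_norm 1 g' \<le> G" "?N k g + Lp_norm 1 g' \<le> G" "?N k g' \<le> G"
      using Lp_norm_le_sobolev_norm[of p g a b "Suc k"] sobolev_norm_le_Suc[of a b p k g] nn
      by (auto simp: G_def sobolev_norm_Suc Dg add_nonneg_nonneg)
    have F0: "0 \<le> F" "0 \<le> G" by (simp_all add: F_def G_def nn)
    have "Lp_norm 1 f' \<le> K * Lp_norm p f'"
      using Lp_imp_L1(2)[OF less_imp_le[OF ab] p sobolev_imp_Lp[OF f'(2)]] by (simp add: K_def)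
    also have "\<dots> \<le> K * F" using K Fs(3) Lp_norm_le_sobolev_norm[of p f' a b k] by (intro mult_left_mono) auto
    finally have f'1: "?N k f + Lp_norm 1 f' \<le> (1 + K) * F" using Fs(2) by (simp add: distrib_right)
    have "Lp_norm p (f * g) \<le> C0 * (Lp_norm p f * (Lp_norm p g + Lp_norm 1 g'))"
      unfolding C0_def by (rule Lp_norm_mult_le[OF ab p _ _ g']) (use f g in blast)+
    also have "\<dots> \<le> C0 * (F * G)"
      using C0 Fs Gs F0 nn by (intro mult_left_mono mult_mono) auto
    finally have e0: "Lp_norm p (f * g) \<le> C0 * (F * G)" .
    have "?N k (f' * g) \<le> C * (?N k f' * (?N k g + Lp_norm 1 g'))" using 1 by blast
    also have "\<dots> \<le> C * (F * G)" using C Fs Gs F0 nn by (intro mult_left_mono mult_mono) auto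
    finally have e1: "?N k (f' * g) \<le> C * (F * G)" .
    have "?N k (g' * f) \<le> C * (?N k g' * (?N k f + Lp_norm 1 f'))" using 2 by blast
    also have "\<dots> \<le> C * (G * ((1 + K) * F))" using C Gs f'1 F0 nn by (intro mult_left_mono mult_mono) auto
    finally have e2: "?N k (f * g') \<le> C * (1 + K) * (F * G)" by (simp add: mult_ac)
    have "?N (Suc k) (f * g) = Lp_norm p (f * g) + ?N k (f' * g + f * g')"
      by (simp add: sobolev_norm_Suc derivative_L1_eq[OF ab der])
    also have "\<dots> \<le> C0 * (F * G) + (C * (F * G) + C * (1 + K) * (F * G))"
      using e0 e1 e2 sobolev_norm_add[OF ab p prodW] by linarith
    also have "\<dots> = (C0 + (C + C * (1 + K))) * (F * G)" by (simp only: distrib_right)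
    finally show "?N (Suc k) (f * g) \<le> (C0 + (C + C * (1 + K))) * (?N (Suc k) f * (?N (Suc k) g + Lp_norm 1 g'))"
      by (simp only: F_def G_def)
  qed
qed

lemma sobolev_mult_closed:
  assumes "a < b" "1 \<le> p" "f \<in> sobolev a b p k" "g \<in> sobolev a b p k" "has_derivative_L1 a b g g'"
  shows "f * g \<in> sobolev a b p k"
  using sobolev_mult[OF assms(1,2)] assms by blast

text \<open>The form of the estimate that is needed for \<open>A y\<close>, with \<open>A\<close> one order less regular than \<open>y\<close>.\<close>

lemma sobolev_mult_Suc:
  assumes ab: "a < b" and p: "1 \<le> p"
  obtains C where "0 \<le> C"
    "\<And>f g. f \<in> sobolev a b p k \<Longrightarrow> g \<in> sobolev a b p (Suc k) \<Longrightarrow>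
       sobolev_norm a b p k (f * g) \<le> C * sobolev_norm a b p k f * sobolev_norm a b p (Suc k) g"
proof -
  let ?N = "sobolev_norm a b p" and ?D = "derivative_L1 a b"
  obtain C where C: "0 \<le> C"
    and le: "\<And>f g g'. f \<in> sobolev a b p k \<Longrightarrow> g \<in> sobolev a b p k \<Longrightarrow> has_derivative_L1 a b g g' \<Longrightarrow>
      f * g \<in> sobolev a b p k \<and> ?N k (f * g) \<le> C * (?N k f * (?N k g + Lp_norm 1 g'))"
    using sobolev_mult[OF ab p] by blast
  define K where "K = b - a + 1"
  have K: "0 \<le> K" using ab by (simp add: K_def)
  have "?N k (f * g) \<le> C * (1 + K) * ?N k f * ?N (Suc k) g"
    if f: "f \<in> sobolev a b p k" and gW: "g \<in> sobolev a b p (Suc k)" for f g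
  proof -
    note g = gW[unfolded sobolev_Suc_iff[OF ab]]
    have "Lp_norm 1 (?D g) \<le> K * Lp_norm p (?D g)"
      using Lp_imp_L1(2)[OF less_imp_le[OF ab] p sobolev_imp_Lp] g by (auto simp: K_def)
    also have "\<dots> \<le> K * ?N (Suc k) g"
      using K Lp_norm_le_sobolev_norm[of p "?D g" a b k] Lp_norm_nonneg[of p g]
      by (intro mult_left_mono) (auto simp: sobolev_norm_Suc)
    finally have le1: "?N k g + Lp_norm 1 (?D g) \<le> (1 + K) * ?N (Suc k) g"
      using sobolev_norm_le_Suc[of a b p k g] by (simp add: distrib_right)
    have "?N k (f * g) \<le> C * (?N k f * (?N k g + Lp_norm 1 (?D g)))"
      using le[of f g "?D g"] f gW g sobolev_Suc_subset by blast
    also have "\<dots> \<le> C * (?N k f * ((1 + K) * ?N (Suc k) g))"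
      using le1 C sobolev_norm_nonneg by (intro mult_left_mono) auto
    finally show ?thesis by (simp add: mult_ac)
  qed
  then show ?thesis using that[of "C * (1 + K)"] C K by simp
qed

section \<open>The Cauchy problem\<close>

lemma bounded_linear_axis: "bounded_linear (axis i :: 'e::real_normed_vector \<Rightarrow> 'e ^ 'm)"
proof (rule bounded_linear_intro[where K=1])
  fix x :: 'e
  have "norm (axis i x :: 'e ^ 'm) \<le> (\<Sum>j\<in>UNIV. norm (axis i x $ j :: 'e))"
    unfolding norm_vec_def by (rule L2_set_le_sum) simp
  also have "\<dots> = (\<Sum>j\<in>UNIV. if j = i then norm x else 0)"
    by (rule sum.cong) (auto simp: axis_def)
  finally show "norm (axis i x :: 'e ^ 'm) \<le> norm x * 1" by simp
qed (auto simp: vec_eq_iff axis_def)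

lemma integrable_vec_lambda:
  fixes f :: "'m::finite \<Rightarrow> real \<Rightarrow> complex"
  assumes "\<And>i. integrable M (f i)"
  shows "integrable M (\<lambda>s. \<chi> i. f i s)"
proof -
  have "(\<lambda>s. \<chi> i. f i s) = (\<lambda>s. \<Sum>i\<in>UNIV. axis i (f i s))"
    by (auto simp: fun_eq_iff vec_eq_iff axis_def)
  moreover have "integrable M (\<lambda>s. \<Sum>i\<in>UNIV. axis i (f i s) :: complex ^ 'm)"
    by (intro Bochner_Integration.integrable_sum integrable_bounded_linear[OF bounded_linear_axis] assms)
  ultimately show ?thesis by simp
qed

lemma primitive_vec_nth:
  fixes g :: "real \<Rightarrow> complex ^ 'm"
  assumes "integrable lborel g"
  shows "primitive g x $ i = primitive (\<lambda>s. g s $ i) x"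
  using integral_bounded_linear[OF bounded_linear_vec_nth[of i] integrable_atMost[OF assms, of x]]
  unfolding primitive_def by simp

text \<open>The right-hand side \<open>f - A u\<close> of the linear system for representatives \<open>\<alpha>\<close> of \<open>A\<close> and \<open>\<phi>\<close> of \<open>f\<close>.\<close>

definition system_rhs ::
    "('m::finite \<Rightarrow> 'm \<Rightarrow> real \<Rightarrow> complex) \<Rightarrow> ('m \<Rightarrow> real \<Rightarrow> complex) \<Rightarrow> real \<Rightarrow> complex ^ 'm \<Rightarrow> complex ^ 'm" where
  "system_rhs \<alpha> \<phi> s u = (\<chi> i. \<phi> i s - (\<Sum>j\<in>UNIV. \<alpha> i j s * u $ j))"

lemma integrable_system_rhs:
  fixes y :: "real \<Rightarrow> complex ^ 'm"
  assumes \<alpha>: "\<And>i j. integrable lborel (\<alpha> i j)" and \<phi>: "\<And>i. integrable lborel (\<phi> i)" and y: "y \<in> bcontfun"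
  shows "integrable lborel (\<lambda>s. system_rhs \<alpha> \<phi> s (y s))"
  unfolding system_rhs_def
proof (intro integrable_vec_lambda Bochner_Integration.integrable_diff Bochner_Integration.integrable_sum \<phi>)
  fix i j
  obtain K where K: "\<And>t. norm (y t) \<le> K" using bcontfunD(2)[OF y] by blast
  show "integrable lborel (\<lambda>s. \<alpha> i j s * y s $ j)"
  proof (rule integrable_bounded_mult[OF \<alpha>])
    show "(\<lambda>s. y s $ j) \<in> borel_measurable borel"
      by (intro borel_measurable_continuous_onI continuous_intros bcontfunD y)
    show "cmod (y x $ j) \<le> K" for x
      using Finite_Cartesian_Product.norm_nth_le[of "y x" j] K[of x] by linarith
  qed
qed

lemma linear_integral_system:
  fixes \<alpha> :: "'m::finite \<Rightarrow> 'm \<Rightarrow> real \<Rightarrow> complex"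
  assumes ab: "a \<le> b" and \<alpha>: "\<And>i j. integrable lborel (\<alpha> i j)" "\<And>i j x. x \<notin> {a..b} \<Longrightarrow> \<alpha> i j x = 0"
    and \<phi>: "\<And>i. integrable lborel (\<phi> i)"
  shows "\<exists>!y. y \<in> bcontfun \<and> (\<forall>t. y t = c + primitive (\<lambda>s. system_rhs \<alpha> \<phi> s (y s)) t)"
proof (rule caratheodory_integral_equation[OF ab, where \<alpha>="\<lambda>s. \<Sum>i\<in>UNIV. \<Sum>j\<in>UNIV. cmod (\<alpha> i j s)"])
  show "integrable lborel (\<lambda>s. \<Sum>i\<in>UNIV. \<Sum>j\<in>UNIV. cmod (\<alpha> i j s))" using \<alpha>(1) by auto
  show "0 \<le> (\<Sum>i\<in>UNIV. \<Sum>j\<in>UNIV. cmod (\<alpha> i j x))" for x by (intro sum_nonneg) auto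
  show "(\<Sum>i\<in>UNIV. \<Sum>j\<in>UNIV. cmod (\<alpha> i j x)) = 0" if "x \<notin> {a..b}" for x using \<alpha>(2)[OF that] by simp
  show "integrable lborel (\<lambda>s. system_rhs \<alpha> \<phi> s (y s))" if "y \<in> bcontfun" for y
    by (rule integrable_system_rhs[OF \<alpha>(1) \<phi> that])
  fix s and u v :: "complex ^ 'm"
  have "norm (system_rhs \<alpha> \<phi> s u - system_rhs \<alpha> \<phi> s v) \<le>
      (\<Sum>i\<in>UNIV. cmod ((system_rhs \<alpha> \<phi> s u - system_rhs \<alpha> \<phi> s v) $ i))"
    unfolding norm_vec_def by (rule L2_set_le_sum) simp
  also have "\<dots> \<le> (\<Sum>i\<in>UNIV. \<Sum>j\<in>UNIV. cmod (\<alpha> i j s) * norm (u - v))"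
  proof (rule sum_mono)
    fix i
    have "(system_rhs \<alpha> \<phi> s u - system_rhs \<alpha> \<phi> s v) $ i = (\<Sum>j\<in>UNIV. \<alpha> i j s * (v - u) $ j)"
      by (simp add: system_rhs_def right_diff_distrib sum_subtractf)
    also have "cmod \<dots> \<le> (\<Sum>j\<in>UNIV. cmod (\<alpha> i j s) * norm (v - u))"
    proof (rule sum_norm_le)
      fix j
      show "cmod (\<alpha> i j s * (v - u) $ j) \<le> cmod (\<alpha> i j s) * norm (v - u)"
        using Finite_Cartesian_Product.norm_nth_le[of "v - u" j] by (simp only: norm_mult) (rule mult_left_mono; simp)
    qed
    finally show "cmod ((system_rhs \<alpha> \<phi> s u - system_rhs \<alpha> \<phi> s v) $ i) \<le> (\<Sum>j\<in>UNIV. cmod (\<alpha> i j s) * norm (u - v))"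
      by (simp add: norm_minus_commute)
  qed
  finally show "norm (system_rhs \<alpha> \<phi> s u - system_rhs \<alpha> \<phi> s v) \<le> (\<Sum>i\<in>UNIV. \<Sum>j\<in>UNIV. cmod (\<alpha> i j s)) * norm (u - v)"
    by (simp add: sum_distrib_right)
qed

text \<open>The Cauchy problem \<open>y' + A y = f\<close>, \<open>y(a) = c\<close> in integrated form. An element of
  \<open>W\<^sub>1\<^sup>1\<close> has no value at \<open>a\<close> by itself; \<open>c\<close> is that of its continuous representative.\<close>

definition solves_cauchy :: "real \<Rightarrow> real \<Rightarrow> L0 ^ 'm ^ 'm \<Rightarrow> L0 ^ 'm \<Rightarrow> complex ^ 'm \<Rightarrow> L0 ^ 'm \<Rightarrow> bool" where
  "solves_cauchy a b A f c y \<longleftrightarrow> (\<forall>i. in_Lp a b 1 ((f - A *v y) $ i) \<and>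
     y $ i = ac_function a b (c $ i) ((f - A *v y) $ i))"

lemma matrix_vector_mult_scaleC: "A *v (k *\<^sub>C y) = k *\<^sub>C (A *v y)" for A :: "L0 ^ 'm ^ 'n"
  by (simp add: vec_eq_iff matrix_vector_mult_def scaleC_vec_def scaleC_L0_mult complex_vector.scale_sum_right)

lemma solves_cauchy_add:
  assumes "solves_cauchy a b A f c y" "solves_cauchy a b A g d z"
  shows "solves_cauchy a b A (f + g) (c + d) (y + z)"
proof -
  have eq: "(f + g) - A *v (y + z) = (f - A *v y) + (g - A *v z)"
    by (simp add: matrix_vector_right_distrib algebra_simps)
  show ?thesis
    using assms Lp_add(1)[of 1 a b] ac_function_add[of a b]
    unfolding solves_cauchy_def eq by (auto simp: vector_add_component)
qed

lemma solves_cauchy_scaleC: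
  assumes "solves_cauchy a b A f c y"
  shows "solves_cauchy a b A (k *\<^sub>C f) (k *\<^sub>C c) (k *\<^sub>C y)"
proof -
  have eq: "k *\<^sub>C f - A *v (k *\<^sub>C y) = k *\<^sub>C (f - A *v y)"
    by (simp add: matrix_vector_mult_scaleC complex_vector.scale_right_diff_distrib)
  have nth: "(k *\<^sub>C v) $ i = k *\<^sub>C (v $ i)" for v :: "L0 ^ 'a" and i by (simp add: scaleC_vec_def)
  have nthc: "(k *\<^sub>C c) $ i = k * (c $ i)" for i by (simp add: scaleC_vec_def scaleC_complex_def)
  show ?thesis
    using assms Lp_scaleC(1)[of 1 a b] ac_function_scaleC[of a b]
    unfolding solves_cauchy_def eq nth nthc by auto
qed

lemma abs_L0_sum:
  assumes "\<And>j. j \<in> J \<Longrightarrow> h j \<in> borel_measurable borel"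
  shows "(\<Sum>j\<in>J. abs_L0 (h j)) = abs_L0 (\<lambda>x. \<Sum>j\<in>J. h j x)"
  using assms
proof (induction J rule: infinite_finite_induct)
  case (insert j J)
  then have "(\<lambda>x. \<Sum>j\<in>J. h j x) \<in> borel_measurable borel" by auto
  then show ?case using insert by (simp add: abs_L0_add)
qed (simp_all add: zero_L0.abs_eq)

text \<open>The passage between classes of functions, in which the problem is posed, and continuous functions, in
  which it is solved: cutting \<open>y\<close> off does not matter in \<open>A y\<close>, because \<open>A\<close> vanishes outside \<open>[a, b]\<close>.\<close>

lemma rhs_abs_L0:
  fixes y :: "real \<Rightarrow> complex ^ 'm"
  assumes \<alpha>: "\<And>i j. \<alpha> i j \<in> borel_measurable borel" "\<And>i j x. x \<notin> {a..b} \<Longrightarrow> \<alpha> i j x = 0"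
      "\<And>i j. A $ i $ j = abs_L0 (\<alpha> i j)"
    and \<phi>: "\<And>i. \<phi> i \<in> borel_measurable borel" "\<And>i. f $ i = abs_L0 (\<phi> i)"
    and y: "continuous_on UNIV y" "\<And>j. Y $ j = abs_L0 (\<lambda>x. indicator {a..b} x *\<^sub>R (y x $ j))"
  shows "(f - A *v Y) $ i = abs_L0 (\<lambda>s. system_rhs \<alpha> \<phi> s (y s) $ i)"
proof -
  have yj: "(\<lambda>x. y x $ j) \<in> borel_measurable borel" for j
    by (intro borel_measurable_continuous_onI continuous_intros y)
  have yi: "(\<lambda>x. indicator {a..b} x *\<^sub>R (y x $ j)) \<in> borel_measurable borel" for j
    using yj by measurable
  have m: "(\<lambda>x. \<alpha> i j x * y x $ j) \<in> borel_measurable borel" for j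
    using \<alpha>(1)[of i j] yj[of j] by measurable
  have "A $ i $ j * Y $ j = abs_L0 (\<lambda>x. \<alpha> i j x * y x $ j)" for j
  proof -
    have "(\<lambda>x. \<alpha> i j x * (indicator {a..b} x *\<^sub>R (y x $ j))) = (\<lambda>x. \<alpha> i j x * y x $ j)"
    proof
      fix x show "\<alpha> i j x * (indicator {a..b} x *\<^sub>R (y x $ j)) = \<alpha> i j x * y x $ j"
        using \<alpha>(2)[of x i j] by (cases "x \<in> {a..b}") simp_all
    qed
    then show ?thesis unfolding \<alpha>(3) y(2) abs_L0_mult[OF \<alpha>(1) yi] by simp
  qed
  then have "(A *v Y) $ i = abs_L0 (\<lambda>x. \<Sum>j\<in>UNIV. \<alpha> i j x * y x $ j)"
    using m by (simp add: matrix_vector_mult_def abs_L0_sum)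
  moreover have "(\<lambda>x. \<Sum>j\<in>UNIV. \<alpha> i j x * y x $ j) \<in> borel_measurable borel"
    using m by (rule borel_measurable_sum)
  ultimately show ?thesis using \<phi> by (simp add: abs_L0_diff system_rhs_def)
qed

lemma L1_matrix_representatives:
  fixes A :: "L0 ^ 'm ^ 'n"
  assumes "\<And>i j. in_Lp a b 1 (A $ i $ j)"
  obtains \<alpha> where "\<And>i j. \<alpha> i j \<in> borel_measurable borel" "\<And>i j. integrable lborel (\<alpha> i j)"
    "\<And>i j x. x \<notin> {a..b} \<Longrightarrow> \<alpha> i j x = 0" "\<And>i j. A $ i $ j = abs_L0 (\<alpha> i j)"
proof -
  have "\<forall>i j. \<exists>\<alpha>. \<alpha> \<in> borel_measurable borel \<and> integrable lborel \<alpha> \<and>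
      (\<forall>x. x \<notin> {a..b} \<longrightarrow> \<alpha> x = 0) \<and> A $ i $ j = abs_L0 \<alpha>"
    using assms L1_supported_representative by metis
  then obtain \<alpha> where "\<forall>i j. \<alpha> i j \<in> borel_measurable borel \<and> integrable lborel (\<alpha> i j) \<and>
      (\<forall>x. x \<notin> {a..b} \<longrightarrow> \<alpha> i j x = 0) \<and> A $ i $ j = abs_L0 (\<alpha> i j)"
    by metis
  then show ?thesis using that[of \<alpha>] by blast
qed

lemma L1_vector_representatives:
  fixes f :: "L0 ^ 'm"
  assumes "\<And>i. in_Lp a b 1 (f $ i)"
  obtains \<phi> where "\<And>i. \<phi> i \<in> borel_measurable borel" "\<And>i. integrable lborel (\<phi> i)"
    "\<And>i x. x \<notin> {a..b} \<Longrightarrow> \<phi> i x = 0" "\<And>i. f $ i = abs_L0 (\<phi> i)"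
proof -
  have "\<forall>i. \<exists>\<phi>. \<phi> \<in> borel_measurable borel \<and> integrable lborel \<phi> \<and>
      (\<forall>x. x \<notin> {a..b} \<longrightarrow> \<phi> x = 0) \<and> f $ i = abs_L0 \<phi>"
    using assms L1_supported_representative by metis
  then obtain \<phi> where "\<forall>i. \<phi> i \<in> borel_measurable borel \<and> integrable lborel (\<phi> i) \<and>
      (\<forall>x. x \<notin> {a..b} \<longrightarrow> \<phi> i x = 0) \<and> f $ i = abs_L0 (\<phi> i)"
    by metis
  then show ?thesis using that[of \<phi>] by blast
qed

lemma cauchy_problem_solvable:
  fixes A :: "L0 ^ 'm ^ 'm"
  assumes ab: "a < b" and A: "\<And>i j. in_Lp a b 1 (A $ i $ j)" and f: "\<And>i. in_Lp a b 1 (f $ i)"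
  obtains y where "solves_cauchy a b A f c y"
proof -
  obtain \<alpha> where \<alpha>: "\<And>i j. \<alpha> i j \<in> borel_measurable borel" "\<And>i j. integrable lborel (\<alpha> i j)"
    "\<And>i j x. x \<notin> {a..b} \<Longrightarrow> \<alpha> i j x = 0" "\<And>i j. A $ i $ j = abs_L0 (\<alpha> i j)"
    by (rule L1_matrix_representatives[OF A], rule that)
  obtain \<phi> where \<phi>: "\<And>i. \<phi> i \<in> borel_measurable borel" "\<And>i. integrable lborel (\<phi> i)"
    "\<And>i x. x \<notin> {a..b} \<Longrightarrow> \<phi> i x = 0" "\<And>i. f $ i = abs_L0 (\<phi> i)"
    by (rule L1_vector_representatives[OF f], rule that)
  have "\<exists>!y. y \<in> bcontfun \<and> (\<forall>t. y t = c + primitive (\<lambda>s. system_rhs \<alpha> \<phi> s (y s)) t)"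
    using \<alpha>(2,3) \<phi>(2) by (intro linear_integral_system[OF less_imp_le[OF ab]])
  then obtain y where y: "y \<in> bcontfun" and eq: "\<And>t. y t = c + primitive (\<lambda>s. system_rhs \<alpha> \<phi> s (y s)) t"
    by (elim ex1E conjE) blast
  note int = integrable_system_rhs[OF \<alpha>(2) \<phi>(2) y]
  define Y where "Y = (\<chi> i. abs_L0 (\<lambda>x. indicator {a..b} x *\<^sub>R (y x $ i)))"
  have rhs: "(f - A *v Y) $ i = abs_L0 (\<lambda>s. system_rhs \<alpha> \<phi> s (y s) $ i)" for i
    by (rule rhs_abs_L0[OF \<alpha>(1,3,4) \<phi>(1,4) bcontfunD(1)[OF y]]) (auto simp: Y_def)
  have inti: "integrable lborel (\<lambda>s. system_rhs \<alpha> \<phi> s (y s) $ i)" for i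
    by (rule integrable_bounded_linear[OF bounded_linear_vec_nth int])
  then have mi: "(\<lambda>s. system_rhs \<alpha> \<phi> s (y s) $ i) \<in> borel_measurable borel" for i
    using borel_measurable_integrable[of lborel "\<lambda>s. system_rhs \<alpha> \<phi> s (y s) $ i"] by simp
  have zero: "system_rhs \<alpha> \<phi> x (y x) $ i = 0" if "x \<notin> {a..b}" for x i
    using \<alpha>(3)[OF that] \<phi>(3)[OF that] by (simp add: system_rhs_def)
  have "y x $ i = c $ i + primitive (\<lambda>s. system_rhs \<alpha> \<phi> s (y s) $ i) x" for x i
    by (subst eq) (simp add: primitive_vec_nth[OF int])
  then have "Y $ i = ac_function a b (c $ i) ((f - A *v Y) $ i)" for i
    unfolding rhs ac_function_abs[OF mi] by (simp add: Y_def)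
  moreover have "in_Lp a b 1 ((f - A *v Y) $ i)" for i
    unfolding rhs in_L1_abs[OF mi] using inti zero by simp
  ultimately have "solves_cauchy a b A f c Y" unfolding solves_cauchy_def by blast
  then show ?thesis by (rule that)
qed

text \<open>The primitives \<open>z\<close> of the components of \<open>- A y\<close> are bounded and continuous on the line and solve the
  homogeneous integral equation, as the zero function does.\<close>

lemma cauchy_problem_zero:
  fixes A :: "L0 ^ 'm ^ 'm"
  assumes ab: "a < b" and A: "\<And>i j. in_Lp a b 1 (A $ i $ j)" and y: "solves_cauchy a b A 0 0 y"
  shows "y = 0"
proof -
  obtain \<alpha> where \<alpha>: "\<And>i j. \<alpha> i j \<in> borel_measurable borel" "\<And>i j. integrable lborel (\<alpha> i j)"
    "\<And>i j x. x \<notin> {a..b} \<Longrightarrow> \<alpha> i j x = 0" "\<And>i j. A $ i $ j = abs_L0 (\<alpha> i j)"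
    by (rule L1_matrix_representatives[OF A], rule that)
  have rhs: "in_Lp a b 1 ((0 - A *v y) $ i)" for i using y by (simp add: solves_cauchy_def)
  obtain h where h: "\<And>i. h i \<in> borel_measurable borel" "\<And>i. integrable lborel (h i)"
    "\<And>i x. x \<notin> {a..b} \<Longrightarrow> h i x = 0" "\<And>i. (0 - A *v y) $ i = abs_L0 (h i)"
    by (rule L1_vector_representatives[OF rhs], rule that)
  define z where "z x = (\<chi> i. primitive (h i) x)" for x
  have z_eq: "z x = primitive (\<lambda>s. \<chi> i. h i s) x" for x
    by (simp add: vec_eq_iff z_def primitive_vec_nth[OF integrable_vec_lambda[OF h(2)]])
  have z: "z \<in> bcontfun"
    unfolding z_eq[abs_def]
    by (rule bcontfun_normI[OF continuous_on_primitive norm_primitive_le]; rule integrable_vec_lambda[OF h(2)])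
  have yi: "y $ i = abs_L0 (\<lambda>x. indicator {a..b} x *\<^sub>R (z x $ i))" for i
    using y unfolding solves_cauchy_def h(4) by (simp add: ac_function_abs[OF h(1)] z_def)
  define \<phi> :: "'m \<Rightarrow> real \<Rightarrow> complex" where "\<phi> = (\<lambda>_ _. 0)"
  have \<phi>: "\<phi> i \<in> borel_measurable borel" "integrable lborel (\<phi> i)" "(0 :: L0 ^ 'm) $ i = abs_L0 (\<phi> i)" for i
    by (simp_all add: \<phi>_def zero_L0.abs_eq)
  note int = integrable_system_rhs[OF \<alpha>(2) \<phi>(2)]
  have "AE s in lborel. h i s = system_rhs \<alpha> \<phi> s (z s) $ i" for i
  proof -
    have m: "(\<lambda>s. system_rhs \<alpha> \<phi> s (z s) $ i) \<in> borel_measurable borel"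
      using borel_measurable_integrable[OF integrable_bounded_linear[OF bounded_linear_vec_nth int[OF z]]] by simp
    have "abs_L0 (h i) = abs_L0 (\<lambda>s. system_rhs \<alpha> \<phi> s (z s) $ i)"
      using rhs_abs_L0[OF \<alpha>(1,3,4) \<phi>(1,3) bcontfunD(1)[OF z] yi] h(4) by metis
    then show ?thesis using abs_L0_eq_iff[OF h(1) m] by blast
  qed
  then have prim: "primitive (h i) x = primitive (\<lambda>s. system_rhs \<alpha> \<phi> s (z s) $ i) x" for i x
    using h(1) borel_measurable_integrable[OF integrable_bounded_linear[OF bounded_linear_vec_nth int[OF z]]]
    by (intro primitive_cong_AE) auto
  define solution where
    "solution u \<longleftrightarrow> u \<in> bcontfun \<and> (\<forall>t. u t = 0 + primitive (\<lambda>s. system_rhs \<alpha> \<phi> s (u s)) t)" for u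
  have "z t $ i = primitive (\<lambda>s. system_rhs \<alpha> \<phi> s (z s)) t $ i" for t i
    unfolding primitive_vec_nth[OF int[OF z]] prim[symmetric] by (simp add: z_def)
  then have "solution z" using z by (simp add: solution_def vec_eq_iff)
  moreover have "solution (\<lambda>_. 0)"
    by (simp add: solution_def const_bcontfun system_rhs_def \<phi>_def primitive_def zero_vec_def[symmetric])
  moreover have "\<exists>!u. solution u"
    unfolding solution_def using \<alpha>(2,3) \<phi>(2) by (intro linear_integral_system[OF less_imp_le[OF ab]])
  ultimately have "z = (\<lambda>_. 0)" by blast
  then show ?thesis using yi by (simp add: vec_eq_iff zero_L0.abs_eq)
qed

section \<open>The differential operator\<close>

lemma subspace_sobolev_vec:
  assumes "a < b" "1 \<le> p"
  shows "complex_vector.subspace (sobolev_vec a b p k :: (L0 ^ 'm) set)"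
  using subspace_sobolev[OF assms, of k]
  by (auto simp: complex_vector.subspace_def sobolev_vec_def scaleC_vec_def)

lemma diff_op_nth: "diff_op a b A y $ i = derivative_L1 a b (y $ i) + (\<Sum>j\<in>UNIV. A $ i $ j * y $ j)"
  by (simp add: diff_op_def matrix_vector_mult_def)

lemma linear_operator_diff_op:
  assumes ab: "a < b" and p: "1 \<le> p" and A: "A \<in> sobolev_mat a b p k"
  shows "linear_operator (sobolev_vec a b p (Suc k)) (sobolev_vec a b p k) (diff_op a b A)"
proof -
  note W = subspace_sobolev[OF ab p, of k]
  have der: "has_derivative_L1 a b (y $ i) (derivative_L1 a b (y $ i))" "derivative_L1 a b (y $ i) \<in> sobolev a b p k"
    if "y \<in> sobolev_vec a b p (Suc k)" for y :: "L0 ^ 'm" and i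
    using that sobolev_Suc_iff[OF ab] by (auto simp: sobolev_vec_def simp del: sobolev.simps)
  have "diff_op a b A y \<in> sobolev_vec a b p k" if y: "y \<in> sobolev_vec a b p (Suc k)" for y
  proof -
    have yk: "y $ j \<in> sobolev a b p k" for j
      using y sobolev_Suc_subset unfolding sobolev_vec_def by blast
    have "A $ i $ j * y $ j \<in> sobolev a b p k" for i j
      by (rule sobolev_mult_closed[OF ab p _ yk der(1)[OF y]]) (use A in \<open>auto simp: sobolev_mat_def\<close>)
    then have "derivative_L1 a b (y $ i) + (\<Sum>j\<in>UNIV. A $ i $ j * y $ j) \<in> sobolev a b p k" for i
      by (intro complex_vector.subspace_add[OF W] complex_vector.subspace_sum[OF W] der(2)[OF y])
    then show ?thesis by (simp add: sobolev_vec_def diff_op_nth)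
  qed
  moreover have "diff_op a b A (y + z) = diff_op a b A y + diff_op a b A z"
    if "y \<in> sobolev_vec a b p (Suc k)" "z \<in> sobolev_vec a b p (Suc k)" for y z
    using derivative_L1_add[OF ab der(1)[OF that(1)] der(1)[OF that(2)]]
    by (simp add: diff_op_def vec_eq_iff matrix_vector_right_distrib)
  moreover have "diff_op a b A (c *\<^sub>C y) = c *\<^sub>C diff_op a b A y"
    if "y \<in> sobolev_vec a b p (Suc k)" for y c
    unfolding diff_op_def matrix_vector_mult_scaleC complex_vector.scale_right_distrib
    using derivative_L1_scaleC[OF ab der(1)[OF that]] by (simp add: vec_eq_iff scaleC_vec_def)
  ultimately show ?thesis by (auto simp: linear_operator_def)
qed

lemma bounded_diff_op:
  fixes A :: "L0 ^ 'm ^ 'm"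
  assumes ab: "a < b" and p: "1 \<le> p" and A: "A \<in> sobolev_mat a b p k"
  obtains C where "\<And>y. y \<in> sobolev_vec a b p (Suc k) \<Longrightarrow>
    sobolev_vec_norm a b p k (diff_op a b A y) \<le> C * sobolev_vec_norm a b p (Suc k) y"
proof -
  let ?N = "sobolev_norm a b p" and ?D = "derivative_L1 a b"
  obtain C where C: "0 \<le> C" and le:
    "\<And>f g. f \<in> sobolev a b p k \<Longrightarrow> g \<in> sobolev a b p (Suc k) \<Longrightarrow> ?N k (f * g) \<le> C * ?N k f * ?N (Suc k) g"
    using sobolev_mult_Suc[OF ab p] by blast
  define M where "M = (\<Sum>i\<in>UNIV. \<Sum>j\<in>UNIV. ?N k (A $ i $ j))"
  have nn: "0 \<le> ?N j f" for j f by (rule sobolev_norm_nonneg)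
  have AM: "(\<Sum>i\<in>UNIV. ?N k (A $ i $ j)) \<le> M" for j
    unfolding M_def by (intro sum_mono member_le_sum) (auto simp: nn)
  have "sobolev_vec_norm a b p k (diff_op a b A y) \<le> (1 + C * M) * sobolev_vec_norm a b p (Suc k) y"
    if y: "y \<in> sobolev_vec a b p (Suc k)" for y
  proof -
    have AW: "A $ i $ j \<in> sobolev a b p k" and yW: "y $ j \<in> sobolev a b p (Suc k)" for i j
      using A y by (auto simp: sobolev_mat_def sobolev_vec_def simp del: sobolev.simps)
    have yd: "y $ j \<in> sobolev a b p k" "has_derivative_L1 a b (y $ j) (?D (y $ j))" "?D (y $ j) \<in> sobolev a b p k" for j
      using yW[of j] sobolev_Suc_subset sobolev_Suc_iff[OF ab] by blast+
    have prod: "A $ i $ j * y $ j \<in> sobolev a b p k" for i j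
      by (rule sobolev_mult_closed[OF ab p AW yd(1,2)])
    have "?N k (diff_op a b A y $ i) \<le> ?N (Suc k) (y $ i) + (\<Sum>j\<in>UNIV. C * ?N k (A $ i $ j) * ?N (Suc k) (y $ j))" for i
    proof -
      have "?N k (diff_op a b A y $ i) \<le> ?N k (?D (y $ i)) + ?N k (\<Sum>j\<in>UNIV. A $ i $ j * y $ j)"
        unfolding diff_op_nth
        by (intro sobolev_norm_add[OF ab p] yd complex_vector.subspace_sum[OF subspace_sobolev[OF ab p]] prod)
      also have "?N k (\<Sum>j\<in>UNIV. A $ i $ j * y $ j) \<le> (\<Sum>j\<in>UNIV. ?N k (A $ i $ j * y $ j))"
        by (rule sobolev_norm_sum[OF ab p]) (auto simp: prod)
      also have "\<dots> \<le> (\<Sum>j\<in>UNIV. C * ?N k (A $ i $ j) * ?N (Suc k) (y $ j))"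
        by (intro sum_mono le AW yW)
      also have "?N k (?D (y $ i)) \<le> ?N (Suc k) (y $ i)"
        by (simp add: sobolev_norm_Suc Lp_norm_nonneg)
      finally show ?thesis by simp
    qed
    then have "sobolev_vec_norm a b p k (diff_op a b A y) \<le>
        (\<Sum>i\<in>UNIV. ?N (Suc k) (y $ i) + (\<Sum>j\<in>UNIV. C * ?N k (A $ i $ j) * ?N (Suc k) (y $ j)))"
      unfolding sobolev_vec_norm_def by (rule sum_mono)
    also have "\<dots> = sobolev_vec_norm a b p (Suc k) y +
        (\<Sum>j\<in>UNIV. C * (\<Sum>i\<in>UNIV. ?N k (A $ i $ j)) * ?N (Suc k) (y $ j))"
      unfolding sum.distrib sobolev_vec_norm_def
      by (subst sum.swap) (simp add: sum_distrib_left sum_distrib_right)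
    also have "\<dots> \<le> sobolev_vec_norm a b p (Suc k) y + (\<Sum>j\<in>UNIV. C * M * ?N (Suc k) (y $ j))"
      using AM C nn by (intro add_left_mono sum_mono mult_right_mono mult_left_mono) auto
    also have "\<dots> = (1 + C * M) * sobolev_vec_norm a b p (Suc k) y"
      by (simp add: sobolev_vec_norm_def sum_distrib_left distrib_right sum.distrib)
    finally show ?thesis .
  qed
  then show ?thesis by (rule that)
qed

text \<open>As long as \<open>j \<le> k\<close>, a solution \<open>y\<close> in \<open>W\<^sub>p\<^sup>j\<close> has \<open>A y\<close>, hence \<open>y' = f - A y\<close>, in \<open>W\<^sub>p\<^sup>j\<close>, so it lies in
  \<open>W\<^sub>p\<^sup>j\<^sup>+\<^sup>1\<close>. The induction starts because \<open>y\<close> is bounded.\<close>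

lemma cauchy_solution_regular:
  fixes A :: "L0 ^ 'm ^ 'm"
  assumes ab: "a < b" and p: "1 \<le> p" and A: "A \<in> sobolev_mat a b p k" and f: "f \<in> sobolev_vec a b p k"
    and y: "solves_cauchy a b A f c y"
  shows "y \<in> sobolev_vec a b p (Suc k)" "diff_op a b A y = f"
proof -
  let ?r = "\<lambda>i. (f - A *v y) $ i"
  have r: "in_Lp a b 1 (?r i)" "y $ i = ac_function a b (c $ i) (?r i)" for i
    using y by (auto simp: solves_cauchy_def)
  have der: "has_derivative_L1 a b (y $ i) (?r i)" for i
    by (subst r(2)) (rule has_derivative_ac[OF ab r(1)])
  have yp: "in_Lp a b p (y $ i)" for i by (subst r(2)) (rule Lp_ac[OF ab p r(1)])
  have "\<forall>i. y $ i \<in> sobolev a b p j" if "j \<le> Suc k" for j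
    using that
  proof (induction j)
    case 0
    show ?case using yp by simp
  next
    case (Suc j)
    note W = subspace_sobolev[OF ab p, of j]
    have "sobolev a b p k \<subseteq> sobolev a b p j" using Suc.prems by (intro sobolev_antimono) simp
    then have "A $ i $ l \<in> sobolev a b p j" "f $ i \<in> sobolev a b p j" for i l
      using A f by (auto simp: sobolev_mat_def sobolev_vec_def)
    then have "?r i \<in> sobolev a b p j" for i
      using Suc by (auto simp: matrix_vector_mult_def
          intro!: complex_vector.subspace_diff[OF W] complex_vector.subspace_sum[OF W] sobolev_mult_closed[OF ab p _ _ der])
    then show ?case using yp der by auto
  qed
  then show "y \<in> sobolev_vec a b p (Suc k)" unfolding sobolev_vec_def by blast
  show "diff_op a b A y = f"
    using derivative_L1_eq[OF ab der] by (simp add: vec_eq_iff diff_op_def)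
qed

lemma solves_cauchy_of_diff_op:
  fixes A :: "L0 ^ 'm ^ 'm"
  assumes ab: "a < b" and y: "y \<in> sobolev_vec a b p (Suc k)"
  obtains c where "solves_cauchy a b A (diff_op a b A y) c y"
proof -
  have der: "has_derivative_L1 a b (y $ i) (derivative_L1 a b (y $ i))" for i
    using y sobolev_Suc_iff[OF ab] by (auto simp: sobolev_vec_def simp del: sobolev.simps)
  then have "\<forall>i. \<exists>c. y $ i = ac_function a b c (derivative_L1 a b (y $ i))"
    using has_derivative_imp_ac[OF ab] by metis
  then obtain c where c: "\<And>i. y $ i = ac_function a b (c i) (derivative_L1 a b (y $ i))" by metis
  have "solves_cauchy a b A (diff_op a b A y) (\<chi> i. c i) y"
    using c der by (simp add: solves_cauchy_def diff_op_def has_derivative_L1_def)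
  then show ?thesis by (rule that)
qed

text \<open>The map \<open>S\<close> from initial values to solutions of the homogeneous equation is linear, injective and onto
  the kernel, so it carries a basis of \<open>\<complex>\<^sup>m\<close> to a basis of the kernel.\<close>

lemma kernel_diff_op_basis:
  fixes A :: "L0 ^ 'm ^ 'm"
  assumes ab: "a < b" and p: "1 \<le> p" and A: "A \<in> sobolev_mat a b p k"
  obtains E where "finite E" "complex_vector.independent E"
    "complex_vector.span E = kernel (sobolev_vec a b p (Suc k)) (diff_op a b A)" "card E = CARD('m)"
proof -
  have "in_Lp a b p (A $ i $ j)" for i j using A unfolding sobolev_mat_def by (blast intro: sobolev_imp_Lp)
  then have A1: "in_Lp a b 1 (A $ i $ j)" for i j by (rule Lp_imp_L1(1)[OF less_imp_le[OF ab] p])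
  define S where "S c = (SOME y. solves_cauchy a b A 0 c y)" for c
  have S: "solves_cauchy a b A 0 c (S c)" for c
  proof -
    obtain y where "solves_cauchy a b A 0 c y"
      by (rule cauchy_problem_solvable[OF ab A1, of 0 c]) (simp add: Lp_zero)
    then show ?thesis unfolding S_def by (rule someI)
  qed
  have uniq: "y = z" if y: "solves_cauchy a b A 0 c y" and z: "solves_cauchy a b A 0 c z" for c y z
  proof -
    have "solves_cauchy a b A (0 + (-1) *\<^sub>C 0) (c + (-1) *\<^sub>C c) (y + (-1) *\<^sub>C z)"
      by (intro solves_cauchy_add solves_cauchy_scaleC y z)
    then have "solves_cauchy a b A 0 0 (y - z)" by (simp add: complex_vector.scale_minus_left)
    then show ?thesis using cauchy_problem_zero[OF ab A1] by force
  qed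
  interpret S: Vector_Spaces.linear "scaleC :: complex \<Rightarrow> complex ^ 'm \<Rightarrow> _" "scaleC :: complex \<Rightarrow> L0 ^ 'm \<Rightarrow> _" S
  proof (unfold_locales)
    show "S (x + y) = S x + S y" for x y
      using uniq[OF S] solves_cauchy_add[OF S S, of x y] by simp
    show "S (r *\<^sub>C x) = r *\<^sub>C S x" for r x
      using uniq[OF S] solves_cauchy_scaleC[OF S, of r x] by simp
  qed
  have inj: "inj S"
  proof (rule injI)
    fix c d assume "S c = S d"
    then have c: "solves_cauchy a b A 0 c (S c)" and d: "solves_cauchy a b A 0 d (S c)" using S by metis+
    have "c $ i = d $ i" for i
      using c d ac_function_inject[OF ab] unfolding solves_cauchy_def by metis
    then show "c = d" by (simp add: vec_eq_iff)
  qed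
  have range: "range S = kernel (sobolev_vec a b p (Suc k)) (diff_op a b A)"
  proof (intro equalityI subsetI)
    have 0: "0 \<in> sobolev_vec a b p k" by (rule complex_vector.subspace_0[OF subspace_sobolev_vec[OF ab p]])
    fix y assume "y \<in> range S"
    then show "y \<in> kernel (sobolev_vec a b p (Suc k)) (diff_op a b A)"
      using cauchy_solution_regular[OF ab p A 0 S] by (auto simp: kernel_def simp del: sobolev.simps)
  next
    fix y assume "y \<in> kernel (sobolev_vec a b p (Suc k)) (diff_op a b A)"
    then have y: "y \<in> sobolev_vec a b p (Suc k)" "diff_op a b A y = 0" by (auto simp: kernel_def)
    obtain c where "solves_cauchy a b A 0 c y" using solves_cauchy_of_diff_op[OF ab y(1), of A] y(2) by metis
    then show "y \<in> range S" using uniq[OF S] by blast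
  qed
  obtain B :: "(complex ^ 'm) set" where B: "complex_vector.independent B" "complex_vector.span B = UNIV"
    using complex_vector.independent_extend_basis[OF complex_vector.independent_empty]
      complex_vector.span_extend_basis[OF complex_vector.independent_empty] by blast
  show ?thesis
  proof (rule that)
    show "finite (S ` B)" using card_basis_complex_vec[OF B] by simp
    show "complex_vector.independent (S ` B)"
      by (rule S.independent_injective_image[OF B(1)]) (use inj in \<open>auto intro: inj_on_subset\<close>)
    show "complex_vector.span (S ` B) = kernel (sobolev_vec a b p (Suc k)) (diff_op a b A)"
      using S.span_image[of B] B(2) range by simp
    show "card (S ` B) = CARD('m)"
      using card_image[OF inj_on_subset[OF inj subset_UNIV], of B] card_basis_complex_vec[OF B] by simp
  qed
qed

lemma diff_op_surjective:
  fixes A :: "L0 ^ 'm ^ 'm"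
  assumes ab: "a < b" and p: "1 \<le> p" and A: "A \<in> sobolev_mat a b p k"
  shows "diff_op a b A ` sobolev_vec a b p (Suc k) = sobolev_vec a b p k"
proof (intro equalityI subsetI)
  fix f assume "f \<in> diff_op a b A ` sobolev_vec a b p (Suc k)"
  then show "f \<in> sobolev_vec a b p k" using linear_operator_diff_op[OF assms] by (auto simp: linear_operator_def)
next
  fix f :: "L0 ^ 'm" assume f: "f \<in> sobolev_vec a b p k"
  have "in_Lp a b p (A $ i $ j)" "in_Lp a b p (f $ i)" for i j
    using A f unfolding sobolev_mat_def sobolev_vec_def by (blast intro: sobolev_imp_Lp)+
  then have L1: "in_Lp a b 1 (A $ i $ j)" "in_Lp a b 1 (f $ i)" for i j
    using Lp_imp_L1(1)[OF less_imp_le[OF ab] p] by blast+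
  obtain y where "solves_cauchy a b A f 0 y" by (rule cauchy_problem_solvable[OF ab L1])
  then show "f \<in> diff_op a b A ` sobolev_vec a b p (Suc k)"
    using cauchy_solution_regular[OF ab p A f] by blast
qed

section \<open>Bounded and continuous operators\<close>

lemma bounded_linear_operator_imp_continuous:
  assumes X: "complex_vector.subspace X" and nX: "\<And>x. 0 \<le> nX x"
    and T: "bounded_linear_operator X nX Y nY T"
  shows "continuous_linear_operator X nX Y nY T"
  unfolding continuous_linear_operator_def
proof (intro conjI ballI allI impI)
  show lin: "linear_operator X Y T" using T by (simp add: bounded_linear_operator_def)
  obtain C where C: "\<And>x. x \<in> X \<Longrightarrow> nY (T x) \<le> C * nX x" using T by (auto simp: bounded_linear_operator_def)
  fix x and \<epsilon> :: real assume x: "x \<in> X" and \<epsilon>: "0 < \<epsilon>"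
  define D where "D = max C 1"
  have D: "0 < D" "C \<le> D" by (auto simp: D_def)
  show "\<exists>\<delta>>0. \<forall>y\<in>X. nX (y - x) < \<delta> \<longrightarrow> nY (T y - T x) < \<epsilon>"
  proof (intro exI[of _ "\<epsilon> / D"] conjI ballI impI)
    fix y assume y: "y \<in> X" and near: "nX (y - x) < \<epsilon> / D"
    have "nY (T y - T x) = nY (T (y - x))" by (simp add: linear_operator_diff[OF lin X y x])
    also have "\<dots> \<le> C * nX (y - x)" using C complex_vector.subspace_diff[OF X y x] by blast
    also have "\<dots> \<le> D * nX (y - x)" using nX D by (intro mult_right_mono)
    also have "\<dots> < \<epsilon>" using near D by (simp add: pos_less_divide_eq mult.commute)
    finally show "nY (T y - T x) < \<epsilon>" .
  qed (use \<epsilon> D in simp)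
qed

lemma continuous_linear_operator_imp_bounded:
  fixes B :: "'a::complex_vector \<Rightarrow> complex ^ 'r"
  assumes X: "complex_vector.subspace X" and nX: "\<And>x. 0 \<le> nX x" "\<And>c x. x \<in> X \<Longrightarrow> nX (c *\<^sub>C x) \<le> cmod c * nX x"
    and B: "continuous_linear_operator X nX UNIV norm B"
  shows "bounded_linear_operator X nX UNIV norm B"
proof -
  have lin: "linear_operator X UNIV B" using B by (simp add: continuous_linear_operator_def)
  have "\<forall>\<epsilon>>0. \<exists>\<delta>>0. \<forall>y\<in>X. nX (y - 0) < \<delta> \<longrightarrow> norm (B y - B 0) < \<epsilon>"
    using B complex_vector.subspace_0[OF X] unfolding continuous_linear_operator_def by blast
  then obtain \<delta> where \<delta>: "0 < \<delta>" "\<And>y. y \<in> X \<Longrightarrow> nX y < \<delta> \<Longrightarrow> norm (B y) < 1"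
    using linear_operator_zero[OF lin X] by (metis diff_zero zero_less_one)
  have "norm (B y) \<le> 2 / \<delta> * nX y" if y: "y \<in> X" for y
  proof (rule field_le_epsilon)
    fix e :: real assume e: "0 < e"
    \<comment> \<open>The second summand keeps \<open>r\<close> positive even where \<open>nX y = 0\<close>.\<close>
    define r where "r = nX y + e * \<delta> / 2"
    have r: "0 < r" "nX y \<le> r" using nX(1)[of y] e \<delta>(1) by (simp_all add: r_def add_nonneg_pos)
    define t where "t = \<delta> / (2 * r)"
    have t: "0 < t" using \<delta>(1) r by (simp add: t_def)
    have tX: "complex_of_real t *\<^sub>C y \<in> X" by (rule complex_vector.subspace_scale[OF X y])
    have "nX (complex_of_real t *\<^sub>C y) \<le> t * nX y" using nX(2)[OF y, of "complex_of_real t"] t by simp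
    also have "\<dots> \<le> t * r" using r t by (intro mult_left_mono) auto
    also have "\<dots> < \<delta>" using r \<delta>(1) by (simp add: t_def)
    finally have "norm (B (complex_of_real t *\<^sub>C y)) < 1" using \<delta>(2)[OF tX] by blast
    moreover have "B (complex_of_real t *\<^sub>C y) = t *\<^sub>R B y"
      unfolding linear_operator_scale[OF lin y]
      by (simp add: vec_eq_iff scaleC_vec_def scaleC_complex_def scaleR_conv_of_real[where 'a=complex])
    ultimately have "t * norm (B y) < 1" using t by simp
    then have "norm (B y) \<le> 1 / t" using t by (simp add: field_simps)
    also have "1 / t = 2 / \<delta> * nX y + e" using \<delta>(1) r by (simp add: t_def r_def field_simps)
    finally show "norm (B y) \<le> 2 / \<delta> * nX y + e" .
  qed
  then show ?thesis using lin unfolding bounded_linear_operator_def by blast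
qed

section \<open>The Fredholm property\<close>

theorem theorem1:
  fixes a b :: real and p :: ennreal and n :: nat
    and A :: "L0 ^ 'm ^ 'm"
    and B :: "L0 ^ 'm \<Rightarrow> complex ^ 'r"
  assumes "a < b" and "1 \<le> p" and "1 \<le> n"
    and "A \<in> sobolev_mat a b p (n - 1)"
    and "continuous_linear_operator
           (sobolev_vec a b p n) (sobolev_vec_norm a b p n) UNIV norm B"
  defines "X \<equiv> sobolev_vec a b p n :: (L0 ^ 'm) set"
    and "nX \<equiv> sobolev_vec_norm a b p n"
    and "Y \<equiv> sobolev_vec a b p (n - 1) \<times> (UNIV :: (complex ^ 'r) set)"
    and "nY \<equiv> (\<lambda>(f, c). sobolev_vec_norm a b p (n - 1) f + norm c)"
    and "T \<equiv> (\<lambda>y. (diff_op a b A y, B y))"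
  shows "bounded_linear_operator X nX Y nY T \<and>
         fredholm_operator X nX Y nY T \<and>
         fredholm_index X Y T = int CARD('m) - int CARD('r)"
proof -
  obtain k where n: "n = Suc k" "n - 1 = k" using assms(3) by (cases n) auto
  note ab = assms(1) and p = assms(2) and A = assms(4)[unfolded n(2)]
  have X: "complex_vector.subspace X" unfolding X_def by (rule subspace_sobolev_vec[OF ab p])
  have L: "linear_operator X (sobolev_vec a b p k) (diff_op a b A)"
    unfolding X_def n(1) by (rule linear_operator_diff_op[OF ab p A])
  have nX: "0 \<le> nX x" for x
    by (simp add: nX_def sobolev_vec_norm_def sum_nonneg sobolev_norm_nonneg)
  have nX_scale: "nX (c *\<^sub>C x) \<le> cmod c * nX x" if "x \<in> X" for c x
  proof -
    have "(\<Sum>i\<in>UNIV. sobolev_norm a b p n (c *\<^sub>C (x $ i))) \<le> (\<Sum>i\<in>UNIV. cmod c * sobolev_norm a b p n (x $ i))"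
      using that by (intro sum_mono sobolev_norm_scaleC[OF ab p]) (auto simp: X_def sobolev_vec_def)
    then show ?thesis by (simp add: nX_def sobolev_vec_norm_def scaleC_vec_def sum_distrib_left)
  qed
  have "bounded_linear_operator X nX UNIV norm B"
    using assms(5) by (intro continuous_linear_operator_imp_bounded X nX nX_scale) (simp_all add: X_def nX_def)
  then obtain K where B: "linear_operator X UNIV B" and K: "\<And>x. x \<in> X \<Longrightarrow> norm (B x) \<le> K * nX x"
    by (auto simp: bounded_linear_operator_def)
  obtain C where C: "\<And>y. y \<in> X \<Longrightarrow> sobolev_vec_norm a b p k (diff_op a b A y) \<le> C * nX y"
    unfolding X_def nX_def n(1) using bounded_diff_op[OF ab p A] by blast
  have T: "linear_operator X Y T"
    using L B unfolding Y_def T_def n(2) by (auto simp: linear_operator_def scaleC_prod_def)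
  have "nY (T y) \<le> (C + K) * nX y" if "y \<in> X" for y
    using C[OF that] K[OF that] by (simp add: nY_def T_def n distrib_right)
  then have bounded: "bounded_linear_operator X nX Y nY T"
    using T by (auto simp: bounded_linear_operator_def)
  obtain E where E: "finite E" "complex_vector.independent E"
    "complex_vector.span E = kernel X (diff_op a b A)" "card E = CARD('m)"
    using kernel_diff_op_basis[OF ab p A] unfolding X_def n(1) by blast
  have onto: "diff_op a b A ` X = sobolev_vec a b p k"
    unfolding X_def n(1) by (rule diff_op_surjective[OF ab p A])
  note index = index_of_augmented_surjection[OF X L onto B E(1-3), folded T_def]
  have "fredholm_operator X nX Y nY T"
    using bounded_linear_operator_imp_continuous[OF X nX bounded] index
    unfolding fredholm_operator_def Y_def n(2) by blast
  then show ?thesis using bounded index(3) E(4) unfolding Y_def n(2) by simp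
qed

end
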